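(* Let $S^1\subset\mathbb{C}$ be the unit circle and $\overline{\mathbb{Q}}\subset\mathbb{C}$ the set of algebraic numbers. For every $\omega \in S^1 \setminus \overline{\mathbb{Q}}$ there exists a constant $c>0$ (depending on $\omega$ only, and in particular not on $n$) such that for all $n \in \mathbb{N}$: $$\liminf \left\{\frac{\sigma_{\omega}(\beta)}{b_1(\beta)} \;\middle|\; \beta \in B_n^+ \right\}\geq c,$$ where $\sigma_\omega(\beta)$ is the Levine-Tristram signature at $\omega$ of the closure of the positive braid $\beta$, $b_1(\beta)$ is the first Betti number of the canonical Seifert surface of $\beta$, and the limit inferior is taken as $b_1(\beta)\to\infty$ with $\beta\in B_n^+$, $n$ fixed.
   Context: $B_n^+$ denotes the monoid of positive braids on $n$ strands, i.e. the monoid of products of the standard (positive) generators $\sigma_1,\dots,\sigma_{n-1}$ of the braid group $B_n$. The canonical Seifert surface of (the closure of) a positive braid $\beta\in B_n^+$ is obtained from $n$ parallel discs, one per strand, by connecting the $i$-th and $(i+1)$-st discs by a half-twisted band for each occurrence of $\sigma_i$ in a positive word for $\beta$; $b_1(\beta)$ is its first Betti number. (If $\beta$ is non-split, i.e. contains every generator at least once, then $b_1(\beta)=\ell(\beta)-n+1$, with $\ell(\beta)$ the word length.) For $\omega\in S^1$ and a link $L$ with Seifert matrix $V$, the Levine-Tristram signature $\sigma_\omega(L)$ is the signature (number of positive eigenvalues minus number of negative eigenvalues) of the Hermitian matrix $$M_\omega=(1-\omega)V+(1-\bar\omega)V^T.$$ For $\beta \in B_n^+$, $\sigma_\omega(\beta)$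 denotes $\sigma_\omega$ of the closure of $\beta$. The sign convention is the one for which positive braids have positive signature: e.g. the closure of $\sigma_1^3\in B_2^+$ (trefoil) has $\sigma_{-1}=+2$. Meaning of the limit inferior: for fixed $n$ there are only finitely many $\beta\in B_n^+$ with $b_1(\beta)$ below any given bound, and "$\liminf\{f(\beta)\mid\beta\in B_n^+\}\ge c$" means that for every $\varepsilon>0$ there is $K$ such that $f(\beta)\ge c-\varepsilon$ for all $\beta\in B_n^+$ with $b_1(\beta)\ge K$ (vacuous for $n=1$). *)

theory Defs
  imports
    Complex_Main
    "HOL-Library.Extended_Real"
    "HOL-Computational_Algebra.Polynomial"
    "Jordan_Normal_Form.Char_Poly"
begin

section \<open>Positive braids\<close>

text \<open>
  Elements of the braid group are represented by words in signed generators: \<open>(True, i)\<close> stands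
  for the generator \<open>s\<^sub>i\<close> and \<open>(False, i)\<close> for its inverse, where \<open>1 \<le> i < n\<close>. The relation
  \<^term>\<open>equivclp\<close> of one-step rewriting below is equality in the Artin presentation.
\<close>

type_synonym signed_word = "(bool \<times> nat) list"

inductive braid_step :: "nat \<Rightarrow> signed_word \<Rightarrow> signed_word \<Rightarrow> bool" for n :: nat where
  cancel: "i \<in> {1..<n} \<Longrightarrow> braid_step n (u @ [(e, i), (\<not> e, i)] @ v) (u @ v)"
| commute: "i \<in> {1..<n} \<Longrightarrow> j \<in> {1..<n} \<Longrightarrow> i + 2 \<le> j \<Longrightarrow>
    braid_step n (u @ [(True, i), (True, j)] @ v) (u @ [(True, j), (True, i)] @ v)"
| braid: "i \<in> {1..<n} \<Longrightarrow> Suc i \<in> {1..<n} \<Longrightarrow>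
    braid_step n (u @ [(True, i), (True, Suc i), (True, i)] @ v)
                 (u @ [(True, Suc i), (True, i), (True, Suc i)] @ v)"

definition braid_class :: "nat \<Rightarrow> signed_word \<Rightarrow> signed_word set" where
  "braid_class n u = {v. equivclp (braid_step n) u v}"

definition positive_words :: "nat \<Rightarrow> nat list set" where
  "positive_words n = {w. set w \<subseteq> {1..<n}}"

definition braid_of_word :: "nat \<Rightarrow> nat list \<Rightarrow> signed_word set" where
  "braid_of_word n w = braid_class n (map (Pair True) w)"

definition positive_braids :: "nat \<Rightarrow> signed_word set set" where
  "positive_braids n = braid_of_word n ` positive_words n"

text \<open>
  The quantities attached to a positive braid below are computed from the canonical Seifert surface
  of a positive word for it; they do not depend on which word is taken.
\<close>

definition word_of_braid :: "nat \<Rightarrow> signed_word set \<Rightarrow> nat list" where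
  "word_of_braid n \<beta> = (SOME w. w \<in> positive_words n \<and> braid_of_word n w = \<beta>)"


section \<open>First Betti number of the canonical Seifert surface\<close>

text \<open>
  The surface retracts onto the graph with one vertex per disc and one edge per band, so its first
  Betti number is the number of edges plus the number of components minus the number of vertices.
  The subtraction never truncates, as a graph has at least (vertices minus edges) components.
\<close>

definition disc_adjacency :: "nat list \<Rightarrow> (nat \<times> nat) set" where
  "disc_adjacency w = (\<lambda>i. (i, Suc i)) ` set w"

definition surface_components :: "nat \<Rightarrow> nat list \<Rightarrow> nat set set" where
  "surface_components n w = {1..n} // (disc_adjacency w \<union> (disc_adjacency w)\<inverse>)\<^sup>*"

definition word_b1 :: "nat \<Rightarrow> nat list \<Rightarrow> nat" where
  "word_b1 n w = length w + card (surface_components n w) - n"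

lemma word_b1_nonsplit:
  assumes n: "n \<ge> 1" and w: "set w = {1..<n}"
  shows "word_b1 n w = length w + 1 - n"
proof -
  define r where "r = (disc_adjacency w \<union> (disc_adjacency w)\<inverse>)\<^sup>*"
  have "equiv UNIV r"
    unfolding r_def by (intro equivI refl_rtrancl sym_rtrancl trans_rtrancl) (auto simp: sym_def)
  have "(1, x) \<in> r" if "1 \<le> x" "x \<le> n" for x
    using that
  proof (induction x rule: dec_induct)
    case base
    show ?case by (simp add: r_def)
  next
    case (step x)
    then have "(x, Suc x) \<in> disc_adjacency w \<union> (disc_adjacency w)\<inverse>"
      by (auto simp: disc_adjacency_def w)
    moreover have "(1, x) \<in> r"
      using step by simp
    ultimately show ?case
      unfolding r_def by (rule rtrancl_into_rtrancl[rotated])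
  qed
  then have *: "r `` {x} = r `` {1}" if "x \<in> {1..n}" for x
    using that by (intro equiv_class_eq[OF \<open>equiv UNIV r\<close>, symmetric]) auto
  have "X \<in> {1..n} // r \<longleftrightarrow> X = r `` {1}" for X
  proof
    assume "X \<in> {1..n} // r"
    then obtain x where "x \<in> {1..n}" "X = r `` {x}" by (rule quotientE)
    then show "X = r `` {1}" using *[of x] by simp
  next
    assume "X = r `` {1}"
    then show "X \<in> {1..n} // r" using n quotientI[of 1 "{1..n}" r] by simp
  qed
  then have "surface_components n w = {r `` {1}}"
    unfolding surface_components_def r_def[symmetric] by blast
  then show ?thesis by (simp add: word_b1_def)
qed

definition braid_b1 :: "nat \<Rightarrow> signed_word set \<Rightarrow> nat" where
  "braid_b1 n \<beta> = word_b1 n (word_of_braid n \<beta>)"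


section \<open>Linking numbers of rectilinear loops\<close>

text \<open>
  A loop in 3-space is given by the corners of a diagram consisting of vertical and horizontal
  segments, in which every vertical segment passes over every horizontal one (a grid diagram).
  The linking number of two disjoint loops \<open>a\<close>, \<open>b\<close> is the sum of the usual (right-handed positive)
  signs of the crossings at which \<open>a\<close> passes over \<open>b\<close>; a vertical segment of direction \<open>(0, p)\<close>
  passing over a horizontal one of direction \<open>(q, 0)\<close> has sign \<open>- sgn p * sgn q\<close>.
\<close>

type_synonym point = "int \<times> int"

definition segments :: "point list \<Rightarrow> (point \<times> point) list" where
  "segments p = zip p (rotate1 p)"

fun crossing_sign :: "point \<times> point \<Rightarrow> point \<times> point \<Rightarrow> int" where
  "crossing_sign ((x, z), (x', z')) ((u, t), (u', t')) =
     (if x = x' \<and> t = t' \<and> t \<in> {min z z'<..<max z z'} \<and> x \<in> {min u u'<..<max u u'}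
      then - sgn (z' - z) * sgn (u' - u) else 0)"

definition linking_number :: "point list \<Rightarrow> point list \<Rightarrow> int" where
  "linking_number a b = (\<Sum>e\<leftarrow>segments a. \<Sum>f\<leftarrow>segments b. crossing_sign e f)"


section \<open>Seifert matrix of the canonical Seifert surface\<close>

text \<open>
  Let \<open>w\<close> be a positive word. View the surface from the side where the bands are attached:
  disc \<open>i\<close> is a horizontal disc at height \<open>i\<close>, seen edge-on, with its positive side facing up, and
  the letter \<open>w ! k = i\<close> gives a band at abscissa \<open>k\<close> in front of the discs, running vertically from
  height \<open>i\<close> to height \<open>i + 1\<close>. All coordinates are doubled, so that half units are integers.

  Two consecutive occurrences \<open>k < l\<close> of the same letter \<open>i\<close> bound a brick. The loop around it runs
  up band \<open>k\<close>, along disc \<open>i + 1\<close> to band \<open>l\<close>, down that band and back along disc \<open>i\<close>; its vertical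
  segments lie in front of all arcs on discs. The loops of all bricks form a basis of the first
  homology of the surface.

  The push-off in the positive normal direction lies above the loop on the discs. Along a band it
  starts behind the band at the lower disc (because the surface turns upwards there) and ends in
  front of it at the upper disc, and the half twist takes it around one vertical edge of the band.
  Hence the push-off is isotopic, in the complement of all brick loops, to the loop displaced by half
  a unit upwards and half a unit to that side. The side is determined by the sense of
  the half twists. It is taken to be the left, the convention under which every brick loop has self-linking
  \<open>+1\<close> and positive braids have positive signatures.
\<close>

definition bricks :: "nat list \<Rightarrow> (nat \<times> nat) list" where
  "bricks w = filter (\<lambda>(k, l). k < l \<and> w ! k = w ! l \<and> (\<forall>j\<in>{k<..<l}. w ! j \<noteq> w ! k))
     (List.product [0..<length w] [0..<length w])"

definition brick_loop :: "nat list \<Rightarrow> nat \<times> nat \<Rightarrow> point list" where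
  "brick_loop w = (\<lambda>(k, l). let i = w ! k in
     [(2 * int k, 2 * int i), (2 * int k, 2 * (int i + 1)),
      (2 * int l, 2 * (int i + 1)), (2 * int l, 2 * int i)])"

definition push_off :: "point list \<Rightarrow> point list" where
  "push_off p = map (\<lambda>(x, z). (x - 1, z + 1)) p"

definition seifert_matrix :: "nat list \<Rightarrow> int mat" where
  "seifert_matrix w = mat (length (bricks w)) (length (bricks w))
     (\<lambda>(a, b). linking_number (brick_loop w (bricks w ! a)) (push_off (brick_loop w (bricks w ! b))))"


section \<open>Levine-Tristram signatures\<close>

text \<open>
  Eigenvalues are counted with algebraic multiplicity. The definition is meant for Hermitian
  matrices, whose eigenvalues are real.
\<close>

definition matrix_signature :: "complex mat \<Rightarrow> int" where
  "matrix_signature A =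
     int (size (filter_mset (\<lambda>x. Re x > 0) (proots (char_poly A)))) -
     int (size (filter_mset (\<lambda>x. Re x < 0) (proots (char_poly A))))"

definition levine_tristram_matrix :: "complex \<Rightarrow> int mat \<Rightarrow> complex mat" where
  "levine_tristram_matrix \<omega> V =
     (1 - \<omega>) \<cdot>\<^sub>m map_mat of_int V + (1 - cnj \<omega>) \<cdot>\<^sub>m transpose_mat (map_mat of_int V)"

definition braid_signature :: "nat \<Rightarrow> complex \<Rightarrow> signed_word set \<Rightarrow> int" where
  "braid_signature n \<omega> \<beta> =
     matrix_signature (levine_tristram_matrix \<omega> (seifert_matrix (word_of_braid n \<beta>)))"

text \<open>The normalisation of signs: the trefoil has signature \<open>2\<close> at \<open>\<omega> = -1\<close>.\<close>

lemma seifert_matrix_trefoil: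
  "seifert_matrix [1, 1, 1] = mat 2 2 (\<lambda>(a, b). if a = b then 1 else if a < b then -1 else 0)"
proof -
  have "bricks [1, 1, 1] = [(0, 1), (1, 2)]"
    by code_simp
  then show ?thesis
    by (intro eq_matI)
      (auto simp: seifert_matrix_def linking_number_def segments_def brick_loop_def push_off_def
        less_2_cases_iff)
qed

lemma trefoil_signature:
  "matrix_signature (levine_tristram_matrix (-1) (seifert_matrix [1, 1, 1])) = 2"
proof -
  have det: "det A = A $$ (0, 0) * A $$ (1, 1) - A $$ (0, 1) * A $$ (1, 0)"
    if A: "A \<in> carrier_mat 2 2" for A :: "complex poly mat"
    using A
    by (subst laplace_expansion_row[OF A, of 0])
       (auto simp: numeral_2_eq_2 cofactor_def det_single mat_delete_def)
  have "char_poly (levine_tristram_matrix (-1) (seifert_matrix [1, 1, 1])) = [:-2, 1:] * [:-6, 1:]"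
    unfolding seifert_matrix_trefoil char_poly_def
    by (subst det) (auto simp: char_poly_matrix_def levine_tristram_matrix_def)
  moreover have "proots ([:-2, 1:] * [:-6, 1:] :: complex poly) = {#2, 6#}"
    by (subst proots_mult) auto
  ultimately show ?thesis by (simp add: matrix_signature_def)
qed


section \<open>The limit over positive braids of fixed index\<close>

text \<open>
  For \<open>n \<le> 1\<close> this filter is trivial, and a limit inferior along it is \<open>\<infinity>\<close>.
\<close>

definition b1_to_infinity :: "nat \<Rightarrow> signed_word set filter" where
  "b1_to_infinity n = inf (filtercomap (braid_b1 n) at_top) (principal (positive_braids n))"

end

theory Submission
  imports "HOL-Analysis.Weierstrass_Theorems" "Jordan_Normal_Form.Schur_Decomposition" Defs
begin

unbundle no vec_syntax
hide_const (open) Finite_Cartesian_Product.mat Finite_Cartesian_Product.vec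
hide_type (open) Finite_Cartesian_Product.vec

text \<open>
  Write \<open>\<omega> = exp (2 \<pi> i \<theta>)\<close> with \<open>0 < \<theta> < 1/2\<close>. The homology of the surface consists of the chains
  on the letters of the word with vanishing sum in every column, and on these the Hermitian form is,
  up to a diagonal unitary change of coordinates, \<open>2 sin (\<pi>\<theta>)\<close> times
  \<open>sin (\<pi>\<theta>) \<Sum> |x\<^sub>p|\<^sup>2 + 2 Im \<Sum>\<^sub>q\<^sub><\<^sub>p G\<^sub>p\<^sub>q cnj x\<^sub>p x\<^sub>q\<close>. Here \<open>G\<close> depends only on the columns: it is
  \<open>cos (\<pi>\<theta>)\<close> on equal columns and \<open>1/2\<close> on adjacent ones. So the form is the sum of
  the energy and the symplectic area of a closed polygon in the space of column sums.

  If \<open>k \<theta> < 1\<close>, then \<open>G\<close> is positive definite on \<open>k - 1\<close> consecutive columns. In that case the form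
  is \<open>|v|\<^sup>2 sin (\<pi>\<theta>) - Re \<langle>v, \<zeta> Y v\<rangle>\<close> with \<open>|\<zeta>| = 1\<close> and \<open>Y\<close> strictly lower triangular and unitary up
  to bounded rank. The powers of \<open>Y\<close> have trace zero, hence the spectrum of \<open>Y + Y\<^sup>*\<close> is distributed
  like \<open>2 cos\<close> on the circle, and only a proportion \<open>1/2 - \<theta>\<close> of the eigenvalues of the form is
  nonpositive, whatever the word.

  For an arbitrary number of strands, drop the letters in every \<open>k\<close>-th column, which restricts the
  form to a subspace of codimension at most \<open>1/k\<close> times the length, and treat the remaining groups of
  \<open>k - 1\<close> columns separately. This yields a linear bound as soon as \<open>(k - 1) \<theta> > 1/2\<close>. Such a \<open>k\<close>
  with \<open>k \<theta> < 1\<close> exists for \<open>\<theta> < 1/3\<close>, \<open>\<theta> \<noteq> 1/4\<close>. For \<open>1/3 < \<theta> < 1/2\<close> one takes \<open>k = 3\<close>, where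
  \<open>G\<close> is indefinite, and shows that the proportion of nonpositive eigenvalues is below \<open>1/4\<close>.
\<close>

section \<open>Hermitian matrices\<close>

text \<open>The constant must not depend on the number of strands, whereas the error term of the
  spectral estimate depends on the number of columns treated at once. Groups of bounded size keep
  this error bounded per group; the number of groups is bounded for fixed \<open>n\<close>, so the
  total error disappears as \<open>b1\<close> grows. Dropped columns are paid for by their letters,
  and averaging over the \<open>k\<close> possible positions keeps this price at a share 1/k.

  The numerical conditions say that the nonpositive index stays below half of the dimension. With a
  proportion \<eta> of nonpositive eigenvalues per group the requirement is
  \<open>1/k + \<eta> (1 - 1/k) < 1/2\<close>. For \<open>\<eta> = 1/2 - \<theta>\<close> it reads
  \<open>(k - 1) \<theta> > 1/2\<close>, and for \<open>k = 3\<close> it reads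
  \<open>\<eta> < 1/4\<close>. The excluded angles 1/3 and 1/4 make \<omega> a root of unity, which
  transcendence forbids.

  Traces are used because the individual eigenvalues depend on the word, while each moment of
  \<open>Y + adj Y\<close> does so only up to a bounded error. A polynomial majorant of a step
  function turns the moments into an eigenvalue count.\<close>

definition adj :: "complex mat \<Rightarrow> complex mat" where
  "adj A = mat (dim_col A) (dim_row A) (\<lambda>(i, j). cnj (A $$ (j, i)))"

lemma adj_carrier [simp, intro]: "A \<in> carrier_mat m n \<Longrightarrow> adj A \<in> carrier_mat n m"
  by (auto simp: adj_def)

lemma adj_dim [simp]: "dim_row (adj A) = dim_col A" "dim_col (adj A) = dim_row A"
  by (auto simp: adj_def)

lemma adj_index [simp]: "i < dim_col A \<Longrightarrow> j < dim_row A \<Longrightarrow> adj A $$ (i, j) = cnj (A $$ (j, i))"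
  by (auto simp: adj_def)

lemma adj_adj [simp]: "adj (adj A) = A"
  by (auto simp: adj_def)

lemma adj_one [simp]: "adj (1\<^sub>m n) = 1\<^sub>m n"
  by (rule eq_matI) (auto simp: adj_def)

lemma index_mult_mat_sum:
  assumes "A \<in> carrier_mat m n" "B \<in> carrier_mat n k" "i < m" "j < k"
  shows "(A * B) $$ (i, j) = (\<Sum>l<n. A $$ (i, l) * B $$ (l, j))"
  using assms by (auto simp: scalar_prod_def atLeast0LessThan)

lemma index_mult_mat_vec_sum:
  assumes "A \<in> carrier_mat m n" "v \<in> carrier_vec n" "i < m"
  shows "(A *\<^sub>v v) $ i = (\<Sum>l<n. A $$ (i, l) * v $ l)"
  using assms by (auto simp: scalar_prod_def atLeast0LessThan)

lemma adj_mult: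
  assumes "A \<in> carrier_mat m n" "B \<in> carrier_mat n k"
  shows "adj (A * B) = adj B * adj A"
proof (rule eq_matI)
  fix i j assume "i < dim_row (adj B * adj A)" "j < dim_col (adj B * adj A)"
  then have ij: "i < k" "j < m" using assms by auto
  have "adj (A * B) $$ (i, j) = cnj ((A * B) $$ (j, i))"
    using assms ij by (subst adj_index) auto
  also have "\<dots> = (\<Sum>l<n. cnj (A $$ (j, l)) * cnj (B $$ (l, i)))"
    by (simp add: index_mult_mat_sum[OF assms ij(2,1)])
  also have "\<dots> = (\<Sum>l<n. adj B $$ (i, l) * adj A $$ (l, j))"
    using assms ij by (intro sum.cong) (auto simp: adj_def)
  also have "\<dots> = (adj B * adj A) $$ (i, j)"
    using assms ij by (intro index_mult_mat_sum[symmetric]) auto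
  finally show "adj (A * B) $$ (i, j) = (adj B * adj A) $$ (i, j)" .
qed (use assms in auto)

section \<open>Unitary diagonalisation of Hermitian matrices\<close>

definition diag_real :: "nat \<Rightarrow> (nat \<Rightarrow> real) \<Rightarrow> complex mat" where
  "diag_real n l = mat n n (\<lambda>(i, j). if i = j then of_real (l i) else 0)"

lemma diag_real_carrier [simp, intro]: "diag_real n l \<in> carrier_mat n n"
  by (simp add: diag_real_def)

text \<open>Orthogonalising a basis that starts with \<open>v\<close> leaves \<open>v\<close> in
  first place; dividing by \<open>sqrt (q i)\<close> afterwards makes the columns orthonormal, so
  the first one becomes a multiple of \<open>v\<close>.\<close>

lemma unitary_with_first_column:
  assumes v: "v \<in> carrier_vec (Suc n)" and v0: "v \<noteq> 0\<^sub>v (Suc n)"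
  obtains W a where "W \<in> carrier_mat (Suc n) (Suc n)" "adj W * W = 1\<^sub>m (Suc n)"
    "col W 0 = a \<cdot>\<^sub>v (v :: complex vec)"
proof -
  let ?n = "Suc n"
  interpret cof_vec_space ?n "TYPE(complex)" .
  define b where "b = basis_completion v"
  define ws where "ws = gram_schmidt ?n b"
  from basis_completion[OF v v0, folded b_def]
  have span_b: "span (set b) = carrier_vec ?n" and dist_b: "distinct b"
    and indep: "\<not> lin_dep (set b)" and b: "set b \<subseteq> carrier_vec ?n" and hdb: "hd b = v"
    and len_b: "length b = ?n" by auto
  from hdb len_b obtain vs where bv: "b = v # vs" by (cases b) auto
  from gram_schmidt_result[OF b dist_b indep refl, folded ws_def]
  have ws: "set ws \<subseteq> carrier_vec ?n" "corthogonal ws" "length ws = ?n"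
    by (auto simp: len_b)
  from gram_schmidt_hd[OF v, of vs, folded bv] have hdws: "hd ws = v" unfolding ws_def .
  define q where "q = (\<lambda>i. \<Sum>k<?n. (cmod (ws ! i $ k))\<^sup>2)"
  have wsi: "ws ! i \<in> carrier_vec ?n" if "i < ?n" for i
    using ws that by auto
  have ip: "(\<Sum>k<?n. ws ! i $ k * cnj (ws ! j $ k)) = (ws ! i \<bullet>c ws ! j)" if "i < ?n" "j < ?n" for i j
    using wsi[OF that(1)] wsi[OF that(2)] by (simp add: scalar_prod_def atLeast0LessThan carrier_vecD)
  have q: "complex_of_real (q i) = (ws ! i \<bullet>c ws ! i)" if "i < ?n" for i
    by (simp add: ip[OF that that, symmetric] q_def complex_norm_square del: of_real_power)
  have q0: "q i > 0" if "i < ?n" for i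
  proof -
    have "q i \<ge> 0" unfolding q_def by (intro sum_nonneg) auto
    moreover have "q i \<noteq> 0"
      using q[OF that] corthogonalD[OF ws(2), of i i] ws(3) that by auto
    ultimately show ?thesis by simp
  qed
  define W where "W = mat ?n ?n (\<lambda>(k, i). ws ! i $ k / of_real (sqrt (q i)))"
  have W: "W \<in> carrier_mat ?n ?n" by (simp add: W_def)
  have "adj W * W = 1\<^sub>m ?n"
  proof (rule eq_matI)
    fix i j assume "i < dim_row (1\<^sub>m ?n :: complex mat)" "j < dim_col (1\<^sub>m ?n :: complex mat)"
    then have ij: "i < ?n" "j < ?n" by auto
    have "(adj W * W) $$ (i, j) = (\<Sum>k<?n. adj W $$ (i, k) * W $$ (k, j))"
      by (rule index_mult_mat_sum[OF _ W]) (use W ij in auto)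
    also have "\<dots> = (\<Sum>k<?n. (ws ! j $ k * cnj (ws ! i $ k)) / of_real (sqrt (q i) * sqrt (q j)))"
      using ij by (intro sum.cong) (auto simp: W_def)
    also have "\<dots> = (ws ! j \<bullet>c ws ! i) / of_real (sqrt (q i) * sqrt (q j))"
      by (simp only: sum_divide_distrib[symmetric] ip[OF ij(2,1)])
    also have "\<dots> = (if i = j then 1 else 0)"
    proof (cases "i = j")
      case True
      then show ?thesis using q[OF ij(1)] q0[OF ij(1)] by (auto simp flip: q)
    next
      case False
      then show ?thesis using corthogonalD[OF ws(2), of j i] ij ws(3) by auto
    qed
    finally show "(adj W * W) $$ (i, j) = 1\<^sub>m ?n $$ (i, j)" using ij by simp
  qed (use W in auto)
  moreover have "col W 0 = (1 / of_real (sqrt (q 0))) \<cdot>\<^sub>v v"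
  proof (rule eq_vecI)
    fix k assume "k < dim_vec ((1 / complex_of_real (sqrt (q 0))) \<cdot>\<^sub>v v)"
    then have k: "k < ?n" using v by auto
    have "ws ! 0 = v" using hdws ws(3) by (simp add: hd_conv_nth[symmetric] flip: length_0_conv)
    then show "col W 0 $ k = ((1 / of_real (sqrt (q 0))) \<cdot>\<^sub>v v) $ k"
      using k v by (simp add: W_def)
  qed (use v W in auto)
  ultimately show ?thesis using that W by blast
qed

text \<open>Deflation: a unitary change of basis moves an eigenvector to the first coordinate. The
  first column of \<open>B\<close> is then a multiple of the unit vector, symmetry forces the same
  for its first row, and the induction continues with the remaining block.\<close>

theorem hermitian_diagonalization:
  assumes "A \<in> carrier_mat n n" "adj A = A"
  obtains U l where "U \<in> carrier_mat n n" "adj U * U = 1\<^sub>m n" "U * adj U = 1\<^sub>m n"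
    "A = U * diag_real n l * adj U"
proof -
  have "\<exists>U l. U \<in> carrier_mat n n \<and> adj U * U = 1\<^sub>m n \<and> A = U * diag_real n l * adj U"
    using assms
  proof (induction n arbitrary: A)
    case 0
    show ?case
      by (rule exI[of _ "1\<^sub>m 0"], rule exI[of _ "\<lambda>_. 0"]) (use 0 in \<open>auto intro!: eq_matI\<close>)
  next
    case (Suc n)
    let ?n = "Suc n"
    note A = Suc.prems(1)
    obtain as where as: "char_poly A = (\<Prod>a\<leftarrow>as. [:- a, 1:])" "length as = ?n"
      using char_poly_factorized[OF A] by blast
    then obtain e es where "as = e # es" by (cases as) auto
    with as have "eigenvalue A e"
      unfolding eigenvalue_root_char_poly[OF A] by simp
    then obtain v where "eigenvector A v e" unfolding eigenvalue_def by blast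
    then have v: "v \<in> carrier_vec ?n" "v \<noteq> 0\<^sub>v ?n" "A *\<^sub>v v = e \<cdot>\<^sub>v v"
      using A by (auto simp: eigenvector_def)
    from unitary_with_first_column[OF v(1,2)] obtain W a
      where W: "W \<in> carrier_mat ?n ?n" "adj W * W = 1\<^sub>m ?n" "col W 0 = a \<cdot>\<^sub>v v" by blast
    have aW: "adj W \<in> carrier_mat ?n ?n" using W by auto
    have WW: "W * adj W = 1\<^sub>m ?n"
      using mat_mult_left_right_inverse[OF aW W(1) W(2)] .
    define B where "B = adj W * (A * W)"
    have B: "B \<in> carrier_mat ?n ?n" unfolding B_def using aW A W(1) by auto
    have AW: "A * W \<in> carrier_mat ?n ?n" using A W by auto
    have B_herm: "adj B = B"
    proof -
      have "adj B = adj (A * W) * adj (adj W)"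
        unfolding B_def by (rule adj_mult[OF aW AW])
      also have "\<dots> = (adj W * A) * W"
        using adj_mult[OF A W(1)] Suc.prems(2) by simp
      also have "\<dots> = B" unfolding B_def by (rule assoc_mult_mat[OF aW A W(1)])
      finally show ?thesis .
    qed
    have colB: "col B 0 = e \<cdot>\<^sub>v unit_vec ?n 0"
    proof -
      have "col B 0 = adj W *\<^sub>v col (A * W) 0"
        unfolding B_def by (rule col_mult2[OF aW AW]) simp
      also have "col (A * W) 0 = A *\<^sub>v col W 0"
        by (rule col_mult2[OF A W(1)]) simp
      also have "\<dots> = e \<cdot>\<^sub>v col W 0"
        using v by (simp add: W(3) mult_mat_vec[OF A v(1)] smult_smult_assoc mult.commute)
      also have "adj W *\<^sub>v (e \<cdot>\<^sub>v col W 0) = e \<cdot>\<^sub>v (adj W *\<^sub>v col W 0)"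
        by (rule mult_mat_vec[OF aW]) (use v W in auto)
      also have "adj W *\<^sub>v col W 0 = col (adj W * W) 0"
        by (rule col_mult2[OF aW W(1), symmetric]) simp
      finally show ?thesis using W(2) by simp
    qed
    have B0: "B $$ (i, 0) = (if i = 0 then e else 0)" if "i < ?n" for i
      using arg_cong[OF colB, of "\<lambda>x. x $ i"] that B by (auto simp: unit_vec_def)
    have B0': "B $$ (0, j) = (if j = 0 then cnj e else 0)" if "j < ?n" for j
      using arg_cong[OF B_herm, of "\<lambda>M. M $$ (0, j)"] B0[OF that] that B by auto
    have e_real: "e = of_real (Re e)"
      using B0[of 0] B0'[of 0] by (simp add: complex_eq_iff)
    have e_cnj: "cnj e = e" by (metis complex_cnj_complex_of_real e_real)
    define A3 where "A3 = mat n n (\<lambda>(i, j). B $$ (Suc i, Suc j))"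
    have A3: "A3 \<in> carrier_mat n n" by (simp add: A3_def)
    have "adj A3 = A3"
    proof (rule eq_matI)
      fix i j assume "i < dim_row A3" "j < dim_col A3"
      then have ij: "i < n" "j < n" by (auto simp: A3_def)
      show "adj A3 $$ (i, j) = A3 $$ (i, j)"
        using ij arg_cong[OF B_herm, of "\<lambda>M. M $$ (Suc i, Suc j)"] B by (auto simp: A3_def)
    qed (auto simp: A3_def)
    from Suc.IH[OF A3 this] obtain V l where V: "V \<in> carrier_mat n n" "adj V * V = 1\<^sub>m n"
      "A3 = V * diag_real n l * adj V" by blast
    let ?one = "1\<^sub>m 1 :: complex mat"
    define V' where "V' = four_block_mat ?one (0\<^sub>m 1 n) (0\<^sub>m n 1) V"
    define l' where "l' = (\<lambda>i. case i of 0 \<Rightarrow> Re e | Suc j \<Rightarrow> l j)"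
    have V': "V' \<in> carrier_mat ?n ?n"
      unfolding V'_def using four_block_carrier_mat[of ?one 1 1 V n n] V by auto
    have adjV': "adj V' = four_block_mat ?one (0\<^sub>m 1 n) (0\<^sub>m n 1) (adj V)"
      unfolding V'_def using V(1) by (intro eq_matI) (auto simp: adj_def)
    have diag': "diag_real ?n l' = four_block_mat (mat 1 1 (\<lambda>_. e)) (0\<^sub>m 1 n) (0\<^sub>m n 1) (diag_real n l)"
      using e_real
      by (intro eq_matI) (auto simp: diag_real_def l'_def split: nat.splits)
    have Bblock: "B = four_block_mat (mat 1 1 (\<lambda>_. e)) (0\<^sub>m 1 n) (0\<^sub>m n 1) A3"
      using B0 B0' B e_cnj by (intro eq_matI) (auto simp: A3_def)
    have VV: "adj V' * V' = 1\<^sub>m ?n"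
    proof -
      have "adj V' * V' = four_block_mat ?one (0\<^sub>m 1 n) (0\<^sub>m n 1) (1\<^sub>m n)"
        unfolding adjV' unfolding V'_def
        using V by (subst mult_four_block_mat[of _ 1 1 _ n _ n _ _ 1 _ n]) auto
      also have "\<dots> = 1\<^sub>m ?n" by (intro eq_matI) auto
      finally show ?thesis .
    qed
    have BV: "B = V' * diag_real ?n l' * adj V'"
    proof -
      have aV: "adj V \<in> carrier_mat n n" using V by auto
      have 1: "V' * diag_real ?n l' =
          four_block_mat (mat 1 1 (\<lambda>_. e)) (0\<^sub>m 1 n) (0\<^sub>m n 1) (V * diag_real n l)"
        unfolding diag' unfolding V'_def
        using V by (subst mult_four_block_mat[of _ 1 1 _ n _ n _ _ 1 _ n])
          (auto simp: left_mult_zero_mat[OF diag_real_carrier] simp del: One_nat_def)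
      have VD: "V * diag_real n l \<in> carrier_mat n n" using V by auto
      have "V' * diag_real ?n l' * adj V' =
          four_block_mat (mat 1 1 (\<lambda>_. e)) (0\<^sub>m 1 n) (0\<^sub>m n 1) (V * diag_real n l * adj V)"
        unfolding 1 adjV'
        using VD aV by (subst mult_four_block_mat[of _ 1 1 _ n _ n _ _ 1 _ n])
          (auto simp: left_mult_zero_mat[OF aV] right_mult_zero_mat[OF VD] simp del: One_nat_def)
      then show ?thesis unfolding Bblock V(3) by simp
    qed
    define U where "U = W * V'"
    have U: "U \<in> carrier_mat ?n ?n" unfolding U_def using W V' by auto
    have adjU: "adj U = adj V' * adj W" unfolding U_def by (rule adj_mult[OF W(1) V'])
    have aV': "adj V' \<in> carrier_mat ?n ?n" using V' by auto
    note [simp] = assoc_mult_mat[of _ ?n ?n _ ?n _ ?n]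
    have "adj U * U = adj V' * ((adj W * W) * V')"
      unfolding adjU unfolding U_def using W(1) aW V' aV' by simp
    then have UU: "adj U * U = 1\<^sub>m ?n" using W(2) V' VV by simp
    have c: "diag_real ?n l' * adj V' \<in> carrier_mat ?n ?n" "V' * (diag_real ?n l' * adj V') \<in> carrier_mat ?n ?n"
      "adj V' * adj W \<in> carrier_mat ?n ?n"
      by (meson mult_carrier_mat V' aV' aW diag_real_carrier)+
    have "U * diag_real ?n l' * adj U = W * (V' * diag_real ?n l' * adj V') * adj W"
      unfolding adjU unfolding U_def using W(1) aW V' aV' c by simp
    also have "\<dots> = W * B * adj W" using BV by simp
    also have "\<dots> = (W * adj W) * A * (W * adj W)"
    proof -
      have c2: "A * (W * adj W) \<in> carrier_mat ?n ?n" "adj W * A \<in> carrier_mat ?n ?n"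
        "W * adj W \<in> carrier_mat ?n ?n"
        by (meson mult_carrier_mat W(1) aW A)+
      have "W * B * adj W = W * (B * adj W)" by (rule assoc_mult_mat[OF W(1) B aW])
      also have "B * adj W = adj W * (A * W * adj W)"
        unfolding B_def by (rule assoc_mult_mat[OF aW AW aW])
      also have "A * W * adj W = A * (W * adj W)" by (rule assoc_mult_mat[OF A W(1) aW])
      also have "W * (adj W * (A * (W * adj W))) = (W * adj W) * (A * (W * adj W))"
        by (rule assoc_mult_mat[OF W(1) aW c2(1), symmetric])
      also have "\<dots> = W * adj W * A * (W * adj W)"
        by (rule assoc_mult_mat[OF c2(3) A c2(3), symmetric])
      finally show ?thesis .
    qed
    also have "\<dots> = A" using A WW by simp
    finally have "A = U * diag_real ?n l' * adj U" by (rule sym)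
    with U UU show ?case by (intro exI[of _ U] exI[of _ l'] conjI)
  qed
  then obtain U l where U: "U \<in> carrier_mat n n" "adj U * U = 1\<^sub>m n" "A = U * diag_real n l * adj U"
    by blast
  have "U * adj U = 1\<^sub>m n"
    by (rule mat_mult_left_right_inverse[OF adj_carrier[OF U(1)] U(1,2)])
  then show ?thesis by (rule that[OF U(1,2) _ U(3)])
qed

section \<open>Dimension counts and the signature\<close>

lemma homogeneous_system_nontrivial:
  fixes f :: "nat \<Rightarrow> 'i \<Rightarrow> 'a::field"
  assumes "finite I" "r < card I"
  shows "\<exists>t. (\<exists>i\<in>I. t i \<noteq> 0) \<and> (\<forall>j<r. (\<Sum>i\<in>I. f j i * t i) = 0)"
  using assms
proof (induction r arbitrary: I f)
  case 0
  then obtain i where "i \<in> I" by fastforce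
  then show ?case by (intro exI[of _ "\<lambda>_. 1"]) auto
next
  case (Suc r)
  show ?case
  proof (cases "\<exists>i\<in>I. f r i \<noteq> 0")
    case False
    obtain t where "\<exists>i\<in>I. t i \<noteq> 0" "\<forall>j<r. (\<Sum>i\<in>I. f j i * t i) = 0"
      using Suc.IH[of I f] Suc.prems by auto
    then show ?thesis using False by (intro exI[of _ t]) (auto simp: less_Suc_eq)
  next
    case True
    then obtain k where k: "k \<in> I" "f r k \<noteq> 0" by blast
    let ?I = "I - {k}"
    \<comment> \<open>Gaussian elimination: equation \<open>r\<close> is solved for the unknown
      \<open>k\<close> and substituted into the others.\<close>
    define g where "g = (\<lambda>j i. f j i - f j k * f r i / f r k)"
    have "r < card ?I" using Suc.prems k by simp
    obtain t where t: "\<exists>i\<in>?I. t i \<noteq> 0" "\<forall>j<r. (\<Sum>i\<in>?I. g j i * t i) = 0"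
      using Suc.IH[of ?I g] Suc.prems \<open>r < card ?I\<close> by blast
    define T where "T = (\<Sum>i\<in>?I. f r i * t i)"
    define t' where "t' = t(k := - T / f r k)"
    have split: "(\<Sum>i\<in>I. f j i * t' i) = f j k * (- T / f r k) + (\<Sum>i\<in>?I. f j i * t i)" for j
    proof -
      have "(\<Sum>i\<in>I. f j i * t' i) = f j k * t' k + (\<Sum>i\<in>?I. f j i * t' i)"
        using k Suc.prems by (simp add: sum.remove)
      also have "(\<Sum>i\<in>?I. f j i * t' i) = (\<Sum>i\<in>?I. f j i * t i)"
        by (intro sum.cong) (auto simp: t'_def)
      finally show ?thesis by (simp add: t'_def)
    qed
    have "(\<Sum>i\<in>I. f j i * t' i) = 0" if "j < Suc r" for j
    proof (cases "j = r")
      case True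
      then show ?thesis using k by (simp add: split T_def)
    next
      case False
      then have "0 = (\<Sum>i\<in>?I. g j i * t i)" using t that by simp
      also have "\<dots> = (\<Sum>i\<in>?I. f j i * t i) - f j k / f r k * T"
        by (simp add: g_def algebra_simps sum_subtractf T_def sum_distrib_left)
      finally show ?thesis by (simp add: split)
    qed
    moreover have "\<exists>i\<in>I. t' i \<noteq> 0" using t(1) by (auto simp: t'_def)
    ultimately show ?thesis by blast
  qed
qed

text \<open>\<open>u i k\<close> is the \<open>i\<close>-th coordinate of the \<open>k\<close>-th
  eigenvector. Orthonormality and completeness are both recorded, the first to evaluate forms on
  eigenvectors, the second to expand arbitrary vectors.\<close>

definition eigenbasis :: "nat \<Rightarrow> complex mat \<Rightarrow> (nat \<Rightarrow> nat \<Rightarrow> complex) \<Rightarrow> (nat \<Rightarrow> real) \<Rightarrow> bool" where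
  "eigenbasis n A u l \<longleftrightarrow> (\<forall>i<n. \<forall>j<n. (\<Sum>k<n. cnj (u k i) * u k j) = (if i = j then 1 else 0) \<and>
    (\<Sum>k<n. u i k * cnj (u j k)) = (if i = j then 1 else 0) \<and>
    A $$ (i, j) = (\<Sum>k<n. of_real (l k) * u i k * cnj (u j k)))"

lemma eigenbasisD:
  assumes "eigenbasis n A u l" "i < n" "j < n"
  shows "(\<Sum>k<n. cnj (u k i) * u k j) = (if i = j then 1 else 0)"
    "(\<Sum>k<n. u i k * cnj (u j k)) = (if i = j then 1 else 0)"
    "A $$ (i, j) = (\<Sum>k<n. of_real (l k) * u i k * cnj (u j k))"
  using assms unfolding eigenbasis_def by blast+

lemma eigenbasis_norm:
  assumes "eigenbasis n A u l" "k < n"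
  shows "(\<Sum>i<n. (cmod (u i k))\<^sup>2) = 1"
proof -
  have "complex_of_real (\<Sum>i<n. (cmod (u i k))\<^sup>2) = (\<Sum>i<n. cnj (u i k) * u i k)"
    by (simp add: complex_norm_square mult.commute del: of_real_power)
  then show ?thesis
    using eigenbasisD(1)[OF assms(1,2,2)] by (simp only: simp_thms if_True of_real_eq_1_iff)
qed

lemma hermitian_eigenbasis:
  assumes "A \<in> carrier_mat n n" "adj A = A"
  obtains u l where "eigenbasis n A u l" "char_poly A = (\<Prod>k<n. [:- of_real (l k), 1:])"
proof -
  obtain U l where U: "U \<in> carrier_mat n n" "adj U * U = 1\<^sub>m n" "U * adj U = 1\<^sub>m n"
    and A: "A = U * diag_real n l * adj U"
    using hermitian_diagonalization[OF assms] by blast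
  define u where "u = (\<lambda>i k. U $$ (i, k))"
  have aU: "adj U \<in> carrier_mat n n" using U by auto
  have 1: "(\<Sum>k<n. cnj (u k i) * u k j) = (if i = j then 1 else 0)" if "i < n" "j < n" for i j
  proof -
    have "(\<Sum>k<n. cnj (u k i) * u k j) = (adj U * U) $$ (i, j)"
      unfolding index_mult_mat_sum[OF aU U(1) that]
      using U that by (intro sum.cong) (auto simp: u_def)
    then show ?thesis using U that by simp
  qed
  have 2: "(\<Sum>k<n. u i k * cnj (u j k)) = (if i = j then 1 else 0)" if "i < n" "j < n" for i j
  proof -
    have "(\<Sum>k<n. u i k * cnj (u j k)) = (U * adj U) $$ (i, j)"
      unfolding index_mult_mat_sum[OF U(1) aU that]
      using U that by (intro sum.cong) (auto simp: u_def)
    then show ?thesis using U that by simp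
  qed
  have 3: "A $$ (i, j) = (\<Sum>k<n. of_real (l k) * u i k * cnj (u j k))" if ij: "i < n" "j < n" for i j
  proof -
    have UD: "U * diag_real n l \<in> carrier_mat n n" using U by auto
    have "(U * diag_real n l) $$ (i, k) = of_real (l k) * u i k" if "k < n" for k
    proof -
      have "(U * diag_real n l) $$ (i, k) = (\<Sum>m<n. u i m * (if m = k then of_real (l m) else 0))"
        unfolding index_mult_mat_sum[OF U(1) diag_real_carrier ij(1) that]
        using that by (intro sum.cong) (auto simp: u_def diag_real_def)
      also have "\<dots> = of_real (l k) * u i k"
        using that by (simp add: if_distrib[of "\<lambda>x. _ * x"] cong: if_cong)
      finally show ?thesis .
    qed
    then show ?thesis
      unfolding A index_mult_mat_sum[OF UD aU ij]
      using U ij by (intro sum.cong) (auto simp: u_def)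
  qed
  have "similar_mat A (diag_real n l)"
    by (rule similar_matI[of _ _ U "adj U" n]) (use U aU A assms in auto)
  then have "char_poly A = char_poly (diag_real n l)" by (rule char_poly_similar)
  also have "\<dots> = (\<Prod>a\<leftarrow>diag_mat (diag_real n l). [:- a, 1:])"
    by (rule char_poly_upper_triangular[of _ n]) (auto simp: diag_real_def)
  also have "diag_mat (diag_real n l) = map (\<lambda>k. of_real (l k)) [0..<n]"
    by (auto simp: diag_mat_def diag_real_def)
  also have "(\<Prod>a\<leftarrow>map (\<lambda>k. of_real (l k)) [0..<n]. [:- a, 1:]) = (\<Prod>k<n. [:- complex_of_real (l k), 1:])"
    by (simp add: prod.list_conv_set_nth atLeast0LessThan comp_def)
  finally show ?thesis using that[of u l] 1 2 3 by (simp add: eigenbasis_def)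
qed

text \<open>The coefficients are an arbitrary function rather than the entries of a matrix, so that
  the identity form, with all \<open>l k = 1\<close>, is covered too and yields Parseval's
  identity.\<close>

lemma quadratic_form_eigenbasis:
  assumes "\<And>i j. i < n \<Longrightarrow> j < n \<Longrightarrow> a i j = (\<Sum>k<n. of_real (l k) * u i k * cnj (u j k))"
  shows "(\<Sum>i<n. \<Sum>j<n. cnj (v i) * a i j * v j) =
    of_real (\<Sum>k<n. l k * (cmod (\<Sum>i<n. cnj (u i k) * v i))\<^sup>2)"
proof -
  have "(\<Sum>i<n. \<Sum>j<n. cnj (v i) * a i j * v j) =
      (\<Sum>i<n. \<Sum>j<n. \<Sum>k<n. of_real (l k) * ((cnj (v i) * u i k) * (cnj (u j k) * v j)))"
    using assms by (intro sum.cong refl) (simp add: sum_distrib_left sum_distrib_right mult_ac)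
  also have "\<dots> = (\<Sum>k<n. \<Sum>i<n. \<Sum>j<n. of_real (l k) * ((cnj (v i) * u i k) * (cnj (u j k) * v j)))"
    by (subst (2) sum.swap, subst sum.swap) (rule refl)
  also have "\<dots> = (\<Sum>k<n. of_real (l k) * ((\<Sum>i<n. cnj (v i) * u i k) * (\<Sum>j<n. cnj (u j k) * v j)))"
    by (simp only: sum_distrib_left[symmetric] sum_distrib_right[symmetric])
  also have "\<dots> = (\<Sum>k<n. of_real (l k * (cmod (\<Sum>i<n. cnj (u i k) * v i))\<^sup>2))"
  proof (intro sum.cong refl)
    fix k
    have "(\<Sum>i<n. cnj (v i) * u i k) = cnj (\<Sum>i<n. cnj (u i k) * v i)"
      by (simp add: mult.commute)
    then show "of_real (l k) * ((\<Sum>i<n. cnj (v i) * u i k) * (\<Sum>j<n. cnj (u j k) * v j)) =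
        complex_of_real (l k * (cmod (\<Sum>i<n. cnj (u i k) * v i))\<^sup>2)"
      by (simp only: of_real_mult complex_norm_square mult.commute)
  qed
  finally show ?thesis by simp
qed

text \<open>If the nonpositive eigenvectors spanned more than \<open>r\<close> dimensions, some
  nonzero combination of them would satisfy all \<open>r\<close> equations, contradicting
  positivity. Zero eigenvalues are counted in \<open>I\<close>, so at least \<open>n - r\<close>
  eigenvalues are positive and at most \<open>r\<close> are negative.\<close>

lemma matrix_signature_ge:
  assumes A: "A \<in> carrier_mat n n" "adj A = A"
    and pos: "\<And>v :: nat \<Rightarrow> complex. \<exists>i<n. v i \<noteq> 0 \<Longrightarrow> \<forall>j<r. (\<Sum>i<n. f j i * v i) = 0 \<Longrightarrow>
      Re (\<Sum>i<n. \<Sum>j<n. cnj (v i) * A $$ (i, j) * v j) > 0"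
  shows "matrix_signature A \<ge> int n - 2 * int r"
proof -
  obtain u l where eb: "eigenbasis n A u l" and cp: "char_poly A = (\<Prod>k<n. [:- of_real (l k), 1:])"
    by (rule hermitian_eigenbasis[OF A])
  note u = eigenbasisD(1)[OF eb] eigenbasisD(3)[OF eb] cp
  define I where "I = {k. k < n \<and> l k \<le> 0}"
  have I: "finite I" "I \<subseteq> {..<n}" by (auto simp: I_def)
  have "card I \<le> r"
  proof (rule ccontr)
    assume "\<not> card I \<le> r"
    then have "r < card I" by simp
    from homogeneous_system_nontrivial[OF I(1) this, of "\<lambda>j k. \<Sum>i<n. f j i * u i k"]
    obtain t where t: "\<exists>k\<in>I. t k \<noteq> 0" "\<And>j. j < r \<Longrightarrow> (\<Sum>k\<in>I. (\<Sum>i<n. f j i * u i k) * t k) = 0"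
      by blast
    define v where "v = (\<lambda>i. \<Sum>k\<in>I. u i k * t k)"
    have uv: "(\<Sum>i<n. cnj (u i m) * v i) = (if m \<in> I then t m else 0)" if "m < n" for m
    proof -
      have "(\<Sum>i<n. cnj (u i m) * v i) = (\<Sum>k\<in>I. (\<Sum>i<n. cnj (u i m) * u i k) * t k)"
        by (simp add: v_def sum_distrib_left sum_distrib_right mult_ac) (rule sum.swap)
      also have "\<dots> = (\<Sum>k\<in>I. if k = m then t k else 0)"
        using that I by (intro sum.cong refl) (subst u(1), auto)
      finally show ?thesis using I by simp
    qed
    have "(\<Sum>i<n. f j i * v i) = 0" if "j < r" for j
    proof -
      have "(\<Sum>i<n. f j i * v i) = (\<Sum>k\<in>I. (\<Sum>i<n. f j i * u i k) * t k)"
        by (simp add: v_def sum_distrib_left sum_distrib_right mult_ac) (rule sum.swap)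
      then show ?thesis using t(2)[OF that] by simp
    qed
    moreover have "\<exists>i<n. v i \<noteq> 0"
    proof (rule ccontr)
      assume "\<not> ?thesis"
      then have "(\<Sum>i<n. cnj (u i m) * v i) = 0" for m by (intro sum.neutral) auto
      with uv t(1) I show False by fastforce
    qed
    ultimately have "Re (\<Sum>i<n. \<Sum>j<n. cnj (v i) * A $$ (i, j) * v j) > 0"
      using pos by blast
    moreover have "(\<Sum>k<n. l k * (cmod (\<Sum>i<n. cnj (u i k) * v i))\<^sup>2) \<le> 0"
      by (intro sum_nonpos) (auto simp: uv I_def mult_nonpos_nonneg)
    moreover have "(\<Sum>i<n. \<Sum>j<n. cnj (v i) * A $$ (i, j) * v j) =
        of_real (\<Sum>k<n. l k * (cmod (\<Sum>i<n. cnj (u i k) * v i))\<^sup>2)"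
      by (rule quadratic_form_eigenbasis) (rule u(2))
    ultimately show False
      by (simp only: Re_complex_of_real)
  qed
  have proots: "proots (char_poly A) = image_mset (\<lambda>k. of_real (l k)) (mset_set {..<n})"
  proof -
    have "proots (char_poly A) = (\<Sum>k<n. {#complex_of_real (l k)#})"
      unfolding u(3) by (subst proots_prod) auto
    then show ?thesis by (simp add: sum_unfold_sum_mset)
  qed
  have size: "size (filter_mset P (proots (char_poly A))) = card {k. k < n \<and> P (of_real (l k))}" for P
    unfolding proots by (simp add: filter_mset_image_mset filter_mset_mset_set)
  have "n = card {k. k < n \<and> l k > 0} + card I"
    unfolding I_def by (subst card_Un_disjoint[symmetric]) (auto intro!: arg_cong[of _ _ card, of "{..<n}", simplified])
  moreover have "card {k. k < n \<and> l k < 0} \<le> card I"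
    by (intro card_mono) (auto simp: I_def)
  ultimately show ?thesis
    using \<open>card I \<le> r\<close> by (simp add: matrix_signature_def size)
qed

section \<open>Traces and contractions\<close>

lemma sum_rotate3: "(\<Sum>i\<in>A. \<Sum>j\<in>B. \<Sum>k\<in>C. f i j k) = (\<Sum>k\<in>C. \<Sum>i\<in>A. \<Sum>j\<in>B. f i j k)"
  by (rule trans[OF sum.cong[OF refl sum.swap] sum.swap])

definition mtrace :: "complex mat \<Rightarrow> complex" where
  "mtrace A = (\<Sum>i<dim_row A. A $$ (i, i))"

lemma mtrace_mult:
  assumes "A \<in> carrier_mat n m" "B \<in> carrier_mat m n"
  shows "mtrace (A * B) = (\<Sum>i<n. \<Sum>j<m. A $$ (i, j) * B $$ (j, i))"
  using assms by (auto simp: mtrace_def scalar_prod_def atLeast0LessThan intro!: sum.cong)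

lemma mtrace_comm:
  assumes "A \<in> carrier_mat n m" "B \<in> carrier_mat m n"
  shows "mtrace (A * B) = mtrace (B * A)"
  unfolding mtrace_mult[OF assms] mtrace_mult[OF assms(2,1)]
  by (subst sum.swap) (simp add: mult.commute)

lemma mtrace_add:
  assumes "A \<in> carrier_mat n n" "B \<in> carrier_mat n n"
  shows "mtrace (A + B) = mtrace A + mtrace B"
  using assms by (auto simp: mtrace_def sum.distrib)

lemma mtrace_minus:
  assumes "A \<in> carrier_mat n n" "B \<in> carrier_mat n n"
  shows "mtrace (A - B) = mtrace A - mtrace B"
  using assms by (auto simp: mtrace_def sum_subtractf)

definition norm2 :: "complex vec \<Rightarrow> real" where
  "norm2 v = (\<Sum>i<dim_vec v. (cmod (v $ i))\<^sup>2)"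

definition contraction :: "nat \<Rightarrow> complex mat \<Rightarrow> bool" where
  "contraction n B \<longleftrightarrow> B \<in> carrier_mat n n \<and> (\<forall>v\<in>carrier_vec n. norm2 (B *\<^sub>v v) \<le> norm2 v)"

lemma contraction_one: "contraction n (1\<^sub>m n)"
  by (auto simp: contraction_def)

lemma contraction_mult:
  assumes "contraction n A" "contraction n B"
  shows "contraction n (A * B)"
proof -
  have "norm2 (A * B *\<^sub>v v) \<le> norm2 v" if v: "v \<in> carrier_vec n" for v
  proof -
    have "A * B *\<^sub>v v = A *\<^sub>v (B *\<^sub>v v)"
      using assms v by (auto simp: contraction_def)
    moreover have "B *\<^sub>v v \<in> carrier_vec n"
      using assms v by (auto simp: contraction_def)
    ultimately show ?thesis
      using assms v unfolding contraction_def by (metis order_trans)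
  qed
  then show ?thesis using assms by (auto simp: contraction_def)
qed

lemma contraction_pow: "contraction n A \<Longrightarrow> contraction n (A ^\<^sub>m k)"
proof (induction k)
  case 0
  then show ?case using contraction_one[of n] by (auto simp: contraction_def)
qed (simp add: contraction_mult)

text \<open>With \<open>w = adj A v\<close> and \<open>z = A w\<close>, the squared norm of
  \<open>w\<close> is the inner product of \<open>z\<close> and \<open>v\<close>, hence at most
  \<open>(|z|^2 + |v|^2) / 2 \<le> (|w|^2 + |v|^2) / 2\<close>. The arithmetic-geometric mean
  inequality replaces Cauchy-Schwarz here and in the next lemma.\<close>

lemma contraction_adj:
  assumes "contraction n A"
  shows "contraction n (adj A)"
proof -
  have A: "A \<in> carrier_mat n n" using assms by (simp add: contraction_def)
  have "norm2 (adj A *\<^sub>v v) \<le> norm2 v" if v: "v \<in> carrier_vec n" for v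
  proof -
    define w where "w = adj A *\<^sub>v v"
    define z where "z = A *\<^sub>v w"
    have w: "w \<in> carrier_vec n" and z: "z \<in> carrier_vec n"
      unfolding w_def z_def by (meson mult_mat_vec_carrier A v adj_carrier)+
    have zw: "norm2 z \<le> norm2 w" using assms w by (simp add: contraction_def z_def)
    have wi: "w $ i = (\<Sum>j<n. cnj (A $$ (j, i)) * v $ j)" if "i < n" for i
      unfolding w_def using A v that
      by (subst index_mult_mat_vec_sum[of _ n n]) (auto intro!: sum.cong)
    have zj: "z $ j = (\<Sum>i<n. A $$ (j, i) * w $ i)" if "j < n" for j
      unfolding z_def using A w that by (subst index_mult_mat_vec_sum[of _ n n]) auto
    have "complex_of_real (norm2 w) = (\<Sum>i<n. w $ i * cnj (w $ i))"
      using w by (simp add: norm2_def complex_norm_square del: of_real_power)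
    also have "\<dots> = (\<Sum>i<n. \<Sum>j<n. cnj (A $$ (j, i) * w $ i) * v $ j)"
      by (intro sum.cong refl) (simp add: wi sum_distrib_right mult_ac)
    also have "\<dots> = (\<Sum>j<n. cnj (z $ j) * v $ j)"
      by (subst sum.swap) (simp add: zj sum_distrib_right)
    finally have "norm2 w = cmod (\<Sum>j<n. cnj (z $ j) * v $ j)"
    proof -
      assume eq: "complex_of_real (norm2 w) = (\<Sum>j<n. cnj (z $ j) * v $ j)"
      have "norm2 w \<ge> 0" unfolding norm2_def by (intro sum_nonneg) auto
      then show ?thesis by (simp flip: eq)
    qed
    also have "\<dots> \<le> (\<Sum>j<n. cmod (z $ j) * cmod (v $ j))"
      by (intro sum_norm_le) (simp add: norm_mult)
    also have "\<dots> \<le> (\<Sum>j<n. ((cmod (z $ j))\<^sup>2 + (cmod (v $ j))\<^sup>2) / 2)"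
    proof (intro sum_mono)
      fix j
      show "cmod (z $ j) * cmod (v $ j) \<le> ((cmod (z $ j))\<^sup>2 + (cmod (v $ j))\<^sup>2) / 2"
        using sum_squares_bound[of "cmod (z $ j)" "cmod (v $ j)"] by simp
    qed
    also have "\<dots> = (norm2 z + norm2 v) / 2"
      using z v by (simp add: norm2_def sum.distrib flip: sum_divide_distrib)
    finally show ?thesis using zw by (simp add: w_def)
  qed
  then show ?thesis using A by (auto simp: contraction_def)
qed

lemma contraction_numerical_radius:
  assumes Z: "contraction n Z" and u: "(\<Sum>i<n. (cmod (u i))\<^sup>2) = 1"
  shows "cmod (\<Sum>i<n. cnj (u i) * (Z *\<^sub>v vec n u) $ i) \<le> 1"
proof -
  let ?w = "Z *\<^sub>v vec n u"
  have "norm2 (vec n u) = 1" using u by (simp add: norm2_def)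
  then have w: "norm2 ?w \<le> 1" using Z unfolding contraction_def by (metis vec_carrier)
  have dim: "dim_vec ?w = n" using Z by (auto simp: contraction_def)
  have "cmod (\<Sum>i<n. cnj (u i) * ?w $ i) \<le> (\<Sum>i<n. cmod (u i) * cmod (?w $ i))"
    by (intro sum_norm_le) (simp add: norm_mult)
  also have "\<dots> \<le> (\<Sum>i<n. ((cmod (u i))\<^sup>2 + (cmod (?w $ i))\<^sup>2) / 2)"
  proof (intro sum_mono)
    fix i
    show "cmod (u i) * cmod (?w $ i) \<le> ((cmod (u i))\<^sup>2 + (cmod (?w $ i))\<^sup>2) / 2"
      using sum_squares_bound[of "cmod (u i)" "cmod (?w $ i)"] by simp
  qed
  also have "\<dots> = (1 + norm2 ?w) / 2"
    unfolding norm2_def dim sum_divide_distrib[symmetric] sum.distrib u ..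
  finally show ?thesis using w by simp
qed

text \<open>In an eigenbasis of \<open>X\<close> the trace of \<open>X * B\<close> is the sum of the
  eigenvalues weighted by the diagonal entries \<open>b k\<close> of \<open>B\<close>, which a
  contraction keeps in the unit disc. This makes a defect of small trace negligible next to any
  contraction.\<close>

lemma norm_mtrace_psd_mult_le:
  assumes X: "X \<in> carrier_mat n n" "adj X = X"
    and psd: "\<And>v :: nat \<Rightarrow> complex. Re (\<Sum>i<n. \<Sum>j<n. cnj (v i) * X $$ (i, j) * v j) \<ge> 0"
    and B: "contraction n B"
  shows "cmod (mtrace (X * B)) \<le> Re (mtrace X)"
proof -
  have Bc: "B \<in> carrier_mat n n" using B by (simp add: contraction_def)
  obtain u l where eb: "eigenbasis n X u l" by (rule hermitian_eigenbasis[OF X])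
  note u = eigenbasisD(1)[OF eb] eigenbasisD(3)[OF eb]
  have l: "l m \<ge> 0" if m: "m < n" for m
  proof -
    have "(\<Sum>i<n. \<Sum>j<n. cnj (u i m) * X $$ (i, j) * u j m) =
        of_real (\<Sum>k<n. l k * (cmod (\<Sum>i<n. cnj (u i k) * u i m))\<^sup>2)"
      by (rule quadratic_form_eigenbasis) (rule u(2))
    also have "(\<Sum>k<n. l k * (cmod (\<Sum>i<n. cnj (u i k) * u i m))\<^sup>2) = (\<Sum>k<n. if k = m then l k else 0)"
      using m by (intro sum.cong refl) (subst u(1), auto)
    finally show ?thesis using psd[of "\<lambda>i. u i m"] m by simp
  qed
  note norm1 = eigenbasis_norm[OF eb]
  define b where "b = (\<lambda>k. \<Sum>j<n. cnj (u j k) * (B *\<^sub>v vec n (\<lambda>i. u i k)) $ j)"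
  have b: "cmod (b k) \<le> 1" if k: "k < n" for k
    unfolding b_def by (rule contraction_numerical_radius[OF B norm1[OF k]])
  have "mtrace (X * B) = (\<Sum>i<n. \<Sum>j<n. \<Sum>k<n. of_real (l k) * (cnj (u j k) * (B $$ (j, i) * u i k)))"
    unfolding mtrace_mult[OF X(1) Bc]
    by (intro sum.cong refl) (simp add: u(2) sum_distrib_left sum_distrib_right mult_ac)
  also have "\<dots> = (\<Sum>k<n. \<Sum>j<n. \<Sum>i<n. of_real (l k) * (cnj (u j k) * (B $$ (j, i) * u i k)))"
    by (rule trans[OF sum_rotate3 sum.cong[OF refl sum.swap]])
  also have "\<dots> = (\<Sum>k<n. of_real (l k) * b k)"
  proof (intro sum.cong refl)
    fix k
    have "(B *\<^sub>v vec n (\<lambda>i. u i k)) $ j = (\<Sum>i<n. B $$ (j, i) * u i k)" if "j < n" for j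
      using Bc that by (subst index_mult_mat_vec_sum[of _ n n]) auto
    then show "(\<Sum>j<n. \<Sum>i<n. of_real (l k) * (cnj (u j k) * (B $$ (j, i) * u i k))) = of_real (l k) * b k"
      by (simp add: b_def sum_distrib_left)
  qed
  finally have "cmod (mtrace (X * B)) \<le> (\<Sum>k<n. l k)"
  proof (simp only:, intro sum_norm_le)
    fix k assume "k \<in> {..<n}"
    then show "cmod (of_real (l k) * b k) \<le> l k"
      using b[of k] l[of k] by (simp add: norm_mult mult_left_le)
  qed
  also have "(\<Sum>k<n. l k) = Re (mtrace X)"
  proof -
    have "mtrace X = (\<Sum>i<n. \<Sum>k<n. of_real (l k) * (u i k * cnj (u i k)))"
      using X by (auto simp: mtrace_def u(2) mult_ac intro!: sum.cong)
    also have "\<dots> = (\<Sum>k<n. of_real (l k) * (\<Sum>i<n. u i k * cnj (u i k)))"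
      by (subst sum.swap) (simp add: sum_distrib_left)
    also have "\<dots> = (\<Sum>k<n. of_real (l k) * of_real (\<Sum>i<n. (cmod (u i k))\<^sup>2))"
      by (simp add: complex_norm_square del: of_real_power)
    also have "\<dots> = of_real (\<Sum>k<n. l k)" by (simp add: norm1)
    finally show ?thesis by simp
  qed
  finally show ?thesis .
qed

lemma mtrace_hermitian_pow:
  assumes "T \<in> carrier_mat n n"
    and eb: "eigenbasis n T u l"
  shows "mtrace (T ^\<^sub>m m) = of_real (\<Sum>k<n. l k ^ m)"
proof -
  have c: "T ^\<^sub>m m \<in> carrier_mat n n" for m using assms(1) by simp
  have pow: "(T ^\<^sub>m m) $$ (i, j) = (\<Sum>k<n. of_real (l k ^ m) * (u i k * cnj (u j k)))"
    if "i < n" "j < n" for i j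
    using that
  proof (induction m arbitrary: i j)
    case 0
    then show ?case using assms(1) eigenbasisD(2)[OF eb] by simp
  next
    case (Suc m)
    have "(T ^\<^sub>m Suc m) $$ (i, j) = (\<Sum>p<n. (T ^\<^sub>m m) $$ (i, p) * T $$ (p, j))"
      using Suc.prems by (simp add: index_mult_mat_sum[OF c assms(1)])
    also have "\<dots> = (\<Sum>p<n. \<Sum>k<n. \<Sum>k'<n. of_real (l k ^ m) * of_real (l k') * u i k * cnj (u j k') * (cnj (u p k) * u p k'))"
    proof (intro sum.cong refl)
      fix p assume "p \<in> {..<n}"
      then have "(T ^\<^sub>m m) $$ (i, p) * T $$ (p, j) = (\<Sum>k<n. of_real (l k ^ m) * (u i k * cnj (u p k))) *
          (\<Sum>k'<n. of_real (l k') * u p k' * cnj (u j k'))"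
        using Suc by (simp only: eigenbasisD(3)[OF eb] lessThan_iff)
      also have "\<dots> = (\<Sum>k<n. \<Sum>k'<n. of_real (l k ^ m) * of_real (l k') * u i k * cnj (u j k') * (cnj (u p k) * u p k'))"
        unfolding sum_product by (intro sum.cong refl) (simp only: mult_ac)
      finally show "(T ^\<^sub>m m) $$ (i, p) * T $$ (p, j) = \<dots>" .
    qed
    also have "\<dots> = (\<Sum>k<n. \<Sum>k'<n. \<Sum>p<n. of_real (l k ^ m) * of_real (l k') * u i k * cnj (u j k') * (cnj (u p k) * u p k'))"
      by (rule trans[OF sum.swap sum.cong[OF refl sum.swap]])
    also have "\<dots> = (\<Sum>k<n. \<Sum>k'<n. if k = k' then of_real (l k ^ m) * of_real (l k') * u i k * cnj (u j k') else 0)"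
      by (intro sum.cong refl) (simp only: sum_distrib_left[symmetric] eigenbasisD(1)[OF eb] lessThan_iff, simp)
    also have "\<dots> = (\<Sum>k<n. of_real (l k ^ Suc m) * (u i k * cnj (u j k)))"
      by (intro sum.cong refl) (simp add: mult_ac)
    finally show ?case .
  qed
  have "mtrace (T ^\<^sub>m m) = (\<Sum>i<n. \<Sum>k<n. of_real (l k ^ m) * (u i k * cnj (u i k)))"
    using assms(1) by (auto simp: mtrace_def pow intro!: sum.cong)
  also have "\<dots> = (\<Sum>k<n. of_real (l k ^ m) * (\<Sum>i<n. cnj (u i k) * u i k))"
    by (subst sum.swap) (simp add: sum_distrib_left mult_ac)
  also have "\<dots> = of_real (\<Sum>k<n. l k ^ m)" by (simp add: eigenbasisD(1)[OF eb])
  finally show ?thesis .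
qed

text \<open>
  The expansion of \<open>(Y + Y\<^sup>*)\<^sup>m\<close> into powers of \<open>Y\<close>, where \<open>Y\<^sup>*\<close> counts as \<open>Y\<^sup>-\<^sup>1\<close>, is a sum
  over the \<open>2\<^sup>m\<close> walks of length \<open>m\<close> on the integers.
\<close>

primrec walk_sum :: "nat \<Rightarrow> (int \<Rightarrow> complex) \<Rightarrow> complex" where
  "walk_sum 0 g = g 0"
| "walk_sum (Suc m) g = walk_sum m (\<lambda>j. g (j + 1) + g (j - 1))"

lemma walk_sum_add: "walk_sum m (\<lambda>j. g j + h j) = walk_sum m g + walk_sum m h"
proof (induction m arbitrary: g h)
  case (Suc m)
  show ?case
    using Suc[of "\<lambda>j. g (j + 1) + g (j - 1)" "\<lambda>j. h (j + 1) + h (j - 1)"] by (simp add: add_ac)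
qed simp

lemma walk_sum_scale: "walk_sum m (\<lambda>j. c * g j) = c * walk_sum m g"
proof (induction m arbitrary: g)
  case (Suc m)
  show ?case
    using Suc[of "\<lambda>j. g (j + 1) + g (j - 1)"] by (simp add: distrib_left)
qed simp

lemma walk_sum_sum: "finite A \<Longrightarrow> walk_sum m (\<lambda>j. \<Sum>a\<in>A. g a j) = (\<Sum>a\<in>A. walk_sum m (g a))"
proof (induction A rule: finite_induct)
  case empty
  show ?case using walk_sum_scale[of m 0 "\<lambda>_. 0"] by simp
qed (simp add: walk_sum_add)

lemma walk_sum_cong: "(\<And>j. \<bar>j\<bar> \<le> int m \<Longrightarrow> g j = h j) \<Longrightarrow> walk_sum m g = walk_sum m h"
proof (induction m arbitrary: g h)
  case (Suc m)
  have "g (j + 1) + g (j - 1) = h (j + 1) + h (j - 1)" if "\<bar>j\<bar> \<le> int m" for j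
    using that Suc.prems[of "j + 1"] Suc.prems[of "j - 1"] by simp
  from Suc.IH[OF this] show ?case by simp
qed simp

lemma walk_sum_diff_le:
  assumes "\<And>j. cmod (g j - h j) \<le> e"
  shows "cmod (walk_sum m g - walk_sum m h) \<le> 2 ^ m * e"
  using assms
proof (induction m arbitrary: g h e)
  case (Suc m)
  have "cmod ((g (j + 1) + g (j - 1)) - (h (j + 1) + h (j - 1))) \<le> 2 * e" for j
  proof -
    have "(g (j + 1) + g (j - 1)) - (h (j + 1) + h (j - 1)) = (g (j + 1) - h (j + 1)) + (g (j - 1) - h (j - 1))"
      by simp
    also have "cmod \<dots> \<le> e + e" by (intro norm_triangle_mono Suc.prems)
    finally show ?thesis by simp
  qed
  from Suc.IH[OF this] show ?case by (simp add: mult_ac)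
qed simp

lemma walk_sum_power_int: "z \<noteq> 0 \<Longrightarrow> walk_sum m (\<lambda>j. z powi j) = (z + inverse z) ^ m"
proof (induction m)
  case (Suc m)
  have "(\<lambda>j. z powi (j + 1) + z powi (j - 1)) = (\<lambda>j. (z + inverse z) * z powi j)"
    using Suc.prems by (auto simp: power_int_add power_int_diff field_simps)
  then show ?case using Suc by (simp add: walk_sum_scale)
qed simp

lemma sum_roots_of_unity_powi:
  fixes N :: nat and j :: int
  assumes "N > 0" "\<bar>j\<bar> < int N"
  shows "(\<Sum>k<N. cis (2 * pi * real k / real N) powi j) = (if j = 0 then of_nat N else 0)"
proof (cases "j = 0")
  case False
  define z where "z = cis (2 * pi * of_int j / real N)"
  have "cis (2 * pi * real k / real N) powi j = z ^ k" for k
    by (simp add: z_def cis_power_int Complex.DeMoivre mult_ac)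
  moreover have "z ^ N = 1"
  proof -
    have "z ^ N = cis (2 * pi * of_int j)" using assms by (simp add: z_def Complex.DeMoivre)
    then show ?thesis by (metis cis_multiple_2pi Ints_of_int)
  qed
  moreover have "z \<noteq> 1"
  proof
    assume "z = 1"
    then have "cos (2 * pi * of_int j / real N) = 1" by (auto simp: z_def complex_eq_iff)
    then obtain i :: int where "2 * pi * of_int j / real N = of_int i * 2 * pi"
      by (auto simp: cos_one_2pi_int)
    then have "real_of_int j = of_int i * real N" using assms by (simp add: field_simps)
    then have ji: "j = i * int N" by (metis of_int_eq_iff of_int_mult of_int_of_nat_eq)
    then have "i \<noteq> 0" using False by auto
    then have "1 * int N \<le> \<bar>i\<bar> * int N" by (intro mult_right_mono) auto
    then show False using assms ji by (simp add: abs_mult)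
  qed
  ultimately show ?thesis using False by (simp add: geometric_sum)
qed simp

lemma walk_sum_delta:
  assumes "m < N"
  shows "walk_sum m (\<lambda>j. if j = 0 then 1 else 0) =
    of_real ((\<Sum>k<N. (2 * cos (2 * pi * real k / real N)) ^ m) / real N)"
proof -
  let ?z = "\<lambda>k. cis (2 * pi * real k / real N)"
  have N: "N > 0" using assms by simp
  have "walk_sum m (\<lambda>j. if j = 0 then 1 else 0) = walk_sum m (\<lambda>j. inverse (of_nat N) * (\<Sum>k<N. ?z k powi j))"
    using N assms by (intro walk_sum_cong) (simp add: sum_roots_of_unity_powi)
  also have "\<dots> = inverse (of_nat N) * (\<Sum>k<N. walk_sum m (\<lambda>j. ?z k powi j))"
    by (simp add: walk_sum_scale walk_sum_sum)
  also have "\<dots> = inverse (of_nat N) * (\<Sum>k<N. (?z k + inverse (?z k)) ^ m)"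
    by (simp add: walk_sum_power_int)
  also have "\<dots> = inverse (of_nat N) * (\<Sum>k<N. (of_real (2 * cos (2 * pi * real k / real N))) ^ m)"
    by (intro arg_cong2[of _ _ _ _ "(*)"] sum.cong refl arg_cong2[of _ _ _ _ "(^)"])
       (simp add: cis_inverse complex_eq_iff)
  finally show ?thesis by (simp add: field_simps)
qed

section \<open>Eigenvalues of nearly unitary nilpotent matrices\<close>

text \<open>The model is the truncated shift of C^n, a nilpotent contraction whose defect is a rank
  one projection. What is retained of it is a bound \<open>d\<close> on the trace of the defect and
  the vanishing of the traces of all powers.\<close>

locale near_shift =
  fixes n :: nat and d :: real and Y :: "complex mat"
  assumes contr: "contraction n Y"
    and defect: "Re (mtrace (1\<^sub>m n - adj Y * Y)) \<le> d"
    and trace_pow: "\<And>k. k > 0 \<Longrightarrow> mtrace (Y ^\<^sub>m k) = 0" "\<And>k. k > 0 \<Longrightarrow> mtrace (adj Y ^\<^sub>m k) = 0"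
begin

lemma Y_carrier: "Y \<in> carrier_mat n n" "adj Y \<in> carrier_mat n n"
  using contr by (auto simp: contraction_def)

text \<open>Stated for any contraction \<open>Z\<close>, since it serves both for \<open>Y\<close>
  and for \<open>adj Y\<close>.\<close>

lemma psd_defect:
  assumes Z: "contraction n Z"
  shows "Re (\<Sum>i<n. \<Sum>j<n. cnj (v i) * (1\<^sub>m n - adj Z * Z) $$ (i, j) * v j) \<ge> 0"
proof -
  have Zc: "Z \<in> carrier_mat n n" "adj Z \<in> carrier_mat n n" using Z by (auto simp: contraction_def)
  define w where "w = Z *\<^sub>v vec n v"
  have w: "w \<in> carrier_vec n" using Zc(1) by (auto simp: w_def)
  have wi: "w $ i = (\<Sum>j<n. Z $$ (i, j) * v j)" if "i < n" for i
    unfolding w_def using Zc that by (subst index_mult_mat_vec_sum[of _ n n]) auto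
  have "(\<Sum>i<n. \<Sum>j<n. cnj (v i) * (adj Z * Z) $$ (i, j) * v j) =
      (\<Sum>i<n. \<Sum>j<n. \<Sum>k<n. cnj (Z $$ (k, i) * v i) * (Z $$ (k, j) * v j))"
  proof (intro sum.cong refl)
    fix i j assume ij: "i \<in> {..<n}" "j \<in> {..<n}"
    then have "(adj Z * Z) $$ (i, j) = (\<Sum>k<n. cnj (Z $$ (k, i)) * Z $$ (k, j))"
      using Zc by (subst index_mult_mat_sum[OF Zc(2,1)]) (auto intro!: sum.cong)
    then show "cnj (v i) * (adj Z * Z) $$ (i, j) * v j =
        (\<Sum>k<n. cnj (Z $$ (k, i) * v i) * (Z $$ (k, j) * v j))"
      by (simp only: sum_distrib_left sum_distrib_right complex_cnj_mult) (simp only: mult_ac)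
  qed
  also have "\<dots> = (\<Sum>k<n. \<Sum>i<n. \<Sum>j<n. cnj (Z $$ (k, i) * v i) * (Z $$ (k, j) * v j))"
    by (rule sum_rotate3)
  also have "\<dots> = (\<Sum>k<n. cnj (w $ k) * w $ k)"
    by (simp add: wi sum_product)
  also have "\<dots> = of_real (norm2 w)"
    using w by (simp add: norm2_def complex_norm_square mult.commute del: of_real_power)
  finally have 1: "(\<Sum>i<n. \<Sum>j<n. cnj (v i) * (adj Z * Z) $$ (i, j) * v j) = of_real (norm2 w)" .
  have 2: "(\<Sum>i<n. \<Sum>j<n. cnj (v i) * 1\<^sub>m n $$ (i, j) * v j) = of_real (norm2 (vec n v))"
  proof -
    have "(\<Sum>i<n. \<Sum>j<n. cnj (v i) * 1\<^sub>m n $$ (i, j) * v j) = (\<Sum>i<n. \<Sum>j<n. if i = j then v i * cnj (v i) else 0)"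
      by (intro sum.cong refl) auto
    also have "\<dots> = of_real (norm2 (vec n v))"
      by (simp add: norm2_def complex_norm_square del: of_real_power)
    finally show ?thesis .
  qed
  have "norm2 w \<le> norm2 (vec n v)" using Z by (simp add: contraction_def w_def)
  moreover have "(\<Sum>i<n. \<Sum>j<n. cnj (v i) * (1\<^sub>m n - adj Z * Z) $$ (i, j) * v j) =
      (\<Sum>i<n. \<Sum>j<n. cnj (v i) * 1\<^sub>m n $$ (i, j) * v j) -
      (\<Sum>i<n. \<Sum>j<n. cnj (v i) * (adj Z * Z) $$ (i, j) * v j)"
    unfolding sum_subtractf[symmetric]
    using Zc by (intro sum.cong refl) (auto simp: algebra_simps)
  ultimately show ?thesis unfolding 1 2 by simp
qed

lemma hermitian_defect:
  assumes "Z \<in> carrier_mat n n"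
  shows "adj (1\<^sub>m n - adj Z * Z) = 1\<^sub>m n - adj Z * Z"
proof -
  have "adj (adj Z * Z) = adj Z * Z" using assms by (subst adj_mult[of _ n n _ n]) auto
  then have "cnj ((adj Z * Z) $$ (j, i)) = (adj Z * Z) $$ (i, j)" if "i < n" "j < n" for i j
    using adj_index[of i "adj Z * Z" j] that assms by simp
  then show ?thesis using assms by (intro eq_matI) (auto simp: adj_def)
qed

lemma norm_mtrace_defect_mult_le:
  assumes "contraction n B"
  shows "cmod (mtrace ((1\<^sub>m n - adj Y * Y) * B)) \<le> d" "cmod (mtrace ((1\<^sub>m n - Y * adj Y) * B)) \<le> d"
proof -
  have c: "1\<^sub>m n - adj Y * Y \<in> carrier_mat n n" "1\<^sub>m n - Y * adj Y \<in> carrier_mat n n"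
    using Y_carrier by auto
  have cc: "adj Y * Y \<in> carrier_mat n n" "Y * adj Y \<in> carrier_mat n n"
    by (meson mult_carrier_mat Y_carrier)+
  show "cmod (mtrace ((1\<^sub>m n - adj Y * Y) * B)) \<le> d"
    using norm_mtrace_psd_mult_le[OF c(1) hermitian_defect[OF Y_carrier(1)] psd_defect[OF contr] assms] defect
    by linarith
  have "mtrace (1\<^sub>m n - Y * adj Y) = mtrace (1\<^sub>m n - adj Y * Y)"
    unfolding mtrace_minus[OF one_carrier_mat cc(1)] mtrace_minus[OF one_carrier_mat cc(2)]
    using mtrace_comm[OF Y_carrier(1,2)] by simp
  moreover have "cmod (mtrace ((1\<^sub>m n - Y * adj Y) * B)) \<le> Re (mtrace (1\<^sub>m n - Y * adj Y))"
    using norm_mtrace_psd_mult_le[OF _ hermitian_defect[OF Y_carrier(2)] psd_defect[OF contraction_adj[OF contr]] assms] c(2)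
    by simp
  ultimately show "cmod (mtrace ((1\<^sub>m n - Y * adj Y) * B)) \<le> d"
    using defect by simp
qed

lemma d_nonneg: "d \<ge> 0"
  using norm_mtrace_defect_mult_le(1)[OF contraction_one] norm_ge_zero order_trans by blast

definition P :: "int \<Rightarrow> complex mat" where
  "P j = (if j \<ge> 0 then Y ^\<^sub>m nat j else adj Y ^\<^sub>m nat (- j))"

lemma contraction_P: "contraction n (P j)"
  using contr by (auto simp: P_def intro!: contraction_pow contraction_adj)

lemma P_carrier: "P j \<in> carrier_mat n n"
  using contraction_P by (simp add: contraction_def)

lemma mtrace_P: "mtrace (P j) = (if j = 0 then of_nat n else 0)"
  using Y_carrier by (auto simp: P_def trace_pow) (simp add: mtrace_def)

text \<open>Cyclicity of the trace brings the inner factor \<open>adj Z * Z\<close> to the front,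
  where replacing it by 1 costs the trace of a defect against the contraction \<open>B * R\<close>.
  The bound on this trace is a hypothesis so that both \<open>Z = Y\<close> and
  \<open>Z = adj Y\<close> are covered.\<close>

lemma cancel_defect:
  assumes R: "contraction n R" and Z: "Z \<in> carrier_mat n n" and B: "contraction n B"
    and le: "\<And>B. contraction n B \<Longrightarrow> cmod (mtrace ((1\<^sub>m n - adj Z * Z) * B)) \<le> d"
  shows "cmod (mtrace (R * adj Z * (Z * B)) - mtrace (R * B)) \<le> d"
proof -
  have Rc: "R \<in> carrier_mat n n" and Bc: "B \<in> carrier_mat n n" and aZ: "adj Z \<in> carrier_mat n n"
    using R B Z by (auto simp: contraction_def)
  have ZB: "Z * B \<in> carrier_mat n n" and ZZ: "adj Z * Z \<in> carrier_mat n n" and BR: "B * R \<in> carrier_mat n n"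
    and aZZB: "adj Z * (Z * B) \<in> carrier_mat n n"
    by (meson mult_carrier_mat Z Bc aZ Rc)+
  have "R * adj Z * (Z * B) = R * (adj Z * (Z * B))"
    by (rule assoc_mult_mat[OF Rc aZ ZB])
  also have "adj Z * (Z * B) = adj Z * Z * B"
    by (rule assoc_mult_mat[OF aZ Z Bc, symmetric])
  also have "mtrace (R * (adj Z * Z * B)) = mtrace (adj Z * Z * B * R)"
    by (rule mtrace_comm[OF Rc]) (meson mult_carrier_mat ZZ Bc)
  also have "adj Z * Z * B * R = adj Z * Z * (B * R)"
    by (rule assoc_mult_mat[OF ZZ Bc Rc])
  finally have 1: "mtrace (R * adj Z * (Z * B)) = mtrace (adj Z * Z * (B * R))" .
  have "(1\<^sub>m n - adj Z * Z) * (B * R) = B * R - adj Z * Z * (B * R)"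
    unfolding minus_mult_distrib_mat[OF one_carrier_mat ZZ BR] left_mult_one_mat[OF BR] ..
  moreover have "adj Z * Z * (B * R) \<in> carrier_mat n n" by (meson mult_carrier_mat ZZ BR)
  ultimately have "mtrace ((1\<^sub>m n - adj Z * Z) * (B * R)) = mtrace (R * B) - mtrace (R * adj Z * (Z * B))"
    using mtrace_minus[OF BR] mtrace_comm[OF Bc Rc] 1 by simp
  with le[OF contraction_mult[OF B R]] show ?thesis by (simp add: norm_minus_commute)
qed

text \<open>A power of matching sign absorbs the new factor exactly; opposite signs meet as
  \<open>adj Y * Y\<close> or \<open>Y * adj Y\<close> and cancel at cost \<open>d\<close>.\<close>

lemma mtrace_P_step:
  assumes B: "contraction n B"
  shows "cmod (mtrace (P j * (Y * B)) - mtrace (P (j + 1) * B)) \<le> d"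
    "cmod (mtrace (P j * (adj Y * B)) - mtrace (P (j - 1) * B)) \<le> d"
proof -
  have Bc: "B \<in> carrier_mat n n" using B by (simp add: contraction_def)
  show "cmod (mtrace (P j * (Y * B)) - mtrace (P (j + 1) * B)) \<le> d"
  proof (cases "j \<ge> 0")
    case True
    then have "P (j + 1) = P j * Y" by (simp add: P_def nat_add_distrib)
    then show ?thesis using assoc_mult_mat[OF P_carrier Y_carrier(1) Bc] d_nonneg by simp
  next
    case False
    then have "nat (- j) = Suc (nat (- (j + 1)))" by simp
    then have "P j = P (j + 1) * adj Y" using False Y_carrier by (cases "j = - 1") (auto simp: P_def)
    then show ?thesis
      using cancel_defect[OF contraction_P Y_carrier(1) B norm_mtrace_defect_mult_le(1)] by simp
  qed
  show "cmod (mtrace (P j * (adj Y * B)) - mtrace (P (j - 1) * B)) \<le> d"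
  proof (cases "j \<le> 0")
    case True
    then have "nat (- (j - 1)) = Suc (nat (- j))" by simp
    then have "P (j - 1) = P j * adj Y" using True by (cases "j = 0") (use Y_carrier in \<open>auto simp: P_def\<close>)
    then show ?thesis using assoc_mult_mat[OF P_carrier Y_carrier(2) Bc] d_nonneg by simp
  next
    case False
    then have "nat j = Suc (nat (j - 1))" by simp
    then have "P j = P (j - 1) * adj (adj Y)" using False by (auto simp: P_def)
    then show ?thesis
      using cancel_defect[OF contraction_P[of "j - 1"] Y_carrier(2) B] norm_mtrace_defect_mult_le(2) by simp
  qed
qed

definition T :: "complex mat" where "T = Y + adj Y"

lemma T_carrier: "T \<in> carrier_mat n n"
  using Y_carrier by (simp add: T_def)

text \<open>The factor \<open>B\<close> collects the part of the product already expanded, which is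
  the generality the induction needs. Two errors \<open>4^m d\<close> and one error
  \<open>2^m (2 d)\<close> from moving a factor into \<open>P j\<close> fit into
  \<open>4^(m+1) d\<close>.\<close>

lemma mtrace_T_pow_mult:
  "contraction n B \<Longrightarrow> cmod (mtrace (T ^\<^sub>m m * B) - walk_sum m (\<lambda>j. mtrace (P j * B))) \<le> 4 ^ m * d"
proof (induction m arbitrary: B)
  case 0
  have "P 0 = T ^\<^sub>m 0" using Y_carrier T_carrier by (simp add: P_def)
  then show ?case using d_nonneg by simp
next
  case (Suc m)
  have Bc: "B \<in> carrier_mat n n" using Suc.prems by (simp add: contraction_def)
  have Tm: "T ^\<^sub>m m \<in> carrier_mat n n" using T_carrier by simp
  have YB: "Y * B \<in> carrier_mat n n" "adj Y * B \<in> carrier_mat n n"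
    by (meson mult_carrier_mat Y_carrier Bc)+
  have c: "contraction n (Y * B)" "contraction n (adj Y * B)"
    using contraction_mult contraction_adj contr Suc.prems by blast+
  have "T ^\<^sub>m Suc m * B = T ^\<^sub>m m * (T * B)"
    using assoc_mult_mat[OF Tm T_carrier Bc] by simp
  also have "T * B = Y * B + adj Y * B"
    unfolding T_def by (rule add_mult_distrib_mat[OF Y_carrier Bc])
  also have "T ^\<^sub>m m * (Y * B + adj Y * B) = T ^\<^sub>m m * (Y * B) + T ^\<^sub>m m * (adj Y * B)"
    by (rule mult_add_distrib_mat[OF Tm YB])
  finally have 1: "mtrace (T ^\<^sub>m Suc m * B) = mtrace (T ^\<^sub>m m * (Y * B)) + mtrace (T ^\<^sub>m m * (adj Y * B))"
    using mtrace_add[OF mult_carrier_mat[OF Tm YB(1)] mult_carrier_mat[OF Tm YB(2)]] by simp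
  define g where "g = (\<lambda>j. mtrace (P j * (Y * B)))"
  define h where "h = (\<lambda>j. mtrace (P j * (adj Y * B)))"
  have 2: "cmod (walk_sum m (\<lambda>j. g j + h j) - walk_sum (Suc m) (\<lambda>j. mtrace (P j * B))) \<le> 2 ^ m * (2 * d)"
    unfolding walk_sum.simps
  proof (rule walk_sum_diff_le)
    fix j
    have "cmod ((g j - mtrace (P (j + 1) * B)) + (h j - mtrace (P (j - 1) * B))) \<le> d + d"
      unfolding g_def h_def by (intro norm_triangle_mono mtrace_P_step Suc.prems)
    then show "cmod (g j + h j - (mtrace (P (j + 1) * B) + mtrace (P (j - 1) * B))) \<le> 2 * d"
      by (simp add: algebra_simps)
  qed
  have "mtrace (T ^\<^sub>m Suc m * B) - walk_sum (Suc m) (\<lambda>j. mtrace (P j * B)) =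
      (mtrace (T ^\<^sub>m m * (Y * B)) - walk_sum m g) + (mtrace (T ^\<^sub>m m * (adj Y * B)) - walk_sum m h) +
      (walk_sum m (\<lambda>j. g j + h j) - walk_sum (Suc m) (\<lambda>j. mtrace (P j * B)))"
    unfolding 1 walk_sum_add by (simp del: walk_sum.simps)
  also have "cmod \<dots> \<le> 4 ^ m * d + 4 ^ m * d + 2 ^ m * (2 * d)"
    by (intro norm_triangle_mono 2) (use Suc.IH[OF c(1)] Suc.IH[OF c(2)] in \<open>auto simp: g_def h_def\<close>)
  also have "\<dots> \<le> 4 ^ Suc m * d"
  proof -
    have "(2::real) ^ m \<le> 4 ^ m" by (intro power_mono) auto
    then have "2 ^ m * (2 * d) \<le> 4 ^ m * (2 * d)" using d_nonneg by (intro mult_right_mono) auto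
    then show ?thesis by (simp add: mult.commute)
  qed
  finally show ?case .
qed

lemma mtrace_T_pow:
  "cmod (mtrace (T ^\<^sub>m m) - of_nat n * walk_sum m (\<lambda>j. if j = 0 then 1 else 0)) \<le> 4 ^ m * d"
proof -
  have "walk_sum m (\<lambda>j. mtrace (P j * 1\<^sub>m n)) = walk_sum m (\<lambda>j. of_nat n * (if j = 0 then 1 else 0))"
    using P_carrier by (intro walk_sum_cong) (simp add: mtrace_P right_mult_one_mat[OF P_carrier])
  then show ?thesis
    using mtrace_T_pow_mult[OF contraction_one, of m] T_carrier
    by (simp add: walk_sum_scale right_mult_one_mat[of _ n n])
qed

lemma T_hermitian: "adj T = T"
  unfolding T_def using Y_carrier by (intro eq_matI) (auto simp: adj_def)

end

section \<open>Counting eigenvalues through moments\<close>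

lemma card_cos_gt_le:
  assumes "0 < \<gamma>" "\<gamma> < pi"
  shows "real (card {k. k < N \<and> cos (2 * pi * real k / real N) > cos \<gamma>}) \<le> real N * \<gamma> / pi + 2"
proof (cases "N = 0")
  case False
  \<comment> \<open>The admissible angles form two arcs of length \<gamma>, one on each side of
    angle 0, and each holds at most \<open>x + 1\<close> of the \<open>N\<close> points.\<close>
  define x where "x = real N * \<gamma> / (2 * pi)"
  have x0: "x \<ge> 0" using assms by (simp add: x_def)
  let ?A = "{k. k < N \<and> cos (2 * pi * real k / real N) > cos \<gamma>}"
  define M where "M = nat \<lceil>x\<rceil>"
  have M: "real M \<le> x + 1" using x0 by (simp add: M_def)
  have "?A \<subseteq> {..<M} \<union> (\<lambda>k. N - k) ` {..<M}"
  proof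
    fix k assume k: "k \<in> ?A"
    define a where "a = 2 * pi * real k / real N"
    have a: "0 \<le> a" "a < 2 * pi" using k False by (auto simp: a_def field_simps)
    have ca: "cos a > cos \<gamma>" using k by (simp add: a_def)
    show "k \<in> {..<M} \<union> (\<lambda>k. N - k) ` {..<M}"
    proof (cases "a \<le> pi")
      case True
      have "a < \<gamma>" using ca a True assms cos_monotone_0_pi_le[of \<gamma> a] by force
      then have "real k < x" using False by (simp add: a_def x_def field_simps)
      then have "k < M" unfolding M_def by linarith
      then show ?thesis by simp
    next
      case False': False
      have "cos (2 * pi - a) = cos a" by (simp add: cos_diff)
      then have "2 * pi - a < \<gamma>"
        using ca a False' assms cos_monotone_0_pi_le[of \<gamma> "2 * pi - a"] by force
      then have "real (N - k) < x"
        using False k by (simp add: a_def x_def of_nat_diff field_simps)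
      then have "N - k < M" unfolding M_def by linarith
      moreover have "k = N - (N - k)" using k by simp
      ultimately show ?thesis by blast
    qed
  qed
  then have "card ?A \<le> card ({..<M} \<union> (\<lambda>k. N - k) ` {..<M})" by (intro card_mono) auto
  also have "\<dots> \<le> card {..<M} + card ((\<lambda>k. N - k) ` {..<M})" by (rule card_Un_le)
  also have "\<dots> \<le> M + M" using card_image_le[of "{..<M}" "\<lambda>k. N - k"] by simp
  finally have "real (card ?A) \<le> real (M + M)" by (simp only: of_nat_le_iff)
  with M have "real (card ?A) \<le> 2 * (x + 1)" by simp
  then show ?thesis by (simp add: x_def field_simps)
qed simp

lemma step_function_polynomial_bound:
  assumes "0 < \<gamma>" "\<gamma> < pi" "\<epsilon> > 0"
  shows "\<exists>(D::nat) (N::nat) (a::nat \<Rightarrow> real). D < N \<and>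
    (\<forall>x. \<bar>x\<bar> \<le> 2 \<longrightarrow> (\<Sum>i\<le>D. a i * x ^ i) \<ge> (if x \<ge> 2 * cos \<gamma> then 1 else 0)) \<and>
    (\<Sum>k<N. \<Sum>i\<le>D. a i * (2 * cos (2 * pi * real k / real N)) ^ i) \<le> (\<gamma> / pi + \<epsilon>) * real N"
proof -
  \<comment> \<open>A slightly larger angle leaves room for a continuous ramp from 0 at
    \<open>2 * cos \<gamma>'\<close> to 1 at \<open>2 * cos \<gamma>\<close>; the share of the
    circle grows by at most \<open>\<epsilon> / 4\<close>.\<close>
  define \<gamma>' where "\<gamma>' = min ((\<gamma> + pi) / 2) (\<gamma> + pi * \<epsilon> / 4)"
  have g': "\<gamma> < \<gamma>'" "\<gamma>' < pi" "\<gamma>' / pi \<le> \<gamma> / pi + \<epsilon> / 4"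
    using assms by (auto simp: \<gamma>'_def field_simps min_def)
  have c: "2 * cos \<gamma>' < 2 * cos \<gamma>" using g' assms by (simp add: cos_monotone_0_pi)
  define f where "f = (\<lambda>x. max 0 (min 1 ((x - 2 * cos \<gamma>') / (2 * cos \<gamma> - 2 * cos \<gamma>'))))"
  define e where "e = \<epsilon> / 8"
  have e: "e > 0" using assms by (simp add: e_def)
  have f: "0 \<le> f x" "f x \<le> 1" "x \<ge> 2 * cos \<gamma> \<Longrightarrow> f x = 1" "x \<le> 2 * cos \<gamma>' \<Longrightarrow> f x = 0" for x
    using c by (auto simp: f_def field_simps max_def min_def)
  have "continuous_on {-2..2} (\<lambda>x. f x + e)"
    unfolding f_def using c by (intro continuous_intros) auto
  \<comment> \<open>Approximating \<open>f + e\<close> within \<open>e\<close> puts the polynomial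
    between \<open>f\<close> and \<open>f + 2 e\<close>, hence above the step function.\<close>
  from Stone_Weierstrass_real_polynomial_function[OF compact_Icc this e]
  obtain p where p: "real_polynomial_function p" "\<And>x. x \<in> {-2..2} \<Longrightarrow> \<bar>f x + e - p x\<bar> < e"
    by blast
  from p(1) obtain a D where aD: "p = (\<lambda>x. \<Sum>i\<le>D. a i * x ^ i)"
    unfolding real_polynomial_function_iff_sum by blast
  \<comment> \<open>\<open>N\<close> exceeds the degree, so that the moments are exact, and
    \<open>8 / \<epsilon>\<close>, so that the rounding term 2 in the count of points is at most
    \<open>N \<epsilon> / 4\<close>.\<close>
  define N where "N = Suc (D + nat \<lceil>8 / \<epsilon>\<rceil>)"
  have N: "real N * \<epsilon> \<ge> 8"
  proof -
    have "real N \<ge> 8 / \<epsilon>" unfolding N_def by linarith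
    then show ?thesis using assms(3) by (simp add: field_simps)
  qed
  have pb: "f x \<le> p x" "p x \<le> f x + 2 * e" if "\<bar>x\<bar> \<le> 2" for x
    using p(2)[of x] that by (auto simp: abs_if split: if_splits)
  show ?thesis
  proof (rule exI[of _ D], rule exI[of _ N], rule exI[of _ a], intro conjI allI impI)
    show "D < N" by (simp add: N_def)
    show "(\<Sum>i\<le>D. a i * x ^ i) \<ge> (if x \<ge> 2 * cos \<gamma> then 1 else 0)" if "\<bar>x\<bar> \<le> 2" for x
      using pb(1)[OF that] f(1,3)[of x] unfolding aD by auto
    define y where "y = (\<lambda>k. 2 * cos (2 * pi * real k / real N))"
    have y: "\<bar>y k\<bar> \<le> 2" for k by (simp add: y_def abs_mult)
    have "(\<Sum>k<N. p (y k)) \<le> (\<Sum>k<N. 2 * e + (if y k > 2 * cos \<gamma>' then 1 else 0))"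
    proof (intro sum_mono)
      fix k
      show "p (y k) \<le> 2 * e + (if y k > 2 * cos \<gamma>' then 1 else 0)"
        using pb(2)[OF y, of k] f(2)[of "y k"] f(4)[of "y k"] by auto
    qed
    also have "\<dots> = 2 * e * real N + real (card {k. k < N \<and> y k > 2 * cos \<gamma>'})"
      by (simp add: sum.distrib sum.If_cases Int_def lessThan_def)
    also have "\<dots> \<le> 2 * e * real N + (real N * \<gamma>' / pi + 2)"
      using card_cos_gt_le[of \<gamma>' N] g' assms by (simp add: y_def)
    also have "\<dots> \<le> 2 * e * real N + real N * (\<gamma> / pi + \<epsilon> / 4) + real N * \<epsilon> / 4"
    proof -
      have "real N * (\<gamma>' / pi) \<le> real N * (\<gamma> / pi + \<epsilon> / 4)" using g'(3) by (intro mult_left_mono) auto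
      then show ?thesis using N by simp
    qed
    also have "\<dots> \<le> (\<gamma> / pi + \<epsilon>) * real N"
      using assms by (simp add: e_def algebra_simps)
    finally show "(\<Sum>k<N. \<Sum>i\<le>D. a i * (2 * cos (2 * pi * real k / real N)) ^ i) \<le> (\<gamma> / pi + \<epsilon>) * real N"
      by (simp add: aD y_def)
  qed
qed

text \<open>A polynomial above the indicator of \<open>[2 cos \<gamma>, 2]\<close> bounds the count
  by moments, and these agree up to \<open>4^i d\<close> with the moments of \<open>2 cos\<close> on
  the circle, where the set in question has share \<open>\<gamma> / pi\<close>. The polynomial
  depends only on \<gamma> and \<epsilon>, so \<open>C\<close> serves all \<open>n\<close>,
  \<open>d\<close> and \<open>Y\<close>.\<close>

theorem near_shift_eigenvalue_count:
  assumes \<gamma>: "0 < \<gamma>" "\<gamma> < pi" and \<epsilon>: "\<epsilon> > 0"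
  shows "\<exists>C. \<forall>n d Y u l. near_shift n d Y \<longrightarrow> eigenbasis n (Y + adj Y) u l \<longrightarrow>
    real (card {k. k < n \<and> l k \<ge> 2 * cos \<gamma>}) \<le> (\<gamma> / pi + \<epsilon>) * real n + C * d"
proof -
  from step_function_polynomial_bound[OF \<gamma> \<epsilon>]
  obtain D N :: nat and a :: "nat \<Rightarrow> real" where aD: "D < N"
    "\<forall>x. \<bar>x\<bar> \<le> 2 \<longrightarrow> (\<Sum>i\<le>D. a i * x ^ i) \<ge> (if x \<ge> 2 * cos \<gamma> then 1 else 0)"
    "(\<Sum>k<N. \<Sum>i\<le>D. a i * (2 * cos (2 * pi * real k / real N)) ^ i) \<le> (\<gamma> / pi + \<epsilon>) * real N"
    by (elim exE conjE) (rule that)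
  let ?y = "\<lambda>k. 2 * cos (2 * pi * real k / real N)"
  define C where "C = (\<Sum>i\<le>D. \<bar>a i\<bar> * 4 ^ i)"
  have "real (card {k. k < n \<and> l k \<ge> 2 * cos \<gamma>}) \<le> (\<gamma> / pi + \<epsilon>) * real n + C * d"
    if ns: "near_shift n d Y" and eb: "eigenbasis n (Y + adj Y) u l"
    for n d Y u l
  proof -
    interpret near_shift n d Y by fact
    define p where "p = (\<lambda>x. \<Sum>i\<le>D. a i * x ^ i)"
    have lb: "\<bar>l m\<bar> \<le> 2" if m: "m < n" for m
    proof -
      note norm1 = eigenbasis_norm[OF eb m]
      let ?v = "vec n (\<lambda>i. u i m)"
      have bnd: "cmod (\<Sum>i<n. cnj (u i m) * (Z *\<^sub>v ?v) $ i) \<le> 1" if "contraction n Z" for Z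
        by (rule contraction_numerical_radius[OF that norm1])
      have "(\<Sum>i<n. \<Sum>j<n. cnj (u i m) * (Y + adj Y) $$ (i, j) * u j m) =
          of_real (\<Sum>k<n. l k * (cmod (\<Sum>i<n. cnj (u i k) * u i m))\<^sup>2)"
        by (rule quadratic_form_eigenbasis) (rule eigenbasisD(3)[OF eb])
      also have "(\<Sum>k<n. l k * (cmod (\<Sum>i<n. cnj (u i k) * u i m))\<^sup>2) = (\<Sum>k<n. if k = m then l k else 0)"
        using m eigenbasisD(1)[OF eb] by (intro sum.cong refl) auto
      also have "\<dots> = l m" using m by simp
      finally have "complex_of_real (l m) = (\<Sum>i<n. \<Sum>j<n. cnj (u i m) * (Y + adj Y) $$ (i, j) * u j m)" ..
      also have "\<dots> = (\<Sum>i<n. cnj (u i m) * (Y *\<^sub>v ?v) $ i) + (\<Sum>i<n. cnj (u i m) * (adj Y *\<^sub>v ?v) $ i)"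
        unfolding sum.distrib[symmetric]
      proof (intro sum.cong refl)
        fix i assume "i \<in> {..<n}"
        then have i: "i < n" by simp
        show "(\<Sum>j<n. cnj (u i m) * (Y + adj Y) $$ (i, j) * u j m) =
            cnj (u i m) * (Y *\<^sub>v ?v) $ i + cnj (u i m) * (adj Y *\<^sub>v ?v) $ i"
          unfolding index_mult_mat_vec_sum[OF Y_carrier(1) vec_carrier i]
            index_mult_mat_vec_sum[OF Y_carrier(2) vec_carrier i] sum_distrib_left sum.distrib[symmetric]
          using i Y_carrier by (intro sum.cong refl) (simp add: algebra_simps)
      qed
      finally have "cmod (complex_of_real (l m)) \<le> 1 + 1"
        by (simp only:) (intro norm_triangle_mono bnd contr contraction_adj)
      then show ?thesis by simp
    qed
    have "real (card {k. k < n \<and> l k \<ge> 2 * cos \<gamma>}) = (\<Sum>k<n. if l k \<ge> 2 * cos \<gamma> then 1 else 0)"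
      by (simp add: sum.If_cases Int_def lessThan_def)
    also have "\<dots> \<le> (\<Sum>k<n. p (l k))"
      unfolding p_def using lb aD(2) by (intro sum_mono) auto
    also have "\<dots> = (\<Sum>i\<le>D. a i * (\<Sum>k<n. l k ^ i))"
      unfolding p_def by (subst sum.swap) (simp add: sum_distrib_left)
    also have "\<dots> \<le> (\<Sum>i\<le>D. a i * (real n * ((\<Sum>k<N. ?y k ^ i) / real N)) + \<bar>a i\<bar> * (4 ^ i * d))"
    proof (intro sum_mono)
      fix i assume "i \<in> {..D}"
      then have i: "i < N" using aD(1) by simp
      let ?s = "\<Sum>k<n. l k ^ i" and ?r = "real n * ((\<Sum>k<N. ?y k ^ i) / real N)"
      have "mtrace (T ^\<^sub>m i) = of_real ?s"
        by (rule mtrace_hermitian_pow[OF T_carrier]) (use eb in \<open>simp add: T_def\<close>)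
      then have "cmod (of_real ?s - of_nat n * of_real ((\<Sum>k<N. ?y k ^ i) / real N)) \<le> 4 ^ i * d"
        using mtrace_T_pow[of i] unfolding walk_sum_delta[OF i] by simp
      moreover have "of_real ?s - of_nat n * of_real ((\<Sum>k<N. ?y k ^ i) / real N) = complex_of_real (?s - ?r)"
        by simp
      ultimately have "\<bar>?s - ?r\<bar> \<le> 4 ^ i * d" by (metis norm_of_real)
      then have "\<bar>a i\<bar> * \<bar>?s - ?r\<bar> \<le> \<bar>a i\<bar> * (4 ^ i * d)" by (intro mult_left_mono) auto
      then have "\<bar>a i * ?s - a i * ?r\<bar> \<le> \<bar>a i\<bar> * (4 ^ i * d)"
        by (simp only: abs_mult[symmetric] right_diff_distrib[symmetric])
      then show "a i * ?s \<le> a i * ?r + \<bar>a i\<bar> * (4 ^ i * d)" by linarith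
    qed
    also have "\<dots> = real n / real N * (\<Sum>i\<le>D. \<Sum>k<N. a i * ?y k ^ i) + C * d"
      unfolding sum.distrib C_def sum_distrib_left sum_distrib_right sum_divide_distrib
      by (intro arg_cong2[of _ _ _ _ "(+)"] sum.cong refl) (simp_all add: mult_ac)
    also have "(\<Sum>i\<le>D. \<Sum>k<N. a i * ?y k ^ i) =
        (\<Sum>k<N. \<Sum>i\<le>D. a i * ?y k ^ i)"
      by (rule sum.swap)
    also have "real n / real N * \<dots> + C * d \<le> real n / real N * ((\<gamma> / pi + \<epsilon>) * real N) + C * d"
      by (intro add_right_mono mult_left_mono aD(3)) simp
    also have "\<dots> = (\<gamma> / pi + \<epsilon>) * real n + C * d"
      using aD(1) by simp
    finally show ?thesis .
  qed
  then show ?thesis by blast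
qed

section \<open>Area forms of vector polygons\<close>

definition area_form :: "nat \<Rightarrow> real \<Rightarrow> (nat \<Rightarrow> nat \<Rightarrow> real) \<Rightarrow> (nat \<Rightarrow> complex) \<Rightarrow> real" where
  "area_form m s g x = s * (\<Sum>p<m. (cmod (x p))\<^sup>2) +
     2 * Im (\<Sum>p<m. \<Sum>q<p. of_real (g p q) * (cnj (x p) * x q))"

text \<open>An upper bound for the nonpositive index on the subspace \<open>K\<close>, expressed by
  a set of linear conditions that force positivity. In this form the bounds for several groups of
  letters are combined by taking unions.\<close>

definition index_le ::
  "nat \<Rightarrow> ((nat \<Rightarrow> complex) \<Rightarrow> bool) \<Rightarrow> real \<Rightarrow> (nat \<Rightarrow> nat \<Rightarrow> real) \<Rightarrow> real \<Rightarrow> bool" where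
  "index_le m K s g b \<longleftrightarrow> (\<exists>F. finite F \<and> real (card F) \<le> b \<and>
    (\<forall>x. K x \<longrightarrow> (\<forall>f\<in>F. (\<Sum>p<m. f p * x p) = 0) \<longrightarrow> (\<exists>p<m. x p \<noteq> 0) \<longrightarrow> area_form m s g x > 0))"

lemma index_le_mono:
  assumes "index_le m K s g b" "\<And>x. K' x \<Longrightarrow> K x" "\<And>p q. p < m \<Longrightarrow> q < m \<Longrightarrow> g p q = g' p q"
  shows "index_le m K' s g' b"
proof -
  have "area_form m s g = area_form m s g'"
    unfolding area_form_def using assms(3)
    by (intro ext arg_cong2[of _ _ _ _ "(+)"] arg_cong2[of _ _ _ _ "(*)"] arg_cong[of _ _ Im] sum.cong refl
      arg_cong[of _ _ of_real]) auto
  from assms(1)[unfolded index_le_def this] show ?thesis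
    unfolding index_le_def using assms(2) by blast
qed

lemma sum_square_split:
  fixes h :: "nat \<Rightarrow> nat \<Rightarrow> 'a::comm_monoid_add"
  shows "(\<Sum>p<m. \<Sum>q<m. h p q) = (\<Sum>p<m. h p p) + (\<Sum>p<m. \<Sum>q<p. h p q + h q p)"
proof (induction m)
  case (Suc m)
  have "(\<Sum>p<Suc m. \<Sum>q<Suc m. h p q) = (\<Sum>p<m. \<Sum>q<m. h p q) + (\<Sum>p<m. h p m) + ((\<Sum>q<m. h m q) + h m m)"
    by (simp add: sum.distrib add_ac)
  then show ?case by (simp add: Suc sum.distrib add_ac)
qed simp

lemma strictly_lower_pow:
  assumes "A \<in> carrier_mat n n" "\<And>i j. i \<le> j \<Longrightarrow> j < n \<Longrightarrow> A $$ (i, j) = 0" "k > 0" "i \<le> j" "j < n"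
  shows "(A ^\<^sub>m k) $$ (i, j) = (0 :: complex)"
  using assms(3-5)
proof (induction k arbitrary: i j)
  case (Suc k)
  have c: "A ^\<^sub>m k \<in> carrier_mat n n" using assms(1) by simp
  show ?case
  proof (cases "k = 0")
    case True
    then show ?thesis using Suc.prems assms(1,2) by simp
  next
    case False
    have "(A ^\<^sub>m Suc k) $$ (i, j) = (\<Sum>l<n. (A ^\<^sub>m k) $$ (i, l) * A $$ (l, j))"
      using Suc.prems by (simp add: index_mult_mat_sum[OF c assms(1)])
    also have "\<dots> = 0"
    proof (intro sum.neutral ballI)
      fix l assume l: "l \<in> {..<n}"
      show "(A ^\<^sub>m k) $$ (i, l) * A $$ (l, j) = 0"
      proof (cases "l \<le> j")
        case True
        then show ?thesis using assms(2) Suc.prems by simp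
      next
        case False': False
        then have "(A ^\<^sub>m k) $$ (i, l) = 0" using False Suc.prems l by (intro Suc.IH) auto
        then show ?thesis by simp
      qed
    qed
    finally show ?thesis .
  qed
qed simp

lemma adj_pow:
  assumes A: "A \<in> carrier_mat n n"
  shows "adj (A ^\<^sub>m k) = adj A ^\<^sub>m k"
proof (induction k)
  case 0
  then show ?case using A by simp
next
  case (Suc k)
  have aA: "adj A \<in> carrier_mat n n" using A by auto
  have comm: "adj A * adj A ^\<^sub>m k = adj A ^\<^sub>m k * adj A" for k
  proof (induction k)
    case (Suc k)
    have c: "adj A ^\<^sub>m k \<in> carrier_mat n n" using aA by simp
    have "adj A * (adj A ^\<^sub>m k * adj A) = adj A * adj A ^\<^sub>m k * adj A"
      by (rule assoc_mult_mat[OF aA c aA, symmetric])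
    then show ?case using Suc by simp
  qed (use A in simp)
  have "adj (A ^\<^sub>m Suc k) = adj A * adj (A ^\<^sub>m k)"
    using A by (simp add: adj_mult[of _ n n _ n])
  then show ?case using Suc comm by simp
qed

lemma mtrace_strictly_lower_pow:
  assumes "A \<in> carrier_mat n n" "\<And>i j. i \<le> j \<Longrightarrow> j < n \<Longrightarrow> A $$ (i, j) = 0" "k > 0"
  shows "mtrace (A ^\<^sub>m k) = 0" "mtrace (adj A ^\<^sub>m k) = 0"
proof -
  have z: "(A ^\<^sub>m k) $$ (i, i) = 0" if "i < n" for i
    by (rule strictly_lower_pow[OF assms]) (use that in auto)
  have c: "dim_row (A ^\<^sub>m k) = n" "dim_col (A ^\<^sub>m k) = n"
    using pow_carrier_mat[OF assms(1), of k] by auto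
  show "mtrace (A ^\<^sub>m k) = 0" using z by (simp add: mtrace_def c carrier_matD(1)[OF assms(1)])
  show "mtrace (adj A ^\<^sub>m k) = 0"
    unfolding adj_pow[OF assms(1), symmetric] using z assms(3) c
    by (simp add: mtrace_def carrier_matD[OF assms(1)])
qed

text \<open>
  The lower triangular matrix \<open>D\<close> satisfies \<open>D + D\<^sup>* = 1 + \<Gamma>\<close> for the Gram matrix
  \<open>\<Gamma>\<close> of the normalised vectors, which has rank at most \<open>d\<close>. Hence \<open>Y = 1 - D\<^sup>-\<^sup>1\<close> is
  nilpotent and unitary up to a perturbation of rank \<open>d\<close>.
\<close>

locale vector_family =
  fixes m d :: nat and e :: "nat \<Rightarrow> nat \<Rightarrow> real" and c :: real
  assumes c_pos: "c > 0" and norm_e: "\<And>p. p < m \<Longrightarrow> (\<Sum>a<d. (e p a)\<^sup>2) = c"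
begin

definition g :: "nat \<Rightarrow> nat \<Rightarrow> real" where "g p q = (\<Sum>a<d. e p a * e q a)"

definition A :: "(nat \<Rightarrow> complex) \<Rightarrow> complex" where
  "A x = (\<Sum>p<m. \<Sum>q<p. of_real (g p q) * (cnj (x p) * x q))"

definition E :: "nat \<Rightarrow> (nat \<Rightarrow> complex) \<Rightarrow> complex" where
  "E a x = (\<Sum>p<m. of_real (e p a) * x p)"

text \<open>Expand the squared length of the sum of the \<open>e p\<close> with weights
  \<open>x p\<close>: every diagonal term carries the factor \<open>c\<close>, and the two triangles
  are conjugate. For a closed polygon this determines the real part of \<open>A x\<close> from the
  energy, while the area is the imaginary part.\<close>

lemma gram: "c * (\<Sum>p<m. (cmod (x p))\<^sup>2) + 2 * Re (A x) = (\<Sum>a<d. (cmod (E a x))\<^sup>2)"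
proof -
  let ?h = "\<lambda>p q. of_real (g p q) * (cnj (x p) * x q)"
  have "complex_of_real (\<Sum>a<d. (cmod (E a x))\<^sup>2) = (\<Sum>a<d. cnj (E a x) * E a x)"
    by (simp add: complex_norm_square mult.commute del: of_real_power)
  also have "\<dots> = (\<Sum>a<d. \<Sum>p<m. \<Sum>q<m. of_real (e p a * e q a) * (cnj (x p) * x q))"
    unfolding E_def cnj_sum sum_product by (intro sum.cong refl) (simp add: mult_ac)
  also have "\<dots> = (\<Sum>p<m. \<Sum>q<m. \<Sum>a<d. of_real (e p a * e q a) * (cnj (x p) * x q))"
    by (rule sum_rotate3[symmetric])
  also have "\<dots> = (\<Sum>p<m. \<Sum>q<m. ?h p q)"
    unfolding g_def of_real_sum sum_distrib_right ..
  also have "\<dots> = (\<Sum>p<m. ?h p p) + (\<Sum>p<m. \<Sum>q<p. ?h p q + ?h q p)"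
    by (rule sum_square_split)
  finally have "Re (complex_of_real (\<Sum>a<d. (cmod (E a x))\<^sup>2)) =
      Re (\<Sum>p<m. ?h p p) + Re (\<Sum>p<m. \<Sum>q<p. ?h p q + ?h q p)" by simp
  moreover have "Re (\<Sum>p<m. ?h p p) = c * (\<Sum>p<m. (cmod (x p))\<^sup>2)"
    unfolding Re_sum sum_distrib_left
  proof (intro sum.cong refl)
    fix p assume "p \<in> {..<m}"
    then have "g p p = c" using norm_e[of p] by (simp add: g_def power2_eq_square)
    then show "Re (?h p p) = c * (cmod (x p))\<^sup>2" unfolding cmod_power2 by (simp add: power2_eq_square)
  qed
  moreover have "Re (\<Sum>p<m. \<Sum>q<p. ?h p q + ?h q p) = 2 * Re (A x)"
    unfolding A_def Re_sum sum_distrib_left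
    by (intro sum.cong refl) (simp add: g_def mult.commute algebra_simps)
  ultimately show ?thesis by simp
qed

definition N :: "complex mat" where
  "N = mat m m (\<lambda>(p, q). if q < p then of_real (g p q / c) else 0)"

definition D :: "complex mat" where "D = 1\<^sub>m m + N"

lemma N_carrier: "N \<in> carrier_mat m m" by (simp add: N_def)

lemma D_carrier: "D \<in> carrier_mat m m" by (simp add: D_def N_carrier)

lemma D_invertible: "\<exists>B. B \<in> carrier_mat m m \<and> D * B = 1\<^sub>m m \<and> B * D = 1\<^sub>m m"
proof -
  have "det D = prod_list (diag_mat D)"
    by (rule det_lower_triangular[OF _ D_carrier]) (auto simp: D_def N_def)
  also have "diag_mat D = map (\<lambda>_. 1) [0..<m]"
    by (auto simp: diag_mat_def D_def N_def)
  finally have "det D \<noteq> 0" by (auto simp: prod_list_zero_iff)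
  from det_non_zero_imp_unit[OF D_carrier this, unfolded Units_def, of "()"]
  show ?thesis by (auto simp: ring_mat_def)
qed

definition Dinv :: "complex mat" where
  "Dinv = (SOME B. B \<in> carrier_mat m m \<and> D * B = 1\<^sub>m m \<and> B * D = 1\<^sub>m m)"

lemma Dinv: "Dinv \<in> carrier_mat m m" "D * Dinv = 1\<^sub>m m" "Dinv * D = 1\<^sub>m m"
  using someI_ex[OF D_invertible] by (auto simp: Dinv_def)

definition Y where "Y = 1\<^sub>m m - Dinv"

lemma Y_carrier: "Y \<in> carrier_mat m m" unfolding Y_def by (rule minus_carrier_mat[OF Dinv(1)])

lemma Y_strictly_lower: "i \<le> j \<Longrightarrow> j < m \<Longrightarrow> Y $$ (i, j) = 0"
proof (induction i rule: less_induct)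
  case (less i)
  have "(if i = j then 1 else 0) = (D * Dinv) $$ (i, j)" using Dinv(2) less.prems by simp
  also have "\<dots> = (\<Sum>l<m. D $$ (i, l) * Dinv $$ (l, j))"
    using less.prems by (intro index_mult_mat_sum[OF D_carrier Dinv(1)]) auto
  also have "\<dots> = (\<Sum>l<m. (if l = i then Dinv $$ (i, j) else 0))"
  proof (intro sum.cong refl)
    fix l assume l: "l \<in> {..<m}"
    show "D $$ (i, l) * Dinv $$ (l, j) = (if l = i then Dinv $$ (i, j) else 0)"
    proof (cases "l < i")
      case True
      then have "Y $$ (l, j) = 0" using less by auto
      then have "Dinv $$ (l, j) = 0" using True less.prems Dinv(1) by (simp add: Y_def)
      then show ?thesis using True by simp
    next
      case False
      then show ?thesis using l less.prems by (auto simp: D_def N_def)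
    qed
  qed
  finally show ?case using less.prems Dinv(1) by (auto simp: Y_def)
qed

text \<open>With \<open>x = Dinv v\<close>, that is \<open>v = D x\<close>, the identity
  \<open>Y = 1 - Dinv\<close> becomes \<open>Y v = v - x = N x\<close>: every letter sees the
  letters before it.\<close>

lemma Y_vec:
  assumes v: "v \<in> carrier_vec m"
  defines "x \<equiv> (\<lambda>p. (Dinv *\<^sub>v v) $ p)" and "y \<equiv> (\<lambda>p. (Y *\<^sub>v v) $ p)"
  assumes p: "p < m"
  shows "v $ p = x p + y p" "y p = (\<Sum>q<p. of_real (g p q / c) * x q)"
proof -
  have Dv: "Dinv *\<^sub>v v \<in> carrier_vec m" by (meson mult_mat_vec_carrier Dinv(1) v)
  have "Y *\<^sub>v v = v - Dinv *\<^sub>v v"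
    unfolding Y_def using minus_mult_distrib_mat_vec[OF one_carrier_mat Dinv(1) v] v by simp
  then show 1: "v $ p = x p + y p" using p v Dv carrier_matD(1)[OF Dinv(1)] by (simp add: x_def y_def)
  have "v = D *\<^sub>v (Dinv *\<^sub>v v)"
    using assoc_mult_mat_vec[OF D_carrier Dinv(1) v] Dinv(2) v by simp
  also have "\<dots> = Dinv *\<^sub>v v + N *\<^sub>v (Dinv *\<^sub>v v)"
    unfolding D_def using add_mult_distrib_mat_vec[OF one_carrier_mat N_carrier Dv] Dv by simp
  finally have "v $ p = x p + (N *\<^sub>v (Dinv *\<^sub>v v)) $ p"
    using p N_carrier Dv by (metis x_def index_add_vec(1) mult_mat_vec_carrier carrier_vecD)
  also have "(N *\<^sub>v (Dinv *\<^sub>v v)) $ p = (\<Sum>q<m. if q < p then of_real (g p q / c) * x q else 0)"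
    unfolding index_mult_mat_vec_sum[OF N_carrier Dv p]
    using p by (intro sum.cong refl) (simp add: N_def x_def)
  also have "\<dots> = (\<Sum>q<p. of_real (g p q / c) * x q)"
    using p by (intro sum.mono_neutral_cong_right) auto
  finally show "y p = (\<Sum>q<p. of_real (g p q / c) * x q)" using 1 by simp
qed

lemma sum_x_y:
  assumes v: "v \<in> carrier_vec m"
  defines "x \<equiv> (\<lambda>p. (Dinv *\<^sub>v v) $ p)" and "y \<equiv> (\<lambda>p. (Y *\<^sub>v v) $ p)"
  shows "(\<Sum>p<m. cnj (x p) * y p) = A x / of_real c"
proof -
  have "(\<Sum>p<m. cnj (x p) * y p) = (\<Sum>p<m. \<Sum>q<p. (of_real (g p q) * (cnj (x p) * x q)) / of_real c)"
  proof (intro sum.cong refl)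
    fix p assume "p \<in> {..<m}"
    then have "y p = (\<Sum>q<p. of_real (g p q / c) * x q)"
      unfolding x_def y_def by (intro Y_vec(2)[OF v]) simp
    then show "cnj (x p) * y p = (\<Sum>q<p. (of_real (g p q) * (cnj (x p) * x q)) / of_real c)"
      by (simp add: sum_distrib_left mult_ac)
  qed
  then show ?thesis by (simp add: A_def sum_divide_distrib)
qed

text \<open>The cross term is \<open>A x / c\<close>, so \<open>gram\<close> applies: up to the
  factor \<open>c\<close>, the loss of norm is the squared length of the closing vector of the
  polygon. Hence \<open>Y\<close> is a contraction, and it preserves the norm of \<open>v\<close>
  when the polygon closes.\<close>

lemma norm2_diff:
  assumes v: "v \<in> carrier_vec m"
  shows "norm2 v - norm2 (Y *\<^sub>v v) = (\<Sum>a<d. (cmod (E a (\<lambda>p. (Dinv *\<^sub>v v) $ p)))\<^sup>2) / c"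
proof -
  define x where "x = (\<lambda>p. (Dinv *\<^sub>v v) $ p)"
  define y where "y = (\<lambda>p. (Y *\<^sub>v v) $ p)"
  have vxy: "v $ p = x p + y p" if "p < m" for p
    unfolding x_def y_def by (rule Y_vec(1)[OF v that])
  have "norm2 v - norm2 (Y *\<^sub>v v) = (\<Sum>p<m. (cmod (x p + y p))\<^sup>2 - (cmod (y p))\<^sup>2)"
    using v Y_carrier vxy by (simp add: norm2_def y_def sum_subtractf)
  also have "\<dots> = (\<Sum>p<m. (cmod (x p))\<^sup>2 + 2 * Re (cnj (x p) * y p))"
    unfolding cmod_power2 by (intro sum.cong refl) (simp add: power2_eq_square algebra_simps)
  also have "\<dots> = (\<Sum>p<m. (cmod (x p))\<^sup>2) + 2 * Re (\<Sum>p<m. cnj (x p) * y p)"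
    by (simp only: sum.distrib sum_distrib_left Re_sum)
  also have "(\<Sum>p<m. cnj (x p) * y p) = A x / of_real c"
    unfolding x_def y_def by (rule sum_x_y[OF v])
  finally show ?thesis
    using gram[of x] c_pos unfolding x_def[symmetric] by (simp add: field_simps)
qed

text \<open>\<open>F\<close> is the coefficient vector of the functional
  \<open>v \<mapsto> E a (Dinv v)\<close>. Evaluated at the conjugate of \<open>F\<close>, the
  functional equals its own squared norm \<open>h\<close>, and the loss of norm bounds
  \<open>h^2\<close> by \<open>c h\<close>.\<close>

lemma sum_E_Dinv_le:
  assumes "a < d"
  shows "(\<Sum>j<m. (cmod (E a (\<lambda>p. Dinv $$ (p, j))))\<^sup>2) \<le> c"
proof -
  define F where "F = (\<lambda>j. E a (\<lambda>p. Dinv $$ (p, j)))"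
  define h where "h = (\<Sum>j<m. (cmod (F j))\<^sup>2)"
  define v where "v = vec m (\<lambda>j. cnj (F j))"
  have v: "v \<in> carrier_vec m" by (simp add: v_def)
  have "E a (\<lambda>p. (Dinv *\<^sub>v v) $ p) = (\<Sum>p<m. \<Sum>j<m. of_real (e p a) * (Dinv $$ (p, j) * cnj (F j)))"
    unfolding E_def
  proof (intro sum.cong refl)
    fix p assume "p \<in> {..<m}"
    then show "of_real (e p a) * (Dinv *\<^sub>v v) $ p = (\<Sum>j<m. of_real (e p a) * (Dinv $$ (p, j) * cnj (F j)))"
      by (subst index_mult_mat_vec_sum[OF Dinv(1) v]) (auto simp: v_def sum_distrib_left)
  qed
  also have "\<dots> = (\<Sum>j<m. F j * cnj (F j))"
    by (subst sum.swap) (simp add: F_def E_def sum_distrib_right mult_ac)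
  also have "\<dots> = of_real h"
    by (simp add: h_def complex_norm_square del: of_real_power)
  finally have Eh: "(cmod (E a (\<lambda>p. (Dinv *\<^sub>v v) $ p)))\<^sup>2 = h\<^sup>2" by simp
  have "h\<^sup>2 \<le> (\<Sum>a<d. (cmod (E a (\<lambda>p. (Dinv *\<^sub>v v) $ p)))\<^sup>2)"
    unfolding Eh[symmetric] by (rule member_le_sum) (use assms in auto)
  also have "\<dots> = c * (norm2 v - norm2 (Y *\<^sub>v v))"
    using norm2_diff[OF v] c_pos by simp
  also have "\<dots> \<le> c * norm2 v"
    using c_pos by (intro mult_left_mono) (auto simp: norm2_def intro: sum_nonneg)
  also have "norm2 v = h" by (simp add: norm2_def v_def h_def)
  finally have "h * h \<le> c * h" by (simp add: power2_eq_square)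
  moreover have "h \<ge> 0" unfolding h_def by (intro sum_nonneg) auto
  ultimately have "h \<le> c" using c_pos by (cases "h = 0") auto
  then show ?thesis by (simp add: h_def F_def)
qed

lemma near_shift_Y:
  assumes z: "cmod z = 1"
  shows "near_shift m (real d) (z \<cdot>\<^sub>m Y)"
proof
  have zY: "z \<cdot>\<^sub>m Y \<in> carrier_mat m m" using Y_carrier by simp
  have norm_zY: "norm2 ((z \<cdot>\<^sub>m Y) *\<^sub>v v) = norm2 (Y *\<^sub>v v)" if v: "v \<in> carrier_vec m" for v
  proof -
    have "(z \<cdot>\<^sub>m Y) *\<^sub>v v = z \<cdot>\<^sub>v (Y *\<^sub>v v)" using Y_carrier v by (intro eq_vecI) auto
    then show ?thesis using z by (simp add: norm2_def norm_mult)
  qed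
  show "contraction m (z \<cdot>\<^sub>m Y)"
    unfolding contraction_def
  proof (intro conjI ballI zY)
    fix v :: "complex vec" assume v: "v \<in> carrier_vec m"
    have "(\<Sum>a<d. (cmod (E a (\<lambda>p. (Dinv *\<^sub>v v) $ p)))\<^sup>2) / c \<ge> 0"
      using c_pos by (intro divide_nonneg_pos sum_nonneg) auto
    then show "norm2 ((z \<cdot>\<^sub>m Y) *\<^sub>v v) \<le> norm2 v"
      using norm2_diff[OF v] norm_zY[OF v] by simp
  qed
  show "mtrace ((z \<cdot>\<^sub>m Y) ^\<^sub>m k) = 0" "mtrace (adj (z \<cdot>\<^sub>m Y) ^\<^sub>m k) = 0" if "k > 0" for k
    by (rule mtrace_strictly_lower_pow[OF zY _ that]; use Y_strictly_lower Y_carrier in simp)+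
  \<comment> \<open>The trace of the defect is the total loss of norm over the unit vectors, to
    which each of the \<open>d\<close> functionals contributes at most 1.\<close>
  have "Re (mtrace (1\<^sub>m m - adj (z \<cdot>\<^sub>m Y) * (z \<cdot>\<^sub>m Y))) = (\<Sum>j<m. 1 - norm2 ((z \<cdot>\<^sub>m Y) *\<^sub>v unit_vec m j))"
  proof -
    have "mtrace (1\<^sub>m m - adj (z \<cdot>\<^sub>m Y) * (z \<cdot>\<^sub>m Y)) = (\<Sum>j<m. 1 - (adj (z \<cdot>\<^sub>m Y) * (z \<cdot>\<^sub>m Y)) $$ (j, j))"
      using Y_carrier by (simp add: mtrace_def)
    also have "\<dots> = (\<Sum>j<m. 1 - of_real (norm2 ((z \<cdot>\<^sub>m Y) *\<^sub>v unit_vec m j)))"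
    proof (intro sum.cong refl arg_cong2[of _ _ _ _ "(-)"])
      fix j assume "j \<in> {..<m}"
      then have j: "j < m" by simp
      have "((z \<cdot>\<^sub>m Y) *\<^sub>v unit_vec m j) $ i = (z \<cdot>\<^sub>m Y) $$ (i, j)" if "i < m" for i
        using j that Y_carrier by simp
      then have "of_real (norm2 ((z \<cdot>\<^sub>m Y) *\<^sub>v unit_vec m j)) = (\<Sum>i<m. (z \<cdot>\<^sub>m Y) $$ (i, j) * cnj ((z \<cdot>\<^sub>m Y) $$ (i, j)))"
        using Y_carrier by (simp add: norm2_def complex_norm_square del: of_real_power)
      then show "(adj (z \<cdot>\<^sub>m Y) * (z \<cdot>\<^sub>m Y)) $$ (j, j) = of_real (norm2 ((z \<cdot>\<^sub>m Y) *\<^sub>v unit_vec m j))"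
        unfolding index_mult_mat_sum[OF adj_carrier[OF zY] zY j j]
        using j by (simp only:, intro sum.cong refl)
          (simp only: adj_index carrier_matD[OF zY] lessThan_iff mult.commute)
    qed
    finally show ?thesis by simp
  qed
  also have "\<dots> = (\<Sum>j<m. (\<Sum>a<d. (cmod (E a (\<lambda>p. Dinv $$ (p, j))))\<^sup>2) / c)"
  proof (intro sum.cong refl)
    fix j assume "j \<in> {..<m}"
    then have j: "j < m" by simp
    have "norm2 (unit_vec m j :: complex vec) = (\<Sum>i<m. if i = j then 1 else 0)"
      unfolding norm2_def by (intro sum.cong) (auto simp: unit_vec_def)
    then have 1: "norm2 (unit_vec m j :: complex vec) = 1" using j by simp
    have "E a (\<lambda>p. (Dinv *\<^sub>v unit_vec m j) $ p) = E a (\<lambda>p. Dinv $$ (p, j))" for a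
      unfolding E_def using j Dinv(1) by (intro sum.cong refl) simp
    then show "1 - norm2 ((z \<cdot>\<^sub>m Y) *\<^sub>v unit_vec m j) = (\<Sum>a<d. (cmod (E a (\<lambda>p. Dinv $$ (p, j))))\<^sup>2) / c"
      using norm2_diff[of "unit_vec m j"] norm_zY[of "unit_vec m j"] 1 by simp
  qed
  also have "\<dots> = (\<Sum>a<d. (\<Sum>j<m. (cmod (E a (\<lambda>p. Dinv $$ (p, j))))\<^sup>2) / c)"
    unfolding sum_divide_distrib by (rule sum.swap)
  also have "\<dots> \<le> (\<Sum>a<d. 1)"
    using sum_E_Dinv_le c_pos by (intro sum_mono) simp
  finally show "Re (mtrace (1\<^sub>m m - adj (z \<cdot>\<^sub>m Y) * (z \<cdot>\<^sub>m Y))) \<le> real d" by simp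
qed

text \<open>Closedness gives \<open>|Y v| = |v|\<close> and \<open>|x|^2 = - 2 Re (A x) / c\<close>,
  while \<open>v = x + Y v\<close> gives \<open>A x / c + |v|^2\<close> for the inner product of
  \<open>v\<close> and \<open>Y v\<close>. Multiplication by \<open>Complex s c\<close> recombines
  the real and imaginary parts of \<open>A x\<close> into energy and area.\<close>

lemma area_form_eq:
  assumes v: "v \<in> carrier_vec m"
  defines "x \<equiv> (\<lambda>p. (Dinv *\<^sub>v v) $ p)"
  assumes E0: "\<And>a. a < d \<Longrightarrow> E a x = 0"
  shows "area_form m s g x = 2 * s * norm2 v - 2 * Re (Complex s c * (\<Sum>p<m. cnj (v $ p) * (Y *\<^sub>v v) $ p))"
proof -
  define y where "y = (\<lambda>p. (Y *\<^sub>v v) $ p)"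
  define w where "w = (\<Sum>p<m. (cmod (y p))\<^sup>2)"
  have vxy: "v $ p = x p + y p" if "p < m" for p
    unfolding x_def y_def by (rule Y_vec(1)[OF v that])
  have xy: "(\<Sum>p<m. cnj (x p) * y p) = A x / of_real c"
    unfolding x_def y_def by (rule sum_x_y[OF v])
  have "(\<Sum>p<m. cnj (v $ p) * y p) = (\<Sum>p<m. cnj (x p) * y p) + (\<Sum>p<m. cnj (y p) * y p)"
    unfolding sum.distrib[symmetric] by (intro sum.cong refl) (simp add: vxy algebra_simps)
  also have "(\<Sum>p<m. cnj (y p) * y p) = of_real w"
    by (simp add: w_def complex_norm_square mult.commute del: of_real_power)
  finally have vy: "(\<Sum>p<m. cnj (v $ p) * y p) = A x / of_real c + of_real w" using xy by simp
  have "norm2 v - norm2 (Y *\<^sub>v v) = 0"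
    unfolding norm2_diff[OF v] using E0 by (simp add: x_def)
  moreover have "norm2 (Y *\<^sub>v v) = w" using Y_carrier by (simp add: norm2_def w_def y_def)
  ultimately have vw: "norm2 v = w" by simp
  have "c * (\<Sum>p<m. (cmod (x p))\<^sup>2) + 2 * Re (A x) = 0"
    unfolding gram using E0 by simp
  then have xx: "(\<Sum>p<m. (cmod (x p))\<^sup>2) = - 2 * Re (A x) / c" using c_pos by (simp add: field_simps)
  show ?thesis
    unfolding y_def[symmetric] vy vw area_form_def xx A_def[symmetric]
    using c_pos by (simp add: Re_divide_of_real Im_divide_of_real field_simps)
qed

end

text \<open>The normalisation by \<open>cos \<gamma>\<close> and \<open>sin \<gamma>\<close> makes
  the scalar of the preceding identity the unit \<open>cis \<gamma>\<close>, which is absorbed into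
  \<open>Z\<close>. The form becomes that of \<open>2 cos \<gamma> - (Z + adj Z)\<close>, to which
  the eigenvalue count applies; \<open>C\<close> depends on \<open>d\<close> but not on
  \<open>m\<close> or on the vectors.\<close>

theorem area_form_index:
  fixes d :: nat
  assumes \<gamma>: "0 < \<gamma>" "\<gamma> < pi" and \<epsilon>: "\<epsilon> > 0"
  shows "\<exists>C. \<forall>m (e :: nat \<Rightarrow> nat \<Rightarrow> real). (\<forall>p<m. (\<Sum>a<d. (e p a)\<^sup>2) = sin \<gamma>) \<longrightarrow>
    index_le m (\<lambda>x. \<forall>a<d. (\<Sum>p<m. of_real (e p a) * x p) = 0) (cos \<gamma>) (\<lambda>p q. \<Sum>a<d. e p a * e q a)
      ((\<gamma> / pi + \<epsilon>) * real m + C)"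
proof -
  from near_shift_eigenvalue_count[OF \<gamma> \<epsilon>] obtain C where C: "\<forall>n d Y u l. near_shift n d Y \<longrightarrow> eigenbasis n (Y + adj Y) u l \<longrightarrow>
    real (card {k. k < n \<and> l k \<ge> 2 * cos \<gamma>}) \<le> (\<gamma> / pi + \<epsilon>) * real n + C * d"
    by (rule exE)
  have "index_le m (\<lambda>x. \<forall>a<d. (\<Sum>p<m. of_real (e p a) * x p) = 0) (cos \<gamma>) (\<lambda>p q. \<Sum>a<d. e p a * e q a)
      ((\<gamma> / pi + \<epsilon>) * real m + C * real d)"
    if norm: "\<forall>p<m. (\<Sum>a<d. (e p a)\<^sup>2) = sin \<gamma>" for m and e :: "nat \<Rightarrow> nat \<Rightarrow> real"
  proof -
    interpret vector_family m d e "sin \<gamma>"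
      using \<gamma> norm by unfold_locales (auto intro: sin_gt_zero)
    define Z where "Z = cis \<gamma> \<cdot>\<^sub>m Y"
    have ns: "near_shift m (real d) Z" unfolding Z_def by (rule near_shift_Y) simp
    interpret ns: near_shift m "real d" Z by (rule ns)
    obtain u l where eb: "eigenbasis m (Z + adj Z) u l"
      by (rule hermitian_eigenbasis[OF ns.T_carrier ns.T_hermitian, unfolded ns.T_def])
    note u = eigenbasisD[OF eb]
    define K where "K = {k. k < m \<and> l k \<ge> 2 * cos \<gamma>}"
    have K: "finite K" by (simp add: K_def)
    have card: "real (card K) \<le> (\<gamma> / pi + \<epsilon>) * real m + C * real d"
      unfolding K_def using C[rule_format, OF ns eb] .
    \<comment> \<open>\<open>f k\<close> is the coordinate of \<open>v = D x\<close> along the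
      \<open>k\<close>-th eigenvector, written as a functional of \<open>x\<close>.\<close>
    define f where "f = (\<lambda>k p. \<Sum>i<m. cnj (u i k) * D $$ (i, p))"
    have "area_form m (cos \<gamma>) (\<lambda>p q. \<Sum>a<d. e p a * e q a) x > 0"
      if x: "\<forall>a<d. (\<Sum>p<m. of_real (e p a) * x p) = 0" "\<forall>h\<in>f ` K. (\<Sum>p<m. h p * x p) = 0"
        "\<exists>p<m. x p \<noteq> 0" for x
    proof -
      define v where "v = D *\<^sub>v vec m x"
      have v: "v \<in> carrier_vec m" unfolding v_def by (meson mult_mat_vec_carrier D_carrier vec_carrier)
      have "Dinv *\<^sub>v v = vec m x"
        unfolding v_def using assoc_mult_mat_vec[OF Dinv(1) D_carrier, of "vec m x"] Dinv(3) by simp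
      then have xv: "(Dinv *\<^sub>v v) $ p = x p" if "p < m" for p using that by simp
      have afc: "area_form m s g x = area_form m s g (\<lambda>p. (Dinv *\<^sub>v v) $ p)" for s
        by (simp add: area_form_def xv)
      have "E a (\<lambda>p. (Dinv *\<^sub>v v) $ p) = 0" if "a < d" for a
        using x(1) that by (simp add: E_def xv)
      then have af: "area_form m (cos \<gamma>) g x = 2 * cos \<gamma> * norm2 v -
          2 * Re (Complex (cos \<gamma>) (sin \<gamma>) * (\<Sum>p<m. cnj (v $ p) * (Y *\<^sub>v v) $ p))"
        unfolding afc by (intro area_form_eq[OF v])
      define b where "b = (\<lambda>k. \<Sum>i<m. cnj (u i k) * v $ i)"
      have b0: "b k = 0" if "k \<in> K" for k
      proof -
        have "b k = (\<Sum>i<m. \<Sum>p<m. cnj (u i k) * (D $$ (i, p) * x p))"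
          unfolding b_def
        proof (intro sum.cong refl)
          fix i assume "i \<in> {..<m}"
          then have "v $ i = (\<Sum>p<m. D $$ (i, p) * x p)"
            unfolding v_def by (subst index_mult_mat_vec_sum[OF D_carrier vec_carrier]) auto
          then show "cnj (u i k) * v $ i = (\<Sum>p<m. cnj (u i k) * (D $$ (i, p) * x p))"
            by (simp only: sum_distrib_left)
        qed
        also have "\<dots> = (\<Sum>p<m. f k p * x p)"
          by (subst sum.swap) (simp add: f_def sum_distrib_left sum_distrib_right mult_ac)
        finally show ?thesis using x(2) that by simp
      qed
      have v_exp: "v $ i = (\<Sum>k<m. u i k * b k)" if "i < m" for i
      proof -
        have "(\<Sum>k<m. u i k * b k) = (\<Sum>j<m. (\<Sum>k<m. u i k * cnj (u j k)) * v $ j)"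
          unfolding b_def sum_distrib_left sum_distrib_right by (subst sum.swap) (simp add: mult_ac)
        also have "\<dots> = (\<Sum>j<m. if i = j then v $ j else 0)"
          using that by (intro sum.cong refl) (subst u(2), auto)
        finally show ?thesis using that by simp
      qed
      have norm_v: "norm2 v = (\<Sum>k<m. (cmod (b k))\<^sup>2)"
      proof -
        have "(\<Sum>i<m. \<Sum>j<m. cnj (v $ i) * (if i = j then 1 else 0) * v $ j) =
            of_real (\<Sum>k<m. 1 * (cmod (\<Sum>i<m. cnj (u i k) * v $ i))\<^sup>2)"
          by (rule quadratic_form_eigenbasis) (simp add: u(2))
        moreover have "(\<Sum>i<m. \<Sum>j<m. cnj (v $ i) * (if i = j then 1 else 0) * v $ j) =
            (\<Sum>i<m. \<Sum>j<m. if i = j then v $ i * cnj (v $ i) else 0)"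
          by (intro sum.cong refl) auto
        moreover have "\<dots> = of_real (norm2 v)"
          using v by (simp add: norm2_def complex_norm_square del: of_real_power)
        ultimately have "complex_of_real (norm2 v) = of_real (\<Sum>k<m. (cmod (b k))\<^sup>2)"
          by (simp only: b_def mult_1)
        then show ?thesis by (simp only: of_real_eq_iff)
      qed
      have YT: "2 * Re (cis \<gamma> * (\<Sum>p<m. cnj (v $ p) * (Y *\<^sub>v v) $ p)) = (\<Sum>k<m. l k * (cmod (b k))\<^sup>2)"
      proof -
        let ?A = "\<Sum>p<m. cnj (v $ p) * (Y *\<^sub>v v) $ p" and ?B = "\<Sum>p<m. \<Sum>q<m. cnj (v $ p) * Z $$ (p, q) * v $ q"
          and ?B' = "\<Sum>p<m. \<Sum>q<m. cnj (v $ p) * adj Z $$ (p, q) * v $ q"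
        have "cis \<gamma> * ?A = ?B"
          unfolding sum_distrib_left
        proof (intro sum.cong refl)
          fix p assume p: "p \<in> {..<m}"
          then have "(Y *\<^sub>v v) $ p = (\<Sum>q<m. Y $$ (p, q) * v $ q)"
            by (intro index_mult_mat_vec_sum[OF Y_carrier v]) simp
          then show "cis \<gamma> * (cnj (v $ p) * (Y *\<^sub>v v) $ p) = (\<Sum>q<m. cnj (v $ p) * Z $$ (p, q) * v $ q)"
            unfolding Z_def using p Y_carrier by (simp add: sum_distrib_left mult_ac)
        qed
        moreover have "cnj ?B =
            ?B'"
          unfolding cnj_sum
          by (subst sum.swap, intro sum.cong refl) (use ns.Y_carrier in \<open>simp add: mult_ac\<close>)
        moreover have "?B +
            ?B' =
            (\<Sum>p<m. \<Sum>q<m. cnj (v $ p) * (Z + adj Z) $$ (p, q) * v $ q)"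
          unfolding sum.distrib[symmetric]
          by (intro sum.cong refl) (use ns.Y_carrier in \<open>simp add: algebra_simps\<close>)
        moreover have "(\<Sum>p<m. \<Sum>q<m. cnj (v $ p) * (Z + adj Z) $$ (p, q) * v $ q) =
            of_real (\<Sum>k<m. l k * (cmod (b k))\<^sup>2)"
          unfolding b_def by (rule quadratic_form_eigenbasis) (rule u(3))
        ultimately have "cis \<gamma> * ?A +
            cnj (cis \<gamma> * ?A) = of_real (\<Sum>k<m. l k * (cmod (b k))\<^sup>2)"
          by (simp only:)
        then show ?thesis unfolding complex_add_cnj by (simp only: of_real_eq_iff)
      qed
      have "area_form m (cos \<gamma>) g x = (\<Sum>k<m. (2 * cos \<gamma> - l k) * (cmod (b k))\<^sup>2)"
        unfolding af norm_v using YT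
        by (simp add: cis.code sum_distrib_left sum_subtractf left_diff_distrib)
      also have "\<dots> > 0"
      proof -
        have "\<exists>k<m. b k \<noteq> 0"
        proof (rule ccontr)
          assume "\<not> ?thesis"
          then have "v $ i = 0" if "i < m" for i using v_exp[OF that] by simp
          then have "v = 0\<^sub>v m" using v by (intro eq_vecI) auto
          then have "x p = 0" if "p < m" for p
            using xv[OF that] index_mult_mat_vec_sum[OF Dinv(1) v that] that by simp
          with x(3) show False by blast
        qed
        then obtain k where k: "k < m" "b k \<noteq> 0" by blast
        show ?thesis
        proof (rule sum_pos2[of _ k])
          show "0 < (2 * cos \<gamma> - l k) * (cmod (b k))\<^sup>2"
            using k b0[of k] by (force simp: K_def)
          show "0 \<le> (2 * cos \<gamma> - l i) * (cmod (b i))\<^sup>2" if "i \<in> {..<m}" for i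
            using b0[of i] that by (cases "i \<in> K") (auto simp: K_def)
        qed (use k in auto)
      qed
      finally show ?thesis unfolding g_def[abs_def] .
    qed
    moreover have "real (card (f ` K)) \<le> (\<gamma> / pi + \<epsilon>) * real m + C * real d"
      using card card_image_le[OF K, of f] by linarith
    ultimately show ?thesis unfolding index_le_def using K by (intro exI[of _ "f ` K"]) blast
  qed
  then show ?thesis by blast
qed

section \<open>Words with few columns\<close>

definition col_gram :: "real \<Rightarrow> nat \<Rightarrow> nat \<Rightarrow> real" where
  "col_gram c i j = (if i = j then c else if i = Suc j \<or> j = Suc i then 1 / 2 else 0)"

text \<open>The columns from 1 to \<open>k - 1\<close> are those between two dropped columns, which
  will have residue 0 modulo \<open>k\<close>. The constant \<open>C\<close> is uniform in
  \<open>m\<close> and \<open>cl\<close>, as it has to serve all groups of letters of all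
  words.\<close>

definition column_index :: "real \<Rightarrow> real \<Rightarrow> nat \<Rightarrow> real \<Rightarrow> real \<Rightarrow> bool" where
  "column_index s c k \<eta> C \<longleftrightarrow> (\<forall>m cl. (\<forall>p<m. 1 \<le> cl p \<and> cl p < k) \<longrightarrow>
    index_le m (\<lambda>x. \<forall>i. (\<Sum>p | p < m \<and> cl p = i. x p) = 0) s (\<lambda>p q. col_gram c (cl p) (cl q)) (\<eta> * real m + C))"

text \<open>Vectors that depend only on the column of a letter have vanishing weighted sum on every
  cycle, so every cycle is a closed polygon.\<close>

lemma sum_by_column:
  fixes x :: "nat \<Rightarrow> complex" and cl :: "nat \<Rightarrow> nat"
  assumes "\<And>p. p < m \<Longrightarrow> cl p < k" "\<And>i. (\<Sum>p | p < m \<and> cl p = i. x p) = 0"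
  shows "(\<Sum>p<m. h (cl p) * x p) = 0"
proof -
  have "(\<Sum>p<m. h (cl p) * x p) = (\<Sum>i<k. \<Sum>p | p \<in> {..<m} \<and> cl p = i. h (cl p) * x p)"
    by (rule sum.group[symmetric]) (use assms(1) in auto)
  also have "\<dots> = (\<Sum>i<k. h i * (\<Sum>p | p < m \<and> cl p = i. x p))"
    unfolding sum_distrib_left by (intro sum.cong) auto
  finally show ?thesis using assms(2) by simp
qed

text \<open>For \<open>k \<theta> < 1\<close> the column Gram matrix comes from actual vectors
  \<open>v i\<close>, one per column, of squared length \<open>cos t = sin \<gamma>\<close>. The
  complementary angle \<gamma> also turns the energy coefficient \<open>sin t\<close> into
  \<open>cos \<gamma>\<close>, and \<open>\<gamma> / pi = 1/2 - \<theta>\<close> is the proportion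
  obtained.\<close>

lemma column_index_definite:
  assumes k: "k \<ge> 2" and \<theta>: "0 < \<theta>" "real k * \<theta> < 1" and \<epsilon>: "\<epsilon> > 0"
  shows "\<exists>C. column_index (sin (pi * \<theta>)) (cos (pi * \<theta>)) k (1 / 2 - \<theta> + \<epsilon>) C"
proof -
  define t where "t = pi * \<theta>"
  define \<gamma> where "\<gamma> = pi / 2 - t"
  have "\<theta> < 1 / 2" using mult_right_mono[of 2 "real k" \<theta>] k \<theta> by linarith
  then have "pi * \<theta> < pi * (1 / 2)" "pi * \<theta> > 0" using \<theta> by (simp_all only: mult_less_cancel_left_pos pi_gt_zero mult_pos_pos)
  then have \<gamma>: "0 < \<gamma>" "\<gamma> < pi" unfolding \<gamma>_def t_def using pi_gt_zero by linarith+
  have \<gamma>': "\<gamma> / pi = 1 / 2 - \<theta>" by (simp add: \<gamma>_def t_def field_simps)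
  have cs: "cos \<gamma> = sin t" "sin \<gamma> = cos t"
    by (simp_all add: \<gamma>_def cos_diff sin_diff)
  \<comment> \<open>The Cholesky factor of the tridiagonal column Gram matrix, whose \<open>i\<close>-th leading minor is
    \<open>sin ((i + 1) t) / (2\<^sup>i sin t)\<close>.\<close>
  define l where "l = (\<lambda>i. sqrt (sin (real (Suc i) * t) / (2 * sin (real i * t))))"
  have sin_pos: "sin (real i * t) > 0" if "1 \<le> i" "i \<le> k" for i
  proof (rule sin_gt_zero)
    show "real i * t > 0" using that \<theta> by (simp add: t_def)
    have "real i * \<theta> \<le> real k * \<theta>" using that \<theta> by (intro mult_right_mono) auto
    then have "real i * \<theta> < 1" using \<theta>(2) by (rule le_less_trans)
    then have "pi * (real i * \<theta>) < pi * 1" by (intro mult_strict_left_mono) auto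
    then show "real i * t < pi" by (simp add: t_def mult_ac)
  qed
  have l_pos: "l i > 0" if "1 \<le> i" "i < k" for i
    using sin_pos[of i] sin_pos[of "Suc i"] that by (simp add: l_def del: of_nat_Suc)
  have l2: "(l i)\<^sup>2 = sin (real (Suc i) * t) / (2 * sin (real i * t))" if "1 \<le> i" "i < k" for i
    using sin_pos[of i] sin_pos[of "Suc i"] that by (simp add: l_def del: of_nat_Suc)
  define v where "v = (\<lambda>i a. if a = i then l i else if 1 \<le> a \<and> Suc a = i then 1 / (2 * l a) else 0)"
  have norm_v: "(\<Sum>a<k. (v i a)\<^sup>2) = cos t" if i: "1 \<le> i" "i < k" for i
  proof -
    \<comment> \<open>Divided by \<open>2 sin (i t)\<close> this is the Cholesky recursion
      \<open>(l i)^2 + 1 / (4 (l (i - 1))^2) = cos t\<close>.\<close>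
    have add: "sin (real (Suc i) * t) + sin (real (i - 1) * t) = 2 * sin (real i * t) * cos t"
    proof -
      have "real (Suc i) * t = real i * t + t" "real (i - 1) * t = real i * t - t"
        using i by (simp_all add: of_nat_diff algebra_simps)
      then show ?thesis by (simp only: sin_add sin_diff)
    qed
    have "(\<Sum>a<k. (v i a)\<^sup>2) = (\<Sum>a\<in>{i - 1, i}. (v i a)\<^sup>2)"
      using i by (intro sum.mono_neutral_right) (auto simp: v_def)
    also have "\<dots> = (v i (i - 1))\<^sup>2 + (v i i)\<^sup>2" using i by (subst sum.insert) auto
    also have "(v i (i - 1))\<^sup>2 = sin (real (i - 1) * t) / (2 * sin (real i * t))"
    proof (cases "i = 1")
      case True
      then show ?thesis by (simp add: v_def)
    next
      case False
      then have i1: "1 \<le> i - 1" "i - 1 < k" "Suc (i - 1) = i" "i - 1 \<noteq> i" using i by auto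
      have "(v i (i - 1))\<^sup>2 = 1 / (4 * (l (i - 1))\<^sup>2)"
        using i i1 False by (simp add: v_def power_divide power_mult_distrib)
      then show ?thesis
        unfolding l2[OF i1(1,2)] i1(3) using sin_pos[of i] sin_pos[of "i - 1"] i i1 by (simp add: field_simps)
    qed
    also have "(v i i)\<^sup>2 = sin (real (Suc i) * t) / (2 * sin (real i * t))"
      using l2[OF i] by (simp add: v_def)
    also have "sin (real (i - 1) * t) / (2 * sin (real i * t)) + sin (real (Suc i) * t) / (2 * sin (real i * t)) =
        (sin (real (Suc i) * t) + sin (real (i - 1) * t)) / (2 * sin (real i * t))"
      by (simp add: add_divide_distrib)
    also have "\<dots> = cos t" unfolding add using sin_pos[of i] i by simp
    finally show ?thesis .
  qed
  have v_step: "(\<Sum>a<k. v i a * v (Suc i) a) = 1 / 2" if i: "1 \<le> i" "Suc i < k" for i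
  proof -
    have "(\<Sum>a<k. v i a * v (Suc i) a) = (\<Sum>a\<in>{i}. v i a * v (Suc i) a)"
      using i by (intro sum.mono_neutral_right) (auto simp: v_def)
    then show ?thesis using l_pos[of i] i by (simp add: v_def)
  qed
  have v_far: "(\<Sum>a<k. v i a * v j a) = 0" if "i + 2 \<le> j" for i j
    using that by (intro sum.neutral) (auto simp: v_def)
  have v_gram: "(\<Sum>a<k. v i a * v j a) = col_gram (cos t) i j"
    if "1 \<le> i" "i < k" "1 \<le> j" "j < k" for i j
  proof -
    consider "i = j" | "j = Suc i" | "i = Suc j" | "i + 2 \<le> j" | "j + 2 \<le> i" by linarith
    then show ?thesis
    proof cases
      case 1
      then show ?thesis using norm_v[of i] that by (simp add: col_gram_def power2_eq_square)
    next
      case 2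
      then show ?thesis using v_step[of i] that by (simp add: col_gram_def)
    next
      case 3
      then show ?thesis using v_step[of j] that by (simp add: col_gram_def mult.commute)
    next
      case 4
      then show ?thesis using v_far[of i j] by (simp add: col_gram_def)
    next
      case 5
      then show ?thesis using v_far[of j i] by (simp add: col_gram_def mult.commute)
    qed
  qed
  obtain C where C: "\<forall>m (e :: nat \<Rightarrow> nat \<Rightarrow> real). (\<forall>p<m. (\<Sum>a<k. (e p a)\<^sup>2) = sin \<gamma>) \<longrightarrow>
    index_le m (\<lambda>x. \<forall>a<k. (\<Sum>p<m. of_real (e p a) * x p) = 0) (cos \<gamma>) (\<lambda>p q. \<Sum>a<k. e p a * e q a)
      ((\<gamma> / pi + \<epsilon>) * real m + C)"
    using area_form_index[OF \<gamma> \<epsilon>, of k] by (rule exE)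
  have "column_index (sin t) (cos t) k (\<gamma> / pi + \<epsilon>) C"
    unfolding column_index_def
  proof (intro allI impI)
    fix m and cl :: "nat \<Rightarrow> nat"
    assume cl: "\<forall>p<m. 1 \<le> cl p \<and> cl p < k"
    then have "\<forall>p<m. (\<Sum>a<k. (v (cl p) a)\<^sup>2) = sin \<gamma>" using norm_v cs by simp
    from C[rule_format, OF this[rule_format]]
    show "index_le m (\<lambda>x. \<forall>i. (\<Sum>p | p < m \<and> cl p = i. x p) = 0) (sin t) (\<lambda>p q. col_gram (cos t) (cl p) (cl q))
        ((\<gamma> / pi + \<epsilon>) * real m + C)"
      unfolding cs(1)
    proof (rule index_le_mono)
      fix x :: "nat \<Rightarrow> complex" assume "\<forall>i. (\<Sum>p | p < m \<and> cl p = i. x p) = 0"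
      then show "\<forall>a<k. (\<Sum>p<m. of_real (v (cl p) a) * x p) = 0"
        using sum_by_column[of m cl k x "\<lambda>i. of_real (v i _)"] cl by auto
    qed (use cl v_gram in auto)
  qed
  then show ?thesis unfolding \<gamma>' t_def by blast
qed

lemma area_form_scale: "area_form m (k * s) (\<lambda>p q. k * g p q) x = k * area_form m s g x"
proof -
  have "(\<Sum>p<m. \<Sum>q<p. of_real (k * g p q) * (cnj (x p) * x q)) =
      of_real k * (\<Sum>p<m. \<Sum>q<p. of_real (g p q) * (cnj (x p) * x q))"
    by (simp add: sum_distrib_left mult_ac)
  then show ?thesis unfolding area_form_def
    by (simp only:) (simp add: distrib_left del: Im_sum)
qed

text \<open>The case of equal vectors in dimension one. Dividing by the positive number
  \<open>a R\<close> brings the coefficients to \<open>cos \<gamma>\<close> and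
  \<open>sin \<gamma>\<close> with \<open>tan \<gamma> = b / a\<close> and does not change the
  index.\<close>

lemma scalar_area_index:
  assumes "a > 0" "b > 0" "\<epsilon> > 0"
  shows "\<exists>C. \<forall>m. index_le m (\<lambda>z. (\<Sum>p<m. z p) = 0) a (\<lambda>_ _. b) ((arctan (b / a) / pi + \<epsilon>) * real m + C)"
proof -
  define \<gamma> where "\<gamma> = arctan (b / a)"
  have \<gamma>: "0 < \<gamma>" "\<gamma> < pi"
    using assms arctan_ubound[of "b / a"] pi_gt_zero by (simp_all add: \<gamma>_def del: pi_gt_zero)
  define R where "R = sqrt (1 + (b / a)\<^sup>2)"
  have R: "R > 0" unfolding R_def by (simp add: add_pos_nonneg)
  have cs: "a = a * R * cos \<gamma>" "b = a * R * sin \<gamma>"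
    using assms R by (simp_all add: \<gamma>_def cos_arctan sin_arctan R_def)
  have s0: "sin \<gamma> > 0" using \<gamma> by (simp add: sin_gt_zero)
  obtain C where C: "\<forall>m (e :: nat \<Rightarrow> nat \<Rightarrow> real). (\<forall>p<m. (\<Sum>a<1. (e p a)\<^sup>2) = sin \<gamma>) \<longrightarrow>
    index_le m (\<lambda>x. \<forall>a<1. (\<Sum>p<m. of_real (e p a) * x p) = 0) (cos \<gamma>) (\<lambda>p q. \<Sum>a<1. e p a * e q a)
      ((\<gamma> / pi + \<epsilon>) * real m + C)"
    using area_form_index[OF \<gamma> assms(3), of 1] by (rule exE)
  have "index_le m (\<lambda>z. (\<Sum>p<m. z p) = 0) a (\<lambda>_ _. b) ((\<gamma> / pi + \<epsilon>) * real m + C)" for m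
  proof -
    have "index_le m (\<lambda>x. \<forall>a<1::nat. (\<Sum>p<m. of_real (sqrt (sin \<gamma>)) * x p) = 0) (cos \<gamma>)
        (\<lambda>p q. \<Sum>a<1::nat. sqrt (sin \<gamma>) * sqrt (sin \<gamma>)) ((\<gamma> / pi + \<epsilon>) * real m + C)"
      using C[rule_format, of m "\<lambda>_ _. sqrt (sin \<gamma>)"] s0 by simp
    then have "index_le m (\<lambda>z. (\<Sum>p<m. z p) = 0) (cos \<gamma>) (\<lambda>_ _. sin \<gamma>) ((\<gamma> / pi + \<epsilon>) * real m + C)"
      by (rule index_le_mono) (use s0 in \<open>auto simp flip: sum_distrib_left\<close>)
    moreover have "area_form m a (\<lambda>_ _. b) z = a * R * area_form m (cos \<gamma>) (\<lambda>_ _. sin \<gamma>) z" for z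
      unfolding area_form_scale[symmetric] cs[symmetric] ..
    then have "area_form m a (\<lambda>_ _. b) z > 0 \<longleftrightarrow> area_form m (cos \<gamma>) (\<lambda>_ _. sin \<gamma>) z > 0" for z
      using mult_pos_pos[OF assms(1) R] by (simp only: zero_less_mult_iff[of "a * R"]) auto
    ultimately show ?thesis unfolding index_le_def by (simp only:)
  qed
  then show ?thesis unfolding \<gamma>_def by blast
qed

section \<open>Two columns with an indefinite Gram matrix\<close>

lemma sum_lessThan_double:
  fixes f :: "nat \<Rightarrow> 'a::comm_monoid_add"
  shows "(\<Sum>p<2 * B. f p) = (\<Sum>b<B. f (2 * b) + f (2 * b + 1))"
  by (induction B) (simp_all add: add_ac)

lemma sum_triangle_double:
  fixes h :: "nat \<Rightarrow> nat \<Rightarrow> 'a::comm_monoid_add"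
  shows "(\<Sum>p<2 * B. \<Sum>q<p. h p q) = (\<Sum>b<B. h (2 * b + 1) (2 * b)) +
    (\<Sum>b<B. \<Sum>b'<b. (h (2 * b) (2 * b') + h (2 * b) (2 * b' + 1)) + (h (2 * b + 1) (2 * b') + h (2 * b + 1) (2 * b' + 1)))"
proof (induction B)
  case (Suc B)
  have 1: "(\<Sum>p<2 * Suc B. \<Sum>q<p. h p q) =
      (\<Sum>p<2 * B. \<Sum>q<p. h p q) + (\<Sum>q<2 * B. h (2 * B) q) + ((\<Sum>q<2 * B. h (2 * B + 1) q) + h (2 * B + 1) (2 * B))"
    by simp
  have 2: "(\<Sum>q<2 * B. h j q) = (\<Sum>b<B. h j (2 * b) + h j (2 * b + 1))" for j
    by (rule sum_lessThan_double)
  show ?case unfolding 1 2 Suc by (simp add: sum.distrib add_ac)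
qed simp

text \<open>Completing the square in \<open>a - b\<close> with \<open>a + b\<close> fixed; the
  constant is the exact minimum and becomes \<open>e\<close> below.\<close>

lemma block_energy_same:
  fixes a b :: complex
  assumes "s > 0" "s\<^sup>2 + c\<^sup>2 = 1"
  shows "s * ((cmod a)\<^sup>2 + (cmod b)\<^sup>2) + 2 * Im (of_real c * (cnj b * a)) \<ge> (2 * s\<^sup>2 - 1) / (2 * s) * (cmod (a + b))\<^sup>2"
proof -
  have e: "(2 * s\<^sup>2 - 1) / (2 * s) = s / 2 - c\<^sup>2 / (2 * s)"
    using assms by (simp add: field_simps power2_eq_square)
  define \<kappa> where "\<kappa> = c / s"
  have k: "c = \<kappa> * s" using assms by (simp add: \<kappa>_def)
  have "s * ((cmod a)\<^sup>2 + (cmod b)\<^sup>2) + 2 * Im (of_real c * (cnj b * a)) - (s / 2 - c\<^sup>2 / (2 * s)) * (cmod (a + b))\<^sup>2 =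
      s / 2 * (cmod ((a - b) + \<i> * of_real \<kappa> * (a + b)))\<^sup>2"
    unfolding k cmod_power2 using assms(1) by (simp add: power2_eq_square field_simps)
  also have "\<dots> \<ge> 0" using assms by simp
  finally show ?thesis unfolding e by simp
qed

text \<open>Bounding the area term by \<open>N / 2\<close> gives the constant
  \<open>s - 1 / 2\<close>, which is at least \<open>s - 1 / (2 s)\<close> because
  \<open>s \<le> 1\<close>.\<close>

lemma block_energy_different:
  fixes a b :: complex
  assumes "s > 0" "s \<le> 1"
  shows "s * ((cmod a)\<^sup>2 + (cmod b)\<^sup>2) + 2 * Im (of_real (1 / 2) * (cnj b * a)) \<ge>
    (2 * s\<^sup>2 - 1) / (2 * s) * ((cmod a)\<^sup>2 + (cmod b)\<^sup>2)"
proof -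
  define N where "N = (cmod a)\<^sup>2 + (cmod b)\<^sup>2"
  define W where "W = Im (cnj b * a)"
  define e where "e = (2 * s\<^sup>2 - 1) / (2 * s)"
  have "e \<le> s - 1 / 2"
    using assms by (simp add: e_def field_simps power2_eq_square)
  then have "e * N \<le> (s - 1 / 2) * N"
    by (intro mult_right_mono) (auto simp: N_def)
  moreover have "(s - 1 / 2) * N = s * N - N / 2"
    by (simp add: left_diff_distrib)
  moreover have "2 * \<bar>W\<bar> \<le> N"
  proof -
    have "\<bar>W\<bar> \<le> cmod (cnj b * a)" unfolding W_def by (rule abs_Im_le_cmod)
    then show ?thesis
      using sum_squares_bound[of "cmod a" "cmod b"] by (simp add: N_def norm_mult mult_ac)
  qed
  ultimately have "e * N \<le> s * N + W" by linarith
  moreover have "2 * Im (of_real (1 / 2) * (cnj b * a)) = W" by (simp add: W_def)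
  ultimately show ?thesis unfolding N_def[symmetric] e_def[symmetric] by (simp only:)
qed

text \<open>On two columns the Gram matrix has the eigenvalues \<open>c + 1/2 > 0\<close> and
  \<open>c - 1/2 < 0\<close>, so it admits no realisation by vectors. Instead, the form is bounded
  below by two scalar area forms, the second one conjugated. Pairing letters halves their length and
  lowers the energy coefficient from \<open>s\<close> to \<open>e\<close>; the total proportion is
  \<open>(\<gamma>1 + \<gamma>2) / (2 pi)\<close> up to \<epsilon>.\<close>

lemma column_index_indefinite:
  assumes \<theta>: "1 / 3 < \<theta>" "\<theta> < 1 / 2"
  shows "\<exists>\<eta> C. 0 \<le> \<eta> \<and> \<eta> < 1 / 4 \<and> column_index (sin (pi * \<theta>)) (cos (pi * \<theta>)) 3 \<eta> C"
proof -
  define s where "s = sin (pi * \<theta>)"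
  define c where "c = cos (pi * \<theta>)"
  have t: "pi / 3 < pi * \<theta>" "pi * \<theta> < pi / 2"
    using \<theta> mult_strict_left_mono[of "1 / 3" \<theta> pi] mult_strict_left_mono[of \<theta> "1 / 2" pi] by auto
  have c: "0 < c" "c < 1 / 2"
  proof -
    have "- (pi / 2) < pi * \<theta>" "pi * \<theta> \<le> pi" "0 \<le> pi / 3" using t pi_gt_zero by linarith+
    then show "0 < c" "c < 1 / 2"
      using cos_gt_zero_pi[OF _ t(2)] cos_monotone_0_pi[OF _ t(1)] by (simp_all add: c_def cos_60)
  qed
  have s: "0 < s" "s \<le> 1" using t by (auto simp: s_def intro!: sin_gt_zero)
  have sc: "s\<^sup>2 + c\<^sup>2 = 1" by (simp add: s_def c_def)
  define e where "e = (2 * s\<^sup>2 - 1) / (2 * s)"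
  have c2: "c\<^sup>2 < 1 / 4" using c power_strict_mono[of c "1 / 2" 2] by (simp add: power2_eq_square)
  have e: "e > 0" using s sc c2 by (simp add: e_def)
  \<comment> \<open>This is \<open>tan \<gamma>1 * tan \<gamma>2 < 1\<close>, the condition for
    \<open>\<gamma>1 + \<gamma>2 < pi / 2\<close>. After clearing denominators the two sides differ
    by \<open>c^2\<close>, so \<open>\<theta> < 1/2\<close> is what makes it strict.\<close>
  have e2: "(1 / 2 - c) * (c + 1 / 2) < e\<^sup>2"
  proof -
    have s2: "s\<^sup>2 = 1 - c\<^sup>2" using sc by simp
    have "e\<^sup>2 = (1 - 2 * c\<^sup>2)\<^sup>2 / (4 * (1 - c\<^sup>2))"
      unfolding e_def power_divide power_mult_distrib s2 by simp
    moreover have "(1 / 4 - c\<^sup>2) * (4 * (1 - c\<^sup>2)) < (1 - 2 * c\<^sup>2)\<^sup>2"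
      using c by (simp add: power2_eq_square algebra_simps)
    ultimately have "1 / 4 - c\<^sup>2 < e\<^sup>2" using c2 by (simp add: pos_less_divide_eq)
    then show ?thesis by (simp add: power2_eq_square algebra_simps)
  qed
  define \<gamma>1 where "\<gamma>1 = arctan ((c + 1 / 2) / e)"
  define \<gamma>2 where "\<gamma>2 = arctan ((1 / 2 - c) / e)"
  have g: "\<gamma>1 + \<gamma>2 < pi / 2" "\<gamma>1 \<ge> 0" "\<gamma>2 \<ge> 0"
  proof -
    have "(1 / 2 - c) / e < 1 / ((c + 1 / 2) / e)"
      using e e2 c by (simp add: field_simps power2_eq_square)
    then have "\<gamma>2 < arctan (1 / ((c + 1 / 2) / e))" unfolding \<gamma>2_def by (rule arctan_monotone)
    also have "\<dots> = pi / 2 - \<gamma>1"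
    proof -
      have "(c + 1 / 2) / e > 0" using e c by simp
      then show ?thesis
        unfolding \<gamma>1_def using arctan_inverse[of "(c + 1 / 2) / e"] by (simp only: sgn_pos)
    qed
    finally show "\<gamma>1 + \<gamma>2 < pi / 2" by simp
  qed (use c e in \<open>auto simp: \<gamma>1_def \<gamma>2_def\<close>)
  \<comment> \<open>The tolerances use up half of the gap to the bound 1/4.\<close>
  define \<epsilon> where "\<epsilon> = (pi / 2 - (\<gamma>1 + \<gamma>2)) / (4 * pi)"
  have \<epsilon>: "\<epsilon> > 0" using g by (simp add: \<epsilon>_def)
  define \<eta> where "\<eta> = ((\<gamma>1 / pi + \<epsilon>) + (\<gamma>2 / pi + \<epsilon>)) / 2"
  have \<eta>: "0 \<le> \<eta>" "\<eta> < 1 / 4"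
  proof -
    show "0 \<le> \<eta>" using g \<epsilon> by (simp add: \<eta>_def)
    have "\<eta> = (\<gamma>1 + \<gamma>2) / (4 * pi) + 1 / 8" by (simp add: \<eta>_def \<epsilon>_def field_simps)
    moreover have "(\<gamma>1 + \<gamma>2) / (4 * pi) < 1 / 8" using g(1) by (simp add: field_simps)
    ultimately show "\<eta> < 1 / 4" by linarith
  qed
  obtain C1 where C1: "\<forall>m. index_le m (\<lambda>z. (\<Sum>p<m. z p) = 0) e (\<lambda>_ _. c + 1 / 2) ((\<gamma>1 / pi + \<epsilon>) * real m + C1)"
    using scalar_area_index[of e "c + 1 / 2" \<epsilon>] e c \<epsilon> unfolding \<gamma>1_def by auto
  obtain C2 where C2: "\<forall>m. index_le m (\<lambda>z. (\<Sum>p<m. z p) = 0) e (\<lambda>_ _. 1 / 2 - c) ((\<gamma>2 / pi + \<epsilon>) * real m + C2)"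
    using scalar_area_index[of e "1 / 2 - c" \<epsilon>] e c \<epsilon> unfolding \<gamma>2_def by auto
  have "column_index s c 3 \<eta> (C1 + C2 + 1)"
    unfolding column_index_def
  proof (intro allI impI)
    fix m :: nat and cl :: "nat \<Rightarrow> nat"
    assume cl: "\<forall>p<m. 1 \<le> cl p \<and> cl p < 3"
    let ?G = "\<lambda>p q. col_gram c (cl p) (cl q)"
    have cl12: "cl p = 1 \<or> cl p = 2" if "p < m" for p using cl that by force
    define B where "B = m div 2"
    have B: "2 * B \<le> m" "m \<le> 2 * B + 1" by (auto simp: B_def)
    obtain F1 where F1: "finite F1" "real (card F1) \<le> (\<gamma>1 / pi + \<epsilon>) * real B + C1"
      "\<And>z. (\<Sum>p<B. z p) = 0 \<Longrightarrow> (\<forall>f\<in>F1. (\<Sum>p<B. f p * z p) = 0) \<Longrightarrow> (\<exists>p<B. z p \<noteq> 0) \<Longrightarrow>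
        area_form B e (\<lambda>_ _. c + 1 / 2) z > 0"
      using C1[rule_format, of B] unfolding index_le_def by blast
    obtain F2 where F2: "finite F2" "real (card F2) \<le> (\<gamma>2 / pi + \<epsilon>) * real B + C2"
      "\<And>z. (\<Sum>p<B. z p) = 0 \<Longrightarrow> (\<forall>f\<in>F2. (\<Sum>p<B. f p * z p) = 0) \<Longrightarrow> (\<exists>p<B. z p \<noteq> 0) \<Longrightarrow>
        area_form B e (\<lambda>_ _. 1 / 2 - c) z > 0"
      using C2[rule_format, of B] unfolding index_le_def by blast
    define \<sigma> where "\<sigma> = (\<lambda>p. if cl p = 1 then 1 else - 1 :: complex)"
    define G1 where "G1 = (\<lambda>f p. if p < 2 * B then f (p div 2) else 0 :: complex)"
    define G2 where "G2 = (\<lambda>f p. if p < 2 * B then cnj (f (p div 2)) * \<sigma> p else 0 :: complex)"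
    \<comment> \<open>This functional removes the unpaired last letter when \<open>m\<close> is
      odd.\<close>
    define G3 where "G3 = (\<lambda>p. if p = 2 * B then 1 else 0 :: complex)"
    define F where "F = G1 ` F1 \<union> G2 ` F2 \<union> {G3}"
    have "card F \<le> card F1 + card F2 + 1"
    proof -
      have "card F \<le> card (G1 ` F1) + card (G2 ` F2) + card {G3}"
        unfolding F_def by (meson card_Un_le add_mono order_trans order_refl)
      then show ?thesis using card_image_le[OF F1(1), of G1] card_image_le[OF F2(1), of G2] by simp
    qed
    then have "real (card F) \<le> real (card F1 + card F2 + 1)" by (simp only: of_nat_le_iff)
    also have "\<dots> \<le> ((\<gamma>1 / pi + \<epsilon>) * real B + C1) + ((\<gamma>2 / pi + \<epsilon>) * real B + C2) + 1"
      using F1(2) F2(2) by simp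
    also have "\<dots> = \<eta> * real (2 * B) + (C1 + C2 + 1)"
      unfolding \<eta>_def by (simp add: algebra_simps)
    also have "\<dots> \<le> \<eta> * real m + (C1 + C2 + 1)"
      using \<eta>(1) B(1) by (intro add_right_mono mult_left_mono) auto
    finally have cardF: "real (card F) \<le> \<eta> * real m + (C1 + C2 + 1)" .
    have "area_form m s ?G x > 0"
      if x0: "\<forall>i. (\<Sum>p | p < m \<and> cl p = i. x p) = 0" and xF: "\<forall>f\<in>F. (\<Sum>p<m. f p * x p) = 0"
        and xn: "\<exists>p<m. x p \<noteq> 0" for x
    proof -
      have last: "x (2 * B) = 0" if "m = 2 * B + 1"
      proof -
        have "(\<Sum>p<m. G3 p * x p) = (\<Sum>p<m. if p = 2 * B then x p else 0)"
          by (intro sum.cong) (auto simp: G3_def)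
        then show ?thesis using xF that by (simp add: F_def)
      qed
      have cut: "(\<Sum>p<m. h p * x p) = (\<Sum>p<2 * B. h p * x p)" for h
      proof (cases "m = 2 * B")
        case False
        then have "m = Suc (2 * B)" using B by simp
        then show ?thesis using last by simp
      qed simp
      \<comment> \<open>Pair consecutive letters into blocks. In the coordinates \<open>z1\<close>, \<open>z2\<close>, which diagonalise the column
        Gram matrix with eigenvalues \<open>c + 1/2\<close> and \<open>c - 1/2\<close>, the energy of every block is at least
        \<open>e/2 (|z1|\<^sup>2 + |z2|\<^sup>2)\<close>, so the form dominates the sum of two scalar area forms.\<close>
      define z1 where "z1 = (\<lambda>b. x (2 * b) + x (2 * b + 1))"
      define z2 where "z2 = (\<lambda>b. \<sigma> (2 * b) * x (2 * b) + \<sigma> (2 * b + 1) * x (2 * b + 1))"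
      have even_odd: "(2 * b) div 2 = b" "(2 * b + 1) div 2 = b" for b :: nat by simp_all
      have sum1: "(\<Sum>p<m. G1 f p * x p) = (\<Sum>b<B. f b * z1 b)" for f
        unfolding cut sum_lessThan_double
        by (intro sum.cong refl) (simp add: G1_def z1_def algebra_simps)
      have sum2: "(\<Sum>p<m. G2 f p * x p) = (\<Sum>b<B. cnj (f b) * z2 b)" for f
        unfolding cut sum_lessThan_double
        by (intro sum.cong refl) (simp add: G2_def z2_def algebra_simps)
      have z1_0: "(\<Sum>b<B. z1 b) = 0" and z2_0: "(\<Sum>b<B. z2 b) = 0"
      proof -
        have "(\<Sum>p<m. 1 * x p) = 0" "(\<Sum>p<m. \<sigma> p * x p) = 0"
          using sum_by_column[of m cl 3 x "\<lambda>_. 1"] sum_by_column[of m cl 3 x "\<lambda>i. if i = 1 then 1 else - 1"] cl x0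
          by (auto simp: \<sigma>_def)
        then show "(\<Sum>b<B. z1 b) = 0" "(\<Sum>b<B. z2 b) = 0"
          unfolding cut sum_lessThan_double by (simp_all add: z1_def z2_def)
      qed
      have A1: "area_form B e (\<lambda>_ _. c + 1 / 2) z1 > 0" if "\<exists>b<B. z1 b \<noteq> 0"
      proof (rule F1(3)[OF z1_0 _ that], rule ballI)
        fix f assume "f \<in> F1"
        then have "G1 f \<in> F" by (simp add: F_def)
        with xF have "(\<Sum>p<m. G1 f p * x p) = 0" by blast
        then show "(\<Sum>b<B. f b * z1 b) = 0" unfolding sum1 .
      qed
      \<comment> \<open>Conjugation reverses the sign of the area, so the negative eigenvalue
        \<open>c - 1/2\<close> turns into the positive weight \<open>1/2 - c\<close>; the
        functionals in \<open>G2\<close> are conjugated accordingly.\<close>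
      have A2: "area_form B e (\<lambda>_ _. 1 / 2 - c) (\<lambda>b. cnj (z2 b)) > 0" if "\<exists>b<B. z2 b \<noteq> 0"
      proof (rule F2(3))
        show "(\<Sum>b<B. cnj (z2 b)) = 0" using z2_0 by (simp flip: cnj_sum)
        show "\<forall>f\<in>F2. (\<Sum>b<B. f b * cnj (z2 b)) = 0"
        proof
          fix f assume "f \<in> F2"
          then have "G2 f \<in> F" by (simp add: F_def)
          with xF have "(\<Sum>p<m. G2 f p * x p) = 0" by blast
          then have "(\<Sum>b<B. cnj (f b) * z2 b) = 0" unfolding sum2 .
          then have "cnj (\<Sum>b<B. cnj (f b) * z2 b) = 0" by (simp only: complex_cnj_zero)
          then show "(\<Sum>b<B. f b * cnj (z2 b)) = 0" by simp
        qed
      qed (use that in auto)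
      define w where "w = (\<lambda>b. s * ((cmod (x (2 * b)))\<^sup>2 + (cmod (x (2 * b + 1)))\<^sup>2) +
        2 * Im (of_real (col_gram c (cl (2 * b + 1)) (cl (2 * b))) * (cnj (x (2 * b + 1)) * x (2 * b))))"
      have w_ge: "w b \<ge> e / 2 * ((cmod (z1 b))\<^sup>2 + (cmod (z2 b))\<^sup>2)" if b: "b < B" for b
      proof (cases "cl (2 * b + 1) = cl (2 * b)")
        case True
        then have "z2 b = z1 b \<or> z2 b = - z1 b"
          by (simp add: z2_def z1_def \<sigma>_def)
        then have "(cmod (z2 b))\<^sup>2 = (cmod (z1 b))\<^sup>2" by auto
        then show ?thesis
          using block_energy_same[OF s(1) sc, of "x (2 * b)" "x (2 * b + 1)"] True
          by (simp add: w_def col_gram_def e_def z1_def)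
      next
        case False
        have e1: "(cmod (z1 b))\<^sup>2 + (cmod (z2 b))\<^sup>2 = 2 * ((cmod (x (2 * b)))\<^sup>2 + (cmod (x (2 * b + 1)))\<^sup>2)"
        proof -
          have "z2 b = x (2 * b) - x (2 * b + 1) \<or> z2 b = - (x (2 * b) - x (2 * b + 1))"
            using False cl12[of "2 * b"] cl12[of "2 * b + 1"] b B by (auto simp: z2_def \<sigma>_def)
          then have "(cmod (z2 b))\<^sup>2 = (cmod (x (2 * b) - x (2 * b + 1)))\<^sup>2" by (metis norm_minus_cancel)
          then show ?thesis
            unfolding z1_def cmod_power2 by (simp add: power2_eq_square algebra_simps)
        qed
        have e2: "col_gram c (cl (2 * b + 1)) (cl (2 * b)) = 1 / 2"
          using False cl12[of "2 * b"] cl12[of "2 * b + 1"] b B by (auto simp: col_gram_def)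
        have e3: "e / 2 * (2 * r) = e * r" for r by simp
        show ?thesis
          unfolding w_def e1 e2 e3 unfolding e_def by (rule block_energy_different[OF s])
      qed
      \<comment> \<open>Spectral decomposition of the two-by-two Gram matrix along (1, 1) and (1,
        -1), with \<sigma> as the sign of the column.\<close>
      have cross: "of_real (col_gram c (cl p) (cl q)) = of_real (c / 2 + 1 / 4) + of_real (c / 2 - 1 / 4) * (\<sigma> p * \<sigma> q)"
        if "p < m" "q < m" for p q
        using cl12[OF that(1)] cl12[OF that(2)] by (auto simp: col_gram_def \<sigma>_def complex_eq_iff)
      have \<sigma>c: "cnj (\<sigma> p) = \<sigma> p" for p by (simp add: \<sigma>_def)
      let ?h = "\<lambda>p q. of_real (col_gram c (cl p) (cl q)) * (cnj (x p) * x q)"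
      have four: "(?h (2 * b) (2 * b') + ?h (2 * b) (2 * b' + 1)) + (?h (2 * b + 1) (2 * b') + ?h (2 * b + 1) (2 * b' + 1)) =
          of_real (c / 2 + 1 / 4) * (cnj (z1 b) * z1 b') + of_real (c / 2 - 1 / 4) * (cnj (z2 b) * z2 b')"
        if "b < B" "b' < b" for b b'
      proof -
        have lt: "2 * b < m" "2 * b + 1 < m" "2 * b' < m" "2 * b' + 1 < m" using that B by auto
        show ?thesis
          unfolding cross[OF lt(1,3)] cross[OF lt(1,4)] cross[OF lt(2,3)] cross[OF lt(2,4)]
          by (simp add: z1_def z2_def \<sigma>c algebra_simps)
      qed
      let ?W1 = "\<Sum>b<B. \<Sum>b'<b. cnj (z1 b) * z1 b'" and ?W2 = "\<Sum>b<B. \<Sum>b'<b. cnj (z2 b) * z2 b'"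
      define S1 where "S1 = Im ?W1"
      define S2 where "S2 = Im ?W2"
      have area_eq: "area_form m s ?G x =
          (\<Sum>b<B. w b) + (c + 1 / 2) * S1 - (1 / 2 - c) * S2"
      proof -
        have "area_form m s ?G x =
            area_form (2 * B) s ?G x"
        proof (cases "m = 2 * B")
          case False
          then have m: "m = Suc (2 * B)" using B by simp
          then show ?thesis using last unfolding area_form_def m by simp
        qed simp
        also have "\<dots> = s * (\<Sum>b<B. (cmod (x (2 * b)))\<^sup>2 + (cmod (x (2 * b + 1)))\<^sup>2) +
            2 * Im ((\<Sum>b<B. ?h (2 * b + 1) (2 * b)) +
              (\<Sum>b<B. \<Sum>b'<b. of_real (c / 2 + 1 / 4) * (cnj (z1 b) * z1 b') + of_real (c / 2 - 1 / 4) * (cnj (z2 b) * z2 b')))"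
        proof -
          have "(\<Sum>b<B. \<Sum>b'<b. (?h (2 * b) (2 * b') + ?h (2 * b) (2 * b' + 1)) + (?h (2 * b + 1) (2 * b') + ?h (2 * b + 1) (2 * b' + 1))) =
              (\<Sum>b<B. \<Sum>b'<b. of_real (c / 2 + 1 / 4) * (cnj (z1 b) * z1 b') + of_real (c / 2 - 1 / 4) * (cnj (z2 b) * z2 b'))"
            by (intro sum.cong refl, rule four) (simp_all only: lessThan_iff)
          then show ?thesis
            unfolding area_form_def sum_triangle_double sum_lessThan_double by (simp only:)
        qed
        also have "(\<Sum>b<B. \<Sum>b'<b. of_real (c / 2 + 1 / 4) * (cnj (z1 b) * z1 b') + of_real (c / 2 - 1 / 4) * (cnj (z2 b) * z2 b')) =
            of_real (c / 2 + 1 / 4) * ?W1 +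
            of_real (c / 2 - 1 / 4) * ?W2"
          by (simp only: sum.distrib sum_distrib_left)
        also have "2 * Im ((\<Sum>b<B. ?h (2 * b + 1) (2 * b)) + (of_real (c / 2 + 1 / 4) * ?W1 +
            of_real (c / 2 - 1 / 4) * ?W2)) =
            (\<Sum>b<B. 2 * Im (?h (2 * b + 1) (2 * b))) + (c + 1 / 2) * S1 - (1 / 2 - c) * S2"
        proof -
          have "2 * Im (X + (of_real (c / 2 + 1 / 4) * W1 + of_real (c / 2 - 1 / 4) * W2)) =
              2 * Im X + (c + 1 / 2) * Im W1 - (1 / 2 - c) * Im W2" for X W1 W2
            by (simp add: algebra_simps)
          then show ?thesis
            unfolding S1_def S2_def sum_distrib_left[symmetric] Im_sum[of "\<lambda>b. ?h (2 * b + 1) (2 * b)", symmetric]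
            by (simp only:)
        qed
        moreover have "(\<Sum>b<B. w b) = s * (\<Sum>b<B. (cmod (x (2 * b)))\<^sup>2 + (cmod (x (2 * b + 1)))\<^sup>2) +
            (\<Sum>b<B. 2 * Im (?h (2 * b + 1) (2 * b)))"
          unfolding w_def by (subst sum.distrib) (simp only: sum_distrib_left)
        ultimately show ?thesis by linarith
      qed
      have area1: "area_form B e (\<lambda>_ _. c + 1 / 2) z1 = e * (\<Sum>b<B. (cmod (z1 b))\<^sup>2) + 2 * (c + 1 / 2) * S1"
      proof -
        have "(\<Sum>p<B. \<Sum>q<p. of_real (c + 1 / 2) * (cnj (z1 p) * z1 q)) =
            of_real (c + 1 / 2) * (\<Sum>p<B. \<Sum>q<p. cnj (z1 p) * z1 q)"
          by (simp only: sum_distrib_left)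
        moreover have "Im (of_real (c + 1 / 2) * y) = (c + 1 / 2) * Im y" for y by simp
        ultimately show ?thesis unfolding area_form_def S1_def by (simp only: mult.assoc)
      qed
      have area2: "area_form B e (\<lambda>_ _. 1 / 2 - c) (\<lambda>b. cnj (z2 b)) = e * (\<Sum>b<B. (cmod (z2 b))\<^sup>2) - 2 * (1 / 2 - c) * S2"
      proof -
        have "(\<Sum>p<B. \<Sum>q<p. of_real (1 / 2 - c) * (cnj (cnj (z2 p)) * cnj (z2 q))) =
            of_real (1 / 2 - c) * cnj (\<Sum>p<B. \<Sum>q<p. cnj (z2 p) * z2 q)"
          by (simp only: sum_distrib_left cnj_sum complex_cnj_mult)
        moreover have "Im (of_real (1 / 2 - c) * cnj y) = - ((1 / 2 - c) * Im y)" for y by simp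
        ultimately show ?thesis unfolding area_form_def S2_def by (simp only: complex_mod_cnj)
      qed
      show ?thesis
      proof (cases "\<exists>b<B. z1 b \<noteq> 0 \<or> z2 b \<noteq> 0")
        case True
        have n1: "area_form B e (\<lambda>_ _. c + 1 / 2) z1 \<ge> 0"
          using A1 by (cases "\<exists>b<B. z1 b \<noteq> 0") (auto simp: area_form_def)
        have n2: "area_form B e (\<lambda>_ _. 1 / 2 - c) (\<lambda>b. cnj (z2 b)) \<ge> 0"
          using A2 by (cases "\<exists>b<B. z2 b \<noteq> 0") (auto simp: area_form_def)
        have "0 < area_form B e (\<lambda>_ _. c + 1 / 2) z1 + area_form B e (\<lambda>_ _. 1 / 2 - c) (\<lambda>b. cnj (z2 b))"
          using True A1 A2 n1 n2 by (auto intro: add_pos_nonneg add_nonneg_pos)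
        also have "\<dots> = 2 * ((\<Sum>b<B. e / 2 * ((cmod (z1 b))\<^sup>2 + (cmod (z2 b))\<^sup>2)) + (c + 1 / 2) * S1 - (1 / 2 - c) * S2)"
          unfolding area1 area2 sum_distrib_left[symmetric] sum.distrib by (simp add: algebra_simps)
        also have "\<dots> \<le> 2 * ((\<Sum>b<B. w b) + (c + 1 / 2) * S1 - (1 / 2 - c) * S2)"
          using w_ge by (intro mult_left_mono diff_right_mono add_right_mono sum_mono) auto
        finally show ?thesis unfolding area_eq by simp
      next
        case False
        \<comment> \<open>If all block coordinates vanish, the two letters of each block are
          opposite, no area is left, and positivity comes from the energy alone.\<close>
        then have z0: "z1 b = 0" "z2 b = 0" if "b < B" for b using that by auto
        have S0: "S1 = 0" "S2 = 0" using z0 by (simp_all add: S1_def S2_def)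
        have w: "w b = s * ((cmod (x (2 * b)))\<^sup>2 + (cmod (x (2 * b + 1)))\<^sup>2)" if b: "b < B" for b
        proof -
          have "x (2 * b + 1) = - x (2 * b)" using z0(1)[OF b] by (simp add: z1_def add_eq_0_iff)
          then have "Im (of_real r * (cnj (x (2 * b + 1)) * x (2 * b))) = 0" for r by simp
          then show ?thesis by (simp only: w_def)
        qed
        obtain p where p: "p < m" "x p \<noteq> 0" using xn by blast
        have "p < 2 * B" using p B last by (cases "p = 2 * B") auto
        define b where "b = p div 2"
        have b: "b < B" using \<open>p < 2 * B\<close> by (simp add: b_def)
        have "p = 2 * b \<or> p = 2 * b + 1" by (auto simp: b_def)
        then have "x (2 * b) \<noteq> 0 \<or> x (2 * b + 1) \<noteq> 0" using p by auto
        then have "w b > 0" unfolding w[OF b] using s by (simp add: sum_power2_gt_zero_iff)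
        moreover have "w b' \<ge> 0" if "b' < B" for b' unfolding w[OF that] using s by auto
        ultimately have "(\<Sum>b<B. w b) > 0" using b by (intro sum_pos2[of _ b]) auto
        then show ?thesis unfolding area_eq S0 by simp
      qed
    qed
    moreover have "finite F" using F1(1) F2(1) by (simp add: F_def)
    ultimately show "index_le m (\<lambda>x. \<forall>i. (\<Sum>p | p < m \<and> cl p = i. x p) = 0) s ?G
        (\<eta> * real m + (C1 + C2 + 1))"
      unfolding index_le_def using cardF by blast
  qed
  then show ?thesis using \<eta> unfolding s_def c_def by blast
qed

text \<open>For \<open>\<theta> < 1/4\<close> take the largest integer \<open>k\<close> below
  \<open>1 / \<theta>\<close>, since then
  \<open>(k - 1) \<theta> \<ge> 1 - 2 \<theta> > 1/2\<close>; between 1/4 and 1/3 the value 3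
  satisfies both inequalities.\<close>

lemma column_index_exists:
  assumes \<theta>: "0 < \<theta>" "\<theta> < 1 / 2" "\<theta> \<noteq> 1 / 3" "\<theta> \<noteq> 1 / 4"
  shows "\<exists>k \<eta> C. k \<ge> 2 \<and> 0 \<le> \<eta> \<and> 1 / real k + \<eta> * (1 - 1 / real k) < 1 / 2 \<and>
    column_index (sin (pi * \<theta>)) (cos (pi * \<theta>)) k \<eta> C"
proof (cases "\<theta> < 1 / 3")
  case True
  have "\<exists>k::nat. k \<ge> 2 \<and> real k * \<theta> < 1 \<and> (real k - 1) * \<theta> > 1 / 2"
  proof (cases "\<theta> < 1 / 4")
    case True
    define k where "k = nat (\<lceil>1 / \<theta>\<rceil> - 1)"
    have "1 / \<theta> > 4" using True \<theta> by (simp add: field_simps)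
    then have k: "real k < 1 / \<theta>" "real k \<ge> 1 / \<theta> - 1" "k \<ge> 2"
      unfolding k_def by linarith+
    have "real k * \<theta> < 1" using k(1) \<theta> by (simp add: field_simps)
    moreover have "(1 / \<theta> - 2) * \<theta> \<le> (real k - 1) * \<theta>" using k(2) \<theta> by (intro mult_right_mono) auto
    then have "1 - 2 * \<theta> \<le> (real k - 1) * \<theta>" using \<theta> by (simp add: left_diff_distrib)
    then have "(real k - 1) * \<theta> > 1 / 2" using True by simp
    ultimately show ?thesis using k(3) by blast
  next
    case False
    then show ?thesis using True \<theta> by (intro exI[of _ 3]) auto
  qed
  then obtain k :: nat where k: "k \<ge> 2" "real k * \<theta> < 1" "(real k - 1) * \<theta> > 1 / 2" by blast
  define \<epsilon> where "\<epsilon> = (\<theta> - 1 / (2 * (real k - 1))) / 2"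
  have "1 / (2 * (real k - 1)) < \<theta>" using k by (simp add: field_simps)
  then have \<epsilon>: "\<epsilon> > 0" "\<theta> - \<epsilon> > 1 / (2 * (real k - 1))" by (simp_all add: \<epsilon>_def field_simps)
  have "(real k - 1) * (1 / (2 * (real k - 1))) < (real k - 1) * (\<theta> - \<epsilon>)"
    using \<epsilon>(2) k(1) by (intro mult_strict_left_mono) auto
  moreover have "(real k - 1) * (1 / (2 * (real k - 1))) = 1 / 2" using k(1) by (simp add: field_simps)
  ultimately have "(real k - 1) * (\<theta> - \<epsilon>) > 1 / 2" by linarith
  then have "1 / real k + (1 / 2 - \<theta> + \<epsilon>) * (1 - 1 / real k) < 1 / 2"
    using k(1) by (simp add: field_simps)
  moreover obtain C where "column_index (sin (pi * \<theta>)) (cos (pi * \<theta>)) k (1 / 2 - \<theta> + \<epsilon>) C"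
    using column_index_definite[OF k(1) \<theta>(1) k(2) \<epsilon>(1)] by blast
  moreover have "0 \<le> 1 / 2 - \<theta> + \<epsilon>" using \<epsilon>(1) \<theta>(2) by simp
  ultimately show ?thesis using k(1) by blast
next
  case False
  then have "1 / 3 < \<theta>" using \<theta> by simp
  from column_index_indefinite[OF this \<theta>(2)] obtain \<eta> C where
    "0 \<le> \<eta>" "\<eta> < 1 / 4" "column_index (sin (pi * \<theta>)) (cos (pi * \<theta>)) 3 \<eta> C" by blast
  then show ?thesis by (intro exI[of _ 3] exI[of _ \<eta>] exI[of _ C]) auto
qed

section \<open>The Seifert form of a positive word\<close>

lemma bricks_iff:
  "(k, l) \<in> set (bricks w) \<longleftrightarrow> k < l \<and> l < length w \<and> w ! k = w ! l \<and> (\<forall>j\<in>{k<..<l}. w ! j \<noteq> w ! k)"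
  by (auto simp: bricks_def)

lemma distinct_bricks: "distinct (bricks w)"
  by (simp add: bricks_def distinct_product)

lemma brick_unique: "(k, l) \<in> set (bricks w) \<Longrightarrow> (k, l') \<in> set (bricks w) \<Longrightarrow> l = l'"
  by (rule ccontr) (auto simp: bricks_iff dest: neq_iff[THEN iffD1])

lemma brick_exists:
  assumes "p < q" "q < length w" "w ! q = w ! p"
  shows "\<exists>l. (p, l) \<in> set (bricks w)"
proof -
  define l where "l = (LEAST l. p < l \<and> w ! l = w ! p)"
  have l: "p < l" "w ! l = w ! p" using LeastI[of "\<lambda>l. p < l \<and> w ! l = w ! p" q] assms by (auto simp: l_def)
  have "l \<le> q" unfolding l_def by (rule Least_le) (use assms in auto)
  moreover have "w ! j \<noteq> w ! p" if "p < j" "j < l" for j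
    using not_less_Least[of j "\<lambda>l. p < l \<and> w ! l = w ! p"] that by (auto simp: l_def)
  ultimately show ?thesis using l assms by (intro exI[of _ l]) (auto simp: bricks_iff)
qed

text \<open>Every position other than the last occurrence of its letter starts a brick.\<close>

lemma length_le_bricks: "length w \<le> length (bricks w) + card (set w)"
proof -
  define L where "L = {p. p < length w \<and> (\<forall>q. p < q \<longrightarrow> q < length w \<longrightarrow> w ! q \<noteq> w ! p)}"
  have "{..<length w} \<subseteq> fst ` set (bricks w) \<union> L"
  proof
    fix p assume p: "p \<in> {..<length w}"
    show "p \<in> fst ` set (bricks w) \<union> L"
    proof (cases "p \<in> L")
      case False
      then obtain q where "p < q" "q < length w" "w ! q = w ! p" using p by (auto simp: L_def)
      then obtain l where "(p, l) \<in> set (bricks w)" using brick_exists by blast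
      then show ?thesis by force
    qed simp
  qed
  then have "card {..<length w} \<le> card (fst ` set (bricks w) \<union> L)"
    by (intro card_mono) (auto simp: L_def)
  also have "\<dots> \<le> card (fst ` set (bricks w)) + card L" by (rule card_Un_le)
  also have "card (fst ` set (bricks w)) \<le> card (set (bricks w))" by (rule card_image_le) simp
  also have "card (set (bricks w)) = length (bricks w)" by (rule distinct_card[OF distinct_bricks])
  also have "card L \<le> card (set w)"
  proof (rule card_inj_on_le[of "(!) w"])
    show "inj_on ((!) w) L"
    proof (rule inj_onI)
      fix p q assume "p \<in> L" "q \<in> L" "w ! p = w ! q"
      then show "p = q" unfolding L_def by (metis (mono_tags, lifting) mem_Collect_eq linorder_neqE_nat)
    qed
  qed (auto simp: L_def)
  finally show ?thesis by simp
qed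

text \<open>
  The brick \<open>(k, l)\<close> is the chain \<open>e\<^sub>k - e\<^sub>l\<close>, and this is one bilinear extension of the Seifert form to
  all chains. Terms depending only on the columns of the two letters may be added to it, as
  cycles have vanishing column sums; \<open>letter_form_area\<close> uses this to remove the symmetric part.
\<close>

definition letter_form :: "nat list \<Rightarrow> nat \<Rightarrow> nat \<Rightarrow> int" where
  "letter_form w p q = (if q \<le> p then (if w ! q = w ! p then 1 else if Suc (w ! q) = w ! p then - 1 else 0) else 0)"

text \<open>Only the vertical edges at \<open>K\<close> and \<open>L\<close> pass over the push-off,
  and of its horizontal edges they can meet only the one at height \<open>2 i + 1\<close>: the lower
  edge if \<open>j = i\<close>, the upper one if \<open>j + 1 = i\<close>. The shift to the left
  turns \<open>2 K' - 1 < 2 K < 2 L' - 1\<close> into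
  \<open>K' \<le> K \<and> K < L'\<close>.\<close>

lemma linking_number_rectangles:
  fixes K L K' L' i j :: int
  assumes "K < L" "K' < L'"
  shows "linking_number [(2 * K, 2 * i), (2 * K, 2 * (i + 1)), (2 * L, 2 * (i + 1)), (2 * L, 2 * i)]
      (push_off [(2 * K', 2 * j), (2 * K', 2 * (j + 1)), (2 * L', 2 * (j + 1)), (2 * L', 2 * j)]) =
    (if j = i then 1 else if j + 1 = i then - 1 else 0) *
      (of_bool (K' \<le> K \<and> K < L') - of_bool (K' \<le> L \<and> L < L'))"
proof -
  have cross: "crossing_sign ((2 * X, 2 * i), (2 * X, 2 * (i + 1))) ((2 * A - 1, t), (2 * A' - 1, t)) =
      (if t = 2 * i + 1 \<and> ((A \<le> X \<and> X < A') \<or> (A' \<le> X \<and> X < A)) then - sgn (A' - A) else 0)"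
    "crossing_sign ((2 * X, 2 * (i + 1)), (2 * X, 2 * i)) ((2 * A - 1, t), (2 * A' - 1, t)) =
      (if t = 2 * i + 1 \<and> ((A \<le> X \<and> X < A') \<or> (A' \<le> X \<and> X < A)) then sgn (A' - A) else 0)"
    for X A A' t
    by (auto simp: min_def max_def sgn_if)
  have zero: "crossing_sign ((2 * X, 2 * i), (2 * X, 2 * (i + 1))) ((a, t), (a', t + 2)) = 0"
    "crossing_sign ((2 * X, 2 * (i + 1)), (2 * X, 2 * i)) ((a, t), (a', t + 2)) = 0"
    "crossing_sign ((2 * X, 2 * i), (2 * X, 2 * (i + 1))) ((a, t + 2), (a', t)) = 0"
    "crossing_sign ((2 * X, 2 * (i + 1)), (2 * X, 2 * i)) ((a, t + 2), (a', t)) = 0" for X a t a'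
    by auto
  have zero': "crossing_sign ((2 * K, z), (2 * L, z')) f = 0" "crossing_sign ((2 * L, z), (2 * K, z')) f = 0" for z z' f
    using assms by (cases f; cases "fst f"; cases "snd f"; simp)+
  have eq: "2 * (j + 1) + 1 = 2 * i + 1 \<longleftrightarrow> j + 1 = i" "2 * j + 1 = 2 * i + 1 \<longleftrightarrow> j = i" "2 * (j + 1) + 1 = (2 * j + 1) + 2"
    by auto
  show ?thesis
    using assms
    by (simp add: linking_number_def segments_def push_off_def cross zero zero' eq del: crossing_sign.simps)
       (auto simp: sgn_if)
qed

lemma seifert_matrix_index:
  assumes a: "a < length (bricks w)" and b: "b < length (bricks w)"
    and kl: "bricks w ! a = (k, l)" "bricks w ! b = (k', l')"
  shows "seifert_matrix w $$ (a, b) =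
    letter_form w k k' - letter_form w k l' - letter_form w l k' + letter_form w l l'"
proof -
  have "(k, l) \<in> set (bricks w)" "(k', l') \<in> set (bricks w)" using nth_mem[OF a] nth_mem[OF b] kl by auto
  then have kl': "k < l" "w ! l = w ! k" "k' < l'" "w ! l' = w ! k'" by (auto simp: bricks_iff)
  have "seifert_matrix w $$ (a, b) = linking_number (brick_loop w (k, l)) (push_off (brick_loop w (k', l')))"
    using a b kl by (simp add: seifert_matrix_def)
  also have "\<dots> = (if int (w ! k') = int (w ! k) then 1 else if int (w ! k') + 1 = int (w ! k) then - 1 else 0) *
      (of_bool (int k' \<le> int k \<and> int k < int l') - of_bool (int k' \<le> int l \<and> int l < int l'))"
    unfolding brick_loop_def Let_def prod.case
    by (rule linking_number_rectangles) (use kl' in auto)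
  also have "\<dots> = letter_form w k k' - letter_form w k l' - letter_form w l k' + letter_form w l l'"
    using kl' by (auto simp: letter_form_def)
  finally show ?thesis .
qed

section \<open>Passage from brick coordinates to chains of letters\<close>

definition brick_chain :: "nat list \<Rightarrow> (nat \<Rightarrow> complex) \<Rightarrow> nat \<Rightarrow> complex" where
  "brick_chain w v p = (\<Sum>a<length (bricks w).
     v a * (of_bool (fst (bricks w ! a) = p) - of_bool (snd (bricks w ! a) = p)))"

lemma brick_chain_column_sum: "(\<Sum>p | p < length w \<and> w ! p = i. brick_chain w v p) = 0"
proof -
  have "(\<Sum>p | p < length w \<and> w ! p = i. of_bool (fst (bricks w ! a) = p) - of_bool (snd (bricks w ! a) = p)) = (0 :: complex)"
    if "a < length (bricks w)" for a
  proof -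
    obtain k l where kl: "bricks w ! a = (k, l)" by (cases "bricks w ! a") auto
    then have "(k, l) \<in> set (bricks w)" using nth_mem[OF that] by simp
    then have kl': "k < length w" "l < length w" "w ! l = w ! k" by (auto simp: bricks_iff)
    have delta: "(\<Sum>p | p < length w \<and> w ! p = i. of_bool (r = p)) = (of_bool (w ! r = i) :: complex)" if "r < length w" for r
    proof -
      have "(\<Sum>p | p < length w \<and> w ! p = i. of_bool (r = p)) = (\<Sum>p | p < length w \<and> w ! p = i. if p = r then 1 else (0 :: complex))"
        by (intro sum.cong) auto
      then show ?thesis using that by simp
    qed
    show ?thesis unfolding kl fst_conv snd_conv sum_subtractf delta[OF kl'(1)] delta[OF kl'(2)] kl'(3) by simp
  qed
  then show ?thesis
    unfolding brick_chain_def by (subst sum.swap) (simp add: sum_distrib_left[symmetric])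
qed

text \<open>Among the bricks with nonzero coefficient take the one that starts first. No other of
  them starts at that letter and none ends there, so its coefficient survives in the chain.\<close>

lemma brick_chain_nonzero:
  assumes "\<exists>a<length (bricks w). v a \<noteq> 0"
  shows "\<exists>p<length w. brick_chain w v p \<noteq> 0"
proof -
  define K where "K = (\<lambda>a. fst (bricks w ! a))"
  define S where "S = {a. a < length (bricks w) \<and> v a \<noteq> 0}"
  have "finite S" "S \<noteq> {}" using assms by (auto simp: S_def)
  then obtain a where a: "a \<in> S" "\<And>b. b \<in> S \<Longrightarrow> K a \<le> K b"
    using ex_min_if_finite[of "K ` S"] by (metis finite_imageI image_eqI image_iff image_is_empty linorder_not_le)
  have brick: "(K b, snd (bricks w ! b)) \<in> set (bricks w)" if "b < length (bricks w)" for b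
    using nth_mem[OF that] by (simp add: K_def)
  have al: "a < length (bricks w)" "v a \<noteq> 0" using a(1) by (auto simp: S_def)
  have "brick_chain w v (K a) = (\<Sum>b<length (bricks w). if b = a then v a else 0)"
    unfolding brick_chain_def
  proof (intro sum.cong refl)
    fix b assume "b \<in> {..<length (bricks w)}"
    then have b: "b < length (bricks w)" by simp
    show "v b * (of_bool (fst (bricks w ! b) = K a) - of_bool (snd (bricks w ! b) = K a)) = (if b = a then v a else 0)"
    proof (cases "v b = 0")
      case True
      then show ?thesis using al by auto
    next
      case False
      then have "K a \<le> K b" using a(2) b by (simp add: S_def)
      then have s: "snd (bricks w ! b) \<noteq> K a" using brick[OF b] by (auto simp: bricks_iff)
      have "fst (bricks w ! b) = K a \<longleftrightarrow> b = a"
      proof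
        assume e: "fst (bricks w ! b) = K a"
        then have "snd (bricks w ! b) = snd (bricks w ! a)"
          using brick_unique[of "K a" _ w] brick[OF b] brick[OF al(1)] by (simp add: K_def)
        then have "bricks w ! b = bricks w ! a" using e by (simp add: K_def prod_eq_iff)
        then show "b = a" using distinct_bricks b al(1) by (simp add: nth_eq_iff_index_eq)
      qed (simp add: K_def)
      then show ?thesis using s by simp
    qed
  qed
  then have "brick_chain w v (K a) \<noteq> 0" using al by simp
  moreover have "K a < length w" using brick[OF al(1)] by (auto simp: bricks_iff)
  ultimately show ?thesis by blast
qed

lemma seifert_form_eq:
  fixes a a' :: complex
  shows "(\<Sum>i<length (bricks w). \<Sum>j<length (bricks w).
      cnj (v i) * (a * of_int (seifert_matrix w $$ (i, j)) + a' * of_int (seifert_matrix w $$ (j, i))) * v j) =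
    (\<Sum>p<length w. \<Sum>q<length w. cnj (brick_chain w v p) *
      (a * of_int (letter_form w p q) + a' * of_int (letter_form w q p)) * brick_chain w v q)"
proof -
  let ?V = "\<lambda>i j. a * of_int (seifert_matrix w $$ (i, j)) + a' * of_int (seifert_matrix w $$ (j, i))"
  let ?N = "length (bricks w)" and ?m = "length w"
  define \<beta> where "\<beta> = (\<lambda>i p. of_bool (fst (bricks w ! i) = p) - of_bool (snd (bricks w ! i) = p) :: complex)"
  define h where "h = (\<lambda>p q. a * of_int (letter_form w p q) + a' * of_int (letter_form w q p))"
  have \<beta>_sum: "(\<Sum>p<?m. \<beta> i p * f p) = f (fst (bricks w ! i)) - f (snd (bricks w ! i))" if "i < ?N" for i f
  proof -
    obtain k l where kl: "bricks w ! i = (k, l)" by (cases "bricks w ! i") auto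
    then have "(k, l) \<in> set (bricks w)" using nth_mem[OF that] by simp
    then have kl': "k < ?m" "l < ?m" by (auto simp: bricks_iff)
    have "(\<Sum>p<?m. \<beta> i p * f p) = (\<Sum>p<?m. if p = k then f p else 0) - (\<Sum>p<?m. if p = l then f p else 0)"
      unfolding sum_subtractf[symmetric] by (intro sum.cong) (auto simp: \<beta>_def kl)
    then show ?thesis using kl' kl by simp
  qed
  have entry: "?V i j =
      (\<Sum>p<?m. \<Sum>q<?m. \<beta> i p * (\<beta> j q * h p q))" if ij: "i < ?N" "j < ?N" for i j
  proof -
    obtain k l k' l' where kl: "bricks w ! i = (k, l)" "bricks w ! j = (k', l')"
      by (cases "bricks w ! i"; cases "bricks w ! j") auto
    have "(\<Sum>p<?m. \<Sum>q<?m. \<beta> i p * (\<beta> j q * h p q)) = (h k k' - h k l') - (h l k' - h l l')"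
      by (simp add: sum_distrib_left[symmetric] \<beta>_sum ij kl)
    also have "\<dots> = ?V i j"
      unfolding seifert_matrix_index[OF ij kl] seifert_matrix_index[OF ij(2,1) kl(2,1)]
      by (simp add: h_def algebra_simps)
    finally show ?thesis ..
  qed
  have "(\<Sum>i<?N. \<Sum>j<?N. cnj (v i) * ?V i j * v j) =
      (\<Sum>i<?N. \<Sum>j<?N. \<Sum>p<?m. \<Sum>q<?m. (cnj (v i) * \<beta> i p) * h p q * (v j * \<beta> j q))"
    by (intro sum.cong refl) (simp add: entry sum_distrib_left sum_distrib_right mult_ac)
  also have "\<dots> = (\<Sum>p<?m. \<Sum>q<?m. \<Sum>i<?N. \<Sum>j<?N. (cnj (v i) * \<beta> i p) * h p q * (v j * \<beta> j q))"
    by (rule trans[OF sum_rotate3 sum.cong[OF refl sum_rotate3]])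
  also have "\<dots> = (\<Sum>p<?m. \<Sum>q<?m. (\<Sum>i<?N. cnj (v i) * \<beta> i p) * h p q * (\<Sum>j<?N. v j * \<beta> j q))"
    by (simp add: sum_distrib_left[symmetric] sum_distrib_right[symmetric])
  also have "\<dots> = (\<Sum>p<?m. \<Sum>q<?m. cnj (brick_chain w v p) * h p q * brick_chain w v q)"
  proof -
    have "cnj (\<beta> i p) = \<beta> i p" for i p by (simp add: \<beta>_def of_bool_def)
    moreover have chain: "brick_chain w v p = (\<Sum>i<?N. v i * \<beta> i p)" for p
      by (simp add: brick_chain_def \<beta>_def)
    ultimately show ?thesis by (simp only: chain cnj_sum complex_cnj_mult)
  qed
  finally show ?thesis unfolding h_def .
qed

text \<open>As \<open>a = 2 \<i> s u\<close>, the half-angle phase \<open>u\<close> accounts for the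
  step between neighbouring columns. The average \<open>C\<close> of the two triangles depends only
  on the columns and vanishes on cycles. What remains is \<open>2 s^2\<close> on the diagonal and
  \<open>J\<close> or its conjugate elsewhere, and the powers of \<open>u\<close> turn
  \<open>J\<close> into \<open>- 2 \<i> s\<close> times the real column Gram matrix.\<close>

lemma letter_form_area:
  fixes x :: "nat \<Rightarrow> complex" and \<theta> :: real
  defines "s \<equiv> sin (pi * \<theta>)" and "c \<equiv> cos (pi * \<theta>)" and "a \<equiv> 1 - cis (2 * pi * \<theta>)" and "u \<equiv> - cis (pi * \<theta>)"
  assumes x: "\<And>i. (\<Sum>p | p < length w \<and> w ! p = i. x p) = 0"
  shows "(\<Sum>p<length w. \<Sum>q<length w. cnj (x p) *
      (a * of_int (letter_form w p q) + cnj a * of_int (letter_form w q p)) * x q) =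
    of_real (2 * s * area_form (length w) s (\<lambda>p q. col_gram c (w ! p) (w ! q)) (\<lambda>p. cnj u ^ (w ! p) * x p))"
proof -
  let ?m = "length w" and ?G = "\<lambda>p q. col_gram c (w ! p) (w ! q)"
  have a: "a = Complex (2 * s\<^sup>2) (- 2 * s * c)"
  proof -
    have "2 * pi * \<theta> = pi * \<theta> + pi * \<theta>" by simp
    then show ?thesis
      unfolding a_def s_def c_def
      by (simp only: complex_eq_iff cis.sel minus_complex.sel one_complex.sel complex.sel cos_add sin_add)
         (simp add: cos_squared_eq power2_eq_square[symmetric] algebra_simps)
  qed
  have sc: "s * s + c * c = 1" by (simp add: s_def c_def power2_eq_square[symmetric])
  define nn where "nn = (\<lambda>i j :: nat. (if j = i then 1 else if Suc j = i then - 1 else 0) :: complex)"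
  define C where "C = (\<lambda>i j. (a * nn i j + cnj a * nn j i) / 2)"
  define J where "J = (\<lambda>i j. (a * nn i j - cnj a * nn j i) / 2)"
  define h where "h = (\<lambda>p q. a * of_int (letter_form w p q) + cnj a * of_int (letter_form w q p))"
  define k where "k = Suc (Max (set w))"
  have k: "w ! p < k" if "p < ?m" for p
    using that by (simp add: k_def less_Suc_eq_le)
  have zero: "(\<Sum>p<?m. \<Sum>q<?m. cnj (x p) * (C (w ! p) (w ! q) * x q)) = 0"
  proof (rule sum.neutral, rule ballI)
    fix p
    have "(\<Sum>q<?m. C (w ! p) (w ! q) * x q) = 0"
      by (rule sum_by_column[of ?m "\<lambda>q. w ! q" k x "C (w ! p)"]) (use k x in auto)
    then show "(\<Sum>q<?m. cnj (x p) * (C (w ! p) (w ! q) * x q)) = 0"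
      by (simp add: sum_distrib_left[symmetric])
  qed
  have u: "cnj u * u = 1" by (simp add: u_def cis_mult cis_cnj)
  have J_eq: "J i j = - (2 * \<i> * of_real s) * (of_real (col_gram c i j) * (u ^ i * cnj u ^ j))" for i j
  proof -
    consider "i = j" | "i = Suc j" | "j = Suc i" | "i \<noteq> j" "i \<noteq> Suc j" "j \<noteq> Suc i" by blast
    then show ?thesis
    proof cases
      case 1
      then have e: "u ^ i * cnj u ^ j = 1" using u by (simp add: power_mult_distrib[symmetric] mult.commute)
      show ?thesis unfolding e using 1 by (simp add: J_def nn_def col_gram_def a complex_eq_iff)
    next
      case 2
      then have "u ^ i * cnj u ^ j = u * (cnj u * u) ^ j" by (simp add: power_mult_distrib)
      then have e: "u ^ i * cnj u ^ j = u" by (simp add: u)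
      show ?thesis unfolding e using 2
        by (simp add: J_def nn_def col_gram_def a u_def complex_eq_iff power2_eq_square s_def c_def)
    next
      case 3
      then have "u ^ i * cnj u ^ j = cnj u * (cnj u * u) ^ i" by (simp add: power_mult_distrib)
      then have e: "u ^ i * cnj u ^ j = cnj u" by (simp add: u)
      show ?thesis unfolding e using 3
        by (simp add: J_def nn_def col_gram_def a u_def complex_eq_iff power2_eq_square s_def c_def)
    next
      case 4
      then show ?thesis by (simp add: J_def nn_def col_gram_def)
    qed
  qed
  define y where "y = (\<lambda>p. cnj u ^ (w ! p) * x p)"
  let ?K = "\<lambda>p q. of_real (col_gram c (w ! p) (w ! q)) * (cnj (y p) * y q)"
  have y_norm: "cmod (y p) = cmod (x p)" for p by (simp add: y_def norm_mult norm_power u_def)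
  define H where "H = (\<lambda>p q. cnj (x p) * (h p q - C (w ! p) (w ! q)) * x q)"
  have H_diag: "H p p = of_real (2 * s\<^sup>2 * (cmod (x p))\<^sup>2)" for p
  proof -
    have "h p p - C (w ! p) (w ! p) = of_real (2 * s\<^sup>2)"
      by (simp add: h_def C_def nn_def letter_form_def a complex_eq_iff)
    then show ?thesis
      by (simp add: H_def complex_norm_square mult_ac del: of_real_power)
  qed
  have H_off: "H p q + H q p = of_real (4 * s * Im (?K p q))" if "q < p" for p q
  proof -
    have hp: "h p q - C (w ! p) (w ! q) = J (w ! p) (w ! q)"
      using that by (auto simp: h_def C_def J_def nn_def letter_form_def field_simps)
    have hq: "h q p - C (w ! q) (w ! p) = cnj (J (w ! p) (w ! q))"
      using that by (auto simp: h_def C_def J_def nn_def letter_form_def field_simps)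
    have "H p q = - (2 * \<i> * of_real s) * ?K p q"
      unfolding H_def hp J_eq y_def by (simp add: mult_ac)
    moreover have "H q p = cnj (H p q)"
      unfolding H_def hp hq by simp
    ultimately have "H p q + H q p = of_real (2 * Re (- (2 * \<i> * of_real s) * ?K p q))"
      by (simp only: complex_add_cnj)
    also have "Re (- (2 * \<i> * of_real s) * z) = 2 * s * Im z" for z by simp
    finally show ?thesis by (simp only: mult.assoc[symmetric]) simp
  qed
  have "(\<Sum>p<?m. \<Sum>q<?m. cnj (x p) * h p q * x q) =
      (\<Sum>p<?m. \<Sum>q<?m. H p q) + (\<Sum>p<?m. \<Sum>q<?m. cnj (x p) * (C (w ! p) (w ! q) * x q))"
    unfolding sum.distrib[symmetric] by (intro sum.cong refl) (simp add: H_def algebra_simps)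
  also have "\<dots> = (\<Sum>p<?m. H p p) + (\<Sum>p<?m. \<Sum>q<p. H p q + H q p)"
    unfolding zero sum_square_split[of H] by simp
  also have "(\<Sum>p<?m. \<Sum>q<p. H p q + H q p) =
      (\<Sum>p<?m. \<Sum>q<p. of_real (4 * s * Im (?K p q)))"
    by (intro sum.cong refl H_off) simp
  also have "(\<Sum>p<?m. H p p) + \<dots> = of_real (2 * s * area_form ?m s ?G y)"
  proof -
    define X where "X = (\<Sum>p<?m. (cmod (x p))\<^sup>2)"
    define S where "S = (\<Sum>p<?m. \<Sum>q<p. Im (?K p q))"
    have "area_form ?m s ?G y = s * X + 2 * S"
      unfolding area_form_def y_norm Im_sum X_def S_def ..
    moreover have "(\<Sum>p<?m. H p p) = of_real (2 * s\<^sup>2 * X)"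
      unfolding H_diag X_def by (simp only: of_real_sum sum_distrib_left)
    moreover have "(\<Sum>p<?m. \<Sum>q<p. of_real (4 * s * Im (?K p q))) =
        complex_of_real (4 * s * S)"
      by (simp only: S_def of_real_sum sum_distrib_left)
    ultimately show ?thesis by (simp add: power2_eq_square algebra_simps)
  qed
  finally show ?thesis unfolding h_def y_def .
qed

section \<open>The linear lower bound\<close>

lemma sorted_list_of_set_bij:
  fixes P :: "nat set"
  assumes "finite P" and M: "M \<le> card P"
  shows "bij_betw ((!) (sorted_list_of_set P)) {..<M} {q \<in> P. M < card P \<longrightarrow> q < sorted_list_of_set P ! M}"
proof -
  let ?e = "(!) (sorted_list_of_set P)"
  have len: "length (sorted_list_of_set P) = card P" by simp
  have mono: "?e i < ?e j" if "i < j" "j < card P" for i j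
    using sorted_wrt_nth_less[OF strict_sorted_list_of_set, of i j P] that len by simp
  have mem: "?e i \<in> P" if "i < card P" for i
    using nth_mem[of i "sorted_list_of_set P"] that assms(1) len by simp
  have surj: "\<exists>i<card P. ?e i = q" if "q \<in> P" for q
    using that assms(1) in_set_conv_nth[of q "sorted_list_of_set P"] len by auto
  show ?thesis
  proof (rule bij_betw_imageI)
    show "inj_on ?e {..<M}"
      using M by (intro inj_onI) (auto simp: nth_eq_iff_index_eq)
    show "?e ` {..<M} = {q \<in> P. M < card P \<longrightarrow> q < ?e M}"
    proof (intro equalityI subsetI)
      fix q assume "q \<in> ?e ` {..<M}"
      then show "q \<in> {q \<in> P. M < card P \<longrightarrow> q < ?e M}" using M mem mono by auto
    next
      fix q assume q: "q \<in> {q \<in> P. M < card P \<longrightarrow> q < ?e M}"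
      then obtain i where i: "i < card P" "?e i = q" using surj by auto
      have "i < M"
      proof (rule ccontr)
        assume "\<not> i < M"
        then show False using q i mono[of M i] by (cases "i = M") auto
      qed
      then show "q \<in> ?e ` {..<M}" using i by auto
    qed
  qed
qed

lemma sum_sorted_list_of_set:
  fixes P :: "nat set"
  assumes "finite P"
  shows "(\<Sum>i<card P. f (sorted_list_of_set P ! i)) = (\<Sum>p\<in>P. f p)"
  using sum.reindex_bij_betw[OF sorted_list_of_set_bij[OF assms order_refl], of f] by simp

text \<open>The enumeration is increasing, so the condition \<open>q < p\<close> on letters is
  preserved; the area depends on this order.\<close>

lemma sum_triangle_sorted_list_of_set:
  fixes P :: "nat set"
  assumes "finite P"
  shows "(\<Sum>i<card P. \<Sum>j<i. f (sorted_list_of_set P ! i) (sorted_list_of_set P ! j)) =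
    (\<Sum>p\<in>P. \<Sum>q | q \<in> P \<and> q < p. f p q)"
proof -
  have "(\<Sum>i<card P. \<Sum>j<i. f (sorted_list_of_set P ! i) (sorted_list_of_set P ! j)) =
      (\<Sum>i<card P. \<Sum>q | q \<in> P \<and> q < sorted_list_of_set P ! i. f (sorted_list_of_set P ! i) q)"
  proof (rule sum.cong[OF refl])
    fix i assume "i \<in> {..<card P}"
    then show "(\<Sum>j<i. f (sorted_list_of_set P ! i) (sorted_list_of_set P ! j)) =
        (\<Sum>q | q \<in> P \<and> q < sorted_list_of_set P ! i. f (sorted_list_of_set P ! i) q)"
      using sum.reindex_bij_betw[OF sorted_list_of_set_bij[OF assms, of i], of "f (sorted_list_of_set P ! i)"] by simp
  qed
  also have "\<dots> = (\<Sum>p\<in>P. \<Sum>q | q \<in> P \<and> q < p. f p q)"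
    by (rule sum_sorted_list_of_set[OF assms])
  finally show ?thesis .
qed

definition restrict_index :: "nat set \<Rightarrow> (nat \<Rightarrow> 'a) \<Rightarrow> nat \<Rightarrow> 'a" where
  "restrict_index P f i = f (sorted_list_of_set P ! i)"

lemma area_form_split:
  fixes grp :: "nat \<Rightarrow> nat" and T :: nat
  assumes dead: "\<And>p. p < m \<Longrightarrow> \<not> alive p \<Longrightarrow> x p = 0"
    and group: "\<And>p. p < m \<Longrightarrow> alive p \<Longrightarrow> grp p < T"
    and indep: "\<And>p q. p < m \<Longrightarrow> q < m \<Longrightarrow> alive p \<Longrightarrow> alive q \<Longrightarrow> grp p \<noteq> grp q \<Longrightarrow> g p q = 0"
  defines "P \<equiv> \<lambda>t. {p. p < m \<and> alive p \<and> grp p = t}"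
  shows "area_form m s g x =
    (\<Sum>t<T. area_form (card (P t)) s (\<lambda>i j. g (sorted_list_of_set (P t) ! i) (sorted_list_of_set (P t) ! j))
      (restrict_index (P t) x))"
proof -
  have fin: "finite (P t)" for t by (simp add: P_def)
  let ?A = "{p \<in> {..<m}. alive p}"
  have by_group: "(\<Sum>p<m. f p) = (\<Sum>t<T. \<Sum>p\<in>P t. f p)" if "\<And>p. p < m \<Longrightarrow> \<not> alive p \<Longrightarrow> f p = (0 :: 'b :: comm_monoid_add)" for f
  proof -
    have "(\<Sum>p<m. f p) = (\<Sum>p\<in>?A. f p)"
      using that by (intro sum.mono_neutral_right) auto
    also have "\<dots> = (\<Sum>t<T. \<Sum>p | p \<in> ?A \<and> grp p = t. f p)"
      by (rule sum.group[symmetric]) (use group in auto)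
    also have "\<dots> = (\<Sum>t<T. \<Sum>p\<in>P t. f p)"
      by (intro sum.cong) (auto simp: P_def)
    finally show ?thesis .
  qed
  let ?h = "\<lambda>p q. of_real (g p q) * (cnj (x p) * x q)"
  have 1: "(\<Sum>p<m. (cmod (x p))\<^sup>2) = (\<Sum>t<T. \<Sum>p\<in>P t. (cmod (x p))\<^sup>2)"
    by (rule by_group) (simp add: dead)
  have inner: "(\<Sum>q<p. ?h p q) = (\<Sum>q | q \<in> P t \<and> q < p. ?h p q)" if p: "p \<in> P t" for t p
  proof (intro sum.mono_neutral_right ballI)
    fix q assume q: "q \<in> {..<p} - {q \<in> P t. q < p}"
    then have q': "q < m" "\<not> alive q \<or> grp q \<noteq> grp p" using p by (auto simp: P_def)
    show "?h p q = 0"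
    proof (cases "alive q")
      case True
      then have "g p q = 0" using p q' by (intro indep) (auto simp: P_def)
      then show ?thesis by simp
    next
      case False
      then show ?thesis using dead q' by simp
    qed
  qed auto
  have "(\<Sum>p<m. \<Sum>q<p. ?h p q) = (\<Sum>t<T. \<Sum>p\<in>P t. \<Sum>q<p. ?h p q)"
    by (rule by_group) (simp add: dead)
  also have "\<dots> = (\<Sum>t<T. \<Sum>p\<in>P t. \<Sum>q | q \<in> P t \<and> q < p. ?h p q)"
    by (intro sum.cong refl inner)
  finally have 2: "(\<Sum>p<m. \<Sum>q<p. ?h p q) = (\<Sum>t<T. \<Sum>p\<in>P t. \<Sum>q | q \<in> P t \<and> q < p. ?h p q)" .
  show ?thesis
    unfolding area_form_def 1 2 restrict_index_def
      sum_sorted_list_of_set[OF fin, of "\<lambda>p. (cmod (x p))\<^sup>2"] sum_triangle_sorted_list_of_set[OF fin, of ?h]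
    by (simp only: sum.distrib sum_distrib_left Im_sum)
qed

lemma matrix_signature_ge_set:
  assumes A: "A \<in> carrier_mat n n" "adj A = A" and F: "finite F"
    and pos: "\<And>v :: nat \<Rightarrow> complex. \<exists>i<n. v i \<noteq> 0 \<Longrightarrow> \<forall>f\<in>F. (\<Sum>i<n. f i * v i) = 0 \<Longrightarrow>
      Re (\<Sum>i<n. \<Sum>j<n. cnj (v i) * A $$ (i, j) * v j) > 0"
  shows "matrix_signature A \<ge> int n - 2 * int (card F)"
proof -
  obtain e where "bij_betw e {0..<card F} F" using ex_bij_betw_nat_finite[OF F] by blast
  then have e: "F = e ` {..<card F}" by (simp add: bij_betw_def atLeast0LessThan)
  show ?thesis
  proof (rule matrix_signature_ge[OF A, of _ e])
    fix v :: "nat \<Rightarrow> complex"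
    assume "\<exists>i<n. v i \<noteq> 0" and v: "\<forall>j<card F. (\<Sum>i<n. e j i * v i) = 0"
    moreover have "\<forall>f\<in>F. (\<Sum>i<n. f i * v i) = 0" using v by (subst e) auto
    ultimately show "Re (\<Sum>i<n. \<Sum>j<n. cnj (v i) * A $$ (i, j) * v j) > 0" by (intro pos)
  qed
qed

text \<open>The conditions imposed on \<open>v\<close> are the vanishing at dead letters and those
  supplied by \<open>column_index\<close> for each group, pulled back to brick coordinates. They
  number at most \<open>|Dead| + \<eta> (m - |Dead|)\<close> plus the constants of
  \<open>n + k\<close> groups.\<close>

lemma levine_tristram_signature_ge:
  fixes \<theta> :: real
  assumes \<theta>: "0 < \<theta>" "\<theta> < 1 / 2" and k: "k \<ge> 2" and \<eta>: "0 \<le> \<eta>" "\<eta> \<le> 1"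
    and ci: "column_index (sin (pi * \<theta>)) (cos (pi * \<theta>)) k \<eta> C"
    and w: "w \<in> positive_words n"
  shows "\<exists>r. real r \<le> (1 / real k + \<eta> * (1 - 1 / real k)) * real (length w) + real (n + k) * max C 0 \<and>
    matrix_signature (levine_tristram_matrix (cis (2 * pi * \<theta>)) (seifert_matrix w)) \<ge>
      int (length (bricks w)) - 2 * int r"
proof -
  let ?m = "length w" and ?N = "length (bricks w)"
  define s where "s = sin (pi * \<theta>)"
  define c where "c = cos (pi * \<theta>)"
  define u where "u = - cis (pi * \<theta>)"
  have "pi * \<theta> < pi * 1" using \<theta> by (intro mult_strict_left_mono) auto
  then have s: "s > 0" unfolding s_def using \<theta> by (intro sin_gt_zero) auto
  \<comment> \<open>Exactly one of the \<open>k\<close> shifts puts a given column at residue 0, so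
    the numbers of dead letters over all shifts add up to the length, and some shift has at most the
    average.\<close>
  have "\<exists>d<k. real (card {p. p < ?m \<and> (w ! p + d) mod k = 0}) \<le> real ?m / real k"
  proof -
    have "(\<Sum>d<k. card {p. p < ?m \<and> (w ! p + d) mod k = 0}) = (\<Sum>d<k. \<Sum>p<?m. of_bool ((w ! p + d) mod k = 0))"
      by (intro sum.cong refl) (simp add: Int_def)
    also have "\<dots> = (\<Sum>p<?m. \<Sum>d<k. of_bool ((w ! p + d) mod k = 0))" by (rule sum.swap)
    also have "\<dots> = (\<Sum>p<?m. 1)"
    proof (intro sum.cong refl)
      fix p
      define d0 where "d0 = (k - w ! p mod k) mod k"
      have "(w ! p + d) mod k = 0 \<longleftrightarrow> d = d0" if "d < k" for d
      proof -
        define r where "r = w ! p mod k"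
        have r: "r < k" using k by (simp add: r_def)
        have "(w ! p + d) mod k = (r + d) mod k" by (simp add: r_def mod_add_left_eq)
        also have "\<dots> = (if r + d < k then r + d else r + d - k)"
          using r that by (auto simp: le_mod_geq)
        finally have "(w ! p + d) mod k = (if r + d < k then r + d else r + d - k)" .
        moreover have "d0 = (if r = 0 then 0 else k - r)" using r by (auto simp: d0_def r_def[symmetric])
        ultimately show ?thesis using r that by (simp split: if_splits) linarith
      qed
      then have "(\<Sum>d<k. of_bool ((w ! p + d) mod k = 0)) = (\<Sum>d<k. if d = d0 then 1 else (0 :: nat))"
        by (intro sum.cong) auto
      then show "(\<Sum>d<k. of_bool ((w ! p + d) mod k = 0)) = (1 :: nat)" using k by (simp add: d0_def)
    qed
    finally have tot: "(\<Sum>d<k. card {p. p < ?m \<and> (w ! p + d) mod k = 0}) = ?m" by simp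
    show ?thesis
    proof (rule ccontr)
      assume "\<not> ?thesis"
      then have "real ?m / real k < real (card {p. p < ?m \<and> (w ! p + d) mod k = 0})" if "d < k" for d
        using that by (simp add: not_le)
      then have "(\<Sum>d<k. real ?m / real k) < (\<Sum>d<k. real (card {p. p < ?m \<and> (w ! p + d) mod k = 0}))"
        using k by (intro sum_strict_mono) (auto simp: lessThan_empty_iff)
      then show False using tot k by (simp flip: of_nat_sum)
    qed
  qed
  then obtain d where d: "d < k" and dead_le: "real (card {p. p < ?m \<and> (w ! p + d) mod k = 0}) \<le> real ?m / real k"
    by blast
  define alive where "alive = (\<lambda>p. (w ! p + d) mod k \<noteq> 0)"
  define grp where "grp = (\<lambda>p. (w ! p + d) div k)"
  define cl where "cl = (\<lambda>p. (w ! p + d) mod k)"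
  define T where "T = n + k"
  define P where "P = (\<lambda>t. {p. p < ?m \<and> alive p \<and> grp p = t})"
  define Dead where "Dead = {p. p < ?m \<and> \<not> alive p}"
  have fin: "finite (P t)" "finite Dead" for t by (simp_all add: P_def Dead_def)
  have grp_less: "grp p < T" if "p < ?m" for p
  proof -
    have "w ! p < n" using w nth_mem[OF that] by (auto simp: positive_words_def)
    then show ?thesis unfolding grp_def T_def using d by (intro le_less_trans[OF div_le_dividend]) simp
  qed
  have same_group: "col_gram c (w ! p) (w ! q) = col_gram c (cl p) (cl q)" if "grp p = grp q" for p q
  proof -
    have split: "w ! p + d = k * grp p + cl p" for p by (simp add: grp_def cl_def)
    have "w ! p + d = k * grp p + cl p" "w ! q + d = k * grp p + cl q"
      using split[of p] split[of q] by (simp_all only: that)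
    then have "w ! p = w ! q \<longleftrightarrow> cl p = cl q" "w ! p = Suc (w ! q) \<longleftrightarrow> cl p = Suc (cl q)"
      "w ! q = Suc (w ! p) \<longleftrightarrow> cl q = Suc (cl p)" by linarith+
    then show ?thesis by (simp add: col_gram_def)
  qed
  \<comment> \<open>Passing from one column to the next changes the group only if the upper column
    has residue 0, that is, if it is dead.\<close>
  have adjacent: "grp p = grp q" if "w ! p = Suc (w ! q)" "alive p" for p q
  proof -
    have "w ! p + d = Suc (w ! q + d)" using that by simp
    then show ?thesis
      using that(2) unfolding grp_def alive_def by (simp add: div_Suc)
  qed
  have indep: "col_gram c (w ! p) (w ! q) = 0" if "alive p" "alive q" "grp p \<noteq> grp q" for p q
    using adjacent[of p q] adjacent[of q p] that by (auto simp: col_gram_def grp_def)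
  define e where "e = (\<lambda>t i. sorted_list_of_set (P t) ! i)"
  have e_mem: "e t i \<in> P t" if "i < card (P t)" for t i
    using nth_mem[of i "sorted_list_of_set (P t)"] that fin by (simp add: e_def)
  let ?Gt = "\<lambda>t p q. col_gram c (cl (e t p)) (cl (e t q))"
  have "\<forall>t. index_le (card (P t)) (\<lambda>x. \<forall>i. (\<Sum>p | p < card (P t) \<and> cl (e t p) = i. x p) = 0) s
      (?Gt t) (\<eta> * real (card (P t)) + C)"
    by (rule allI, rule ci[folded s_def c_def, unfolded column_index_def, rule_format])
       (use e_mem k in \<open>auto simp: cl_def P_def alive_def Suc_le_eq\<close>)
  then obtain F where F_all: "\<forall>t. finite (F t) \<and> real (card (F t)) \<le> \<eta> * real (card (P t)) + C \<and>
      (\<forall>x :: nat \<Rightarrow> complex. (\<forall>i. (\<Sum>p | p < card (P t) \<and> cl (e t p) = i. x p) = 0) \<longrightarrow> (\<forall>f\<in>F t. (\<Sum>p<card (P t). f p * x p) = 0) \<longrightarrow>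
        (\<exists>p<card (P t). x p \<noteq> 0) \<longrightarrow> area_form (card (P t)) s (?Gt t) x > 0)"
    unfolding index_le_def choice_iff by (rule exE)
  have F: "finite (F t)" "real (card (F t)) \<le> \<eta> * real (card (P t)) + C"
    "\<And>x :: nat \<Rightarrow> complex. \<forall>i. (\<Sum>p | p < card (P t) \<and> cl (e t p) = i. x p) = 0 \<Longrightarrow> \<forall>f\<in>F t. (\<Sum>p<card (P t). f p * x p) = 0 \<Longrightarrow>
      \<exists>p<card (P t). x p \<noteq> 0 \<Longrightarrow> area_form (card (P t)) s (?Gt t) x > 0" for t
    using F_all[rule_format, of t] by blast+
  \<comment> \<open>\<open>L \<phi>\<close> is the functional \<phi> on phase-shifted chains,
    expressed in brick coordinates.\<close>
  define L where "L = (\<lambda>(\<phi> :: nat \<Rightarrow> complex) a. \<Sum>p<?m. \<phi> p * (cnj u ^ (w ! p) *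
    (of_bool (fst (bricks w ! a) = p) - of_bool (snd (bricks w ! a) = p))))"
  define y where "y = (\<lambda>v p. cnj u ^ (w ! p) * brick_chain w v p)"
  have L: "(\<Sum>a<?N. L \<phi> a * v a) = (\<Sum>p<?m. \<phi> p * y v p)" for \<phi> v
    unfolding L_def y_def brick_chain_def sum_distrib_left sum_distrib_right
    by (subst sum.swap) (simp add: mult_ac)
  define ext where "ext = (\<lambda>t f p. \<Sum>i<card (P t). f i * of_bool (e t i = p) :: complex)"
  have ext: "(\<Sum>p<?m. ext t f p * z p) = (\<Sum>i<card (P t). f i * z (e t i))" for t f z
  proof -
    have "(\<Sum>p<?m. ext t f p * z p) = (\<Sum>i<card (P t). \<Sum>p<?m. f i * of_bool (e t i = p) * z p)"
      unfolding ext_def sum_distrib_right by (rule sum.swap)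
    also have "\<dots> = (\<Sum>i<card (P t). f i * z (e t i))"
    proof (intro sum.cong refl)
      fix i assume "i \<in> {..<card (P t)}"
      then have "e t i < ?m" using e_mem[of i t] by (simp add: P_def)
      moreover have "(\<Sum>p<?m. f i * of_bool (e t i = p) * z p) = (\<Sum>p<?m. if p = e t i then f i * z p else 0)"
        by (intro sum.cong) auto
      ultimately show "(\<Sum>p<?m. f i * of_bool (e t i = p) * z p) = f i * z (e t i)" by simp
    qed
    finally show ?thesis .
  qed
  define \<Phi> where "\<Phi> = (\<lambda>p0. L (\<lambda>p. of_bool (p = p0))) ` Dead \<union> (\<Union>t<T. (\<lambda>f. L (ext t f)) ` F t)"
  have fin\<Phi>: "finite \<Phi>" using fin F(1) by (simp add: \<Phi>_def)
  have cardP: "(\<Sum>t<T. card (P t)) + card Dead = ?m"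
  proof -
    have "card {p \<in> {..<?m}. alive p} = (\<Sum>t<T. card (P t))"
    proof -
      have "(\<Sum>t<T. \<Sum>p | p \<in> {p \<in> {..<?m}. alive p} \<and> grp p = t. 1) = (\<Sum>p\<in>{p \<in> {..<?m}. alive p}. (1 :: nat))"
        by (rule sum.group) (use grp_less in auto)
      moreover have "{p. p \<in> {p \<in> {..<?m}. alive p} \<and> grp p = t} = P t" for t by (auto simp: P_def)
      ultimately show ?thesis by simp
    qed
    moreover have "card {p \<in> {..<?m}. alive p} + card Dead = card ({p \<in> {..<?m}. alive p} \<union> Dead)"
      by (rule card_Un_disjoint[symmetric]) (auto simp: Dead_def)
    moreover have "{p \<in> {..<?m}. alive p} \<union> Dead = {..<?m}" by (auto simp: Dead_def)
    ultimately show ?thesis by simp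
  qed
  have card\<Phi>: "real (card \<Phi>) \<le> (1 / real k + \<eta> * (1 - 1 / real k)) * real ?m + real (n + k) * max C 0"
  proof -
    have "card \<Phi> \<le> card ((\<lambda>p0. L (\<lambda>p. of_bool (p = p0))) ` Dead) + card (\<Union>t<T. (\<lambda>f. L (ext t f)) ` F t)"
      unfolding \<Phi>_def by (rule card_Un_le)
    also have "\<dots> \<le> card Dead + (\<Sum>t<T. card (F t))"
    proof (intro add_mono card_image_le fin)
      have "card (\<Union>t<T. (\<lambda>f. L (ext t f)) ` F t) \<le> (\<Sum>t<T. card ((\<lambda>f. L (ext t f)) ` F t))"
        by (rule card_UN_le) simp
      also have "\<dots> \<le> (\<Sum>t<T. card (F t))" by (intro sum_mono card_image_le F)
      finally show "card (\<Union>t<T. (\<lambda>f. L (ext t f)) ` F t) \<le> (\<Sum>t<T. card (F t))" .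
    qed
    finally have "real (card \<Phi>) \<le> real (card Dead + (\<Sum>t<T. card (F t)))" by (simp only: of_nat_le_iff)
    also have "\<dots> = real (card Dead) + (\<Sum>t<T. real (card (F t)))" by simp
    also have "\<dots> \<le> real (card Dead) + (\<Sum>t<T. \<eta> * real (card (P t)) + max C 0)"
      using F(2) by (intro add_left_mono sum_mono) (meson add_left_mono max.cobounded1 order_trans)
    also have "\<dots> = real (card Dead) + \<eta> * real (\<Sum>t<T. card (P t)) + real T * max C 0"
      by (simp add: sum.distrib sum_distrib_left)
    also have "real (\<Sum>t<T. card (P t)) = real ?m - real (card Dead)" using cardP by linarith
    also have "real (card Dead) + \<eta> * (real ?m - real (card Dead)) = (1 - \<eta>) * real (card Dead) + \<eta> * real ?m"
      by (simp add: algebra_simps)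
    \<comment> \<open>Since \<open>\<eta> \<le> 1\<close>, the count grows with the number of dead
      letters, so the upper bound for that number may be inserted.\<close>
    also have "(1 - \<eta>) * real (card Dead) \<le> (1 - \<eta>) * (real ?m / real k)"
      using dead_le \<eta> by (intro mult_left_mono) (auto simp: Dead_def alive_def)
    finally show ?thesis by (simp add: T_def algebra_simps add_divide_distrib diff_divide_distrib)
  qed
  let ?M = "levine_tristram_matrix (cis (2 * pi * \<theta>)) (seifert_matrix w)"
  define a where "a = 1 - cis (2 * pi * \<theta>)"
  have dimV: "dim_row (seifert_matrix w) = ?N" "dim_col (seifert_matrix w) = ?N"
    by (simp_all add: seifert_matrix_def)
  have M: "?M \<in> carrier_mat ?N ?N"
    by (intro carrier_matI) (simp_all add: levine_tristram_matrix_def dimV)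
  have M_index: "?M $$ (i, j) = a * of_int (seifert_matrix w $$ (i, j)) + cnj a * of_int (seifert_matrix w $$ (j, i))"
    if "i < ?N" "j < ?N" for i j
    using that by (simp add: levine_tristram_matrix_def dimV a_def)
  have "matrix_signature ?M \<ge> int ?N - 2 * int (card \<Phi>)"
  proof (rule matrix_signature_ge_set[OF M _ fin\<Phi>])
    show "adj ?M = ?M"
      using M by (intro eq_matI) (auto simp: adj_def M_index)
  next
    fix v :: "nat \<Rightarrow> complex"
    assume v0: "\<exists>i<?N. v i \<noteq> 0" and v\<Phi>: "\<forall>f\<in>\<Phi>. (\<Sum>i<?N. f i * v i) = 0"
    have u1: "cmod (cnj u) = 1" by (simp add: u_def)
    then have u0: "cnj u \<noteq> 0" by auto
    have y_dead: "y v p = 0" if "p < ?m" "\<not> alive p" for p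
    proof -
      have L\<Phi>: "L (\<lambda>q. of_bool (q = p)) \<in> \<Phi>" using that by (auto simp: \<Phi>_def Dead_def)
      have "(\<Sum>a<?N. L (\<lambda>q. of_bool (q = p)) a * v a) = 0" by (rule bspec[OF v\<Phi> L\<Phi>])
      then have "(\<Sum>q<?m. of_bool (q = p) * y v q) = 0" unfolding L .
      moreover have "(\<Sum>q<?m. of_bool (q = p) * y v q) = (\<Sum>q<?m. if q = p then y v q else 0)"
        by (intro sum.cong) auto
      ultimately show ?thesis using that by simp
    qed
    have y_col: "(\<Sum>p | p < ?m \<and> w ! p = i. y v p) = 0" for i
    proof -
      have "(\<Sum>p | p < ?m \<and> w ! p = i. y v p) = cnj u ^ i * (\<Sum>p | p < ?m \<and> w ! p = i. brick_chain w v p)"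
        unfolding sum_distrib_left by (intro sum.cong) (auto simp: y_def)
      then show ?thesis by (simp add: brick_chain_column_sum)
    qed
    let ?x = "\<lambda>t. restrict_index (P t) (y v)"
    define Q where "Q = (\<lambda>t. area_form (card (P t)) s (?Gt t) (?x t))"
    have Q_pos: "Q t > 0" if nz: "\<exists>i<card (P t). ?x t i \<noteq> 0" for t
      unfolding Q_def
    proof (rule F(3)[OF _ _ nz]; intro allI ballI)
      fix i
      have "(\<Sum>p | p < card (P t) \<and> cl (e t p) = i. ?x t p) =
          (\<Sum>p<card (P t). if cl (e t p) = i then y v (e t p) else 0)"
        by (simp add: sum.If_cases Int_def restrict_index_def e_def)
      also have "\<dots> = (\<Sum>p\<in>P t. if cl p = i then y v p else 0)"
        unfolding e_def by (rule sum_sorted_list_of_set[OF fin(1)])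
      also have "\<dots> = (\<Sum>p | p \<in> P t \<and> cl p = i. y v p)"
        using fin by (simp add: sum.If_cases Int_def)
      also have "\<dots> = 0"
      \<comment> \<open>Group \<open>t\<close> meets residue \<open>i\<close> in the single column
        \<open>k t + i - d\<close>, so the sum is a full column sum of the cycle.\<close>
      proof (cases "0 < i \<and> i < k \<and> d \<le> k * t + i")
        case True
        have "p \<in> P t \<and> cl p = i \<longleftrightarrow> p < ?m \<and> w ! p = k * t + i - d" for p
        proof
          assume p: "p \<in> P t \<and> cl p = i"
          then have "w ! p + d = k * t + i" by (auto simp: P_def grp_def cl_def)
          then show "p < ?m \<and> w ! p = k * t + i - d" using p by (auto simp: P_def)
        next
          assume p: "p < ?m \<and> w ! p = k * t + i - d"
          then have "w ! p + d = k * t + i" using True by simp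
          then show "p \<in> P t \<and> cl p = i" using p True by (simp add: P_def alive_def grp_def cl_def)
        qed
        then show ?thesis by (simp add: y_col)
      next
        case False
        have "\<not> (p \<in> P t \<and> cl p = i)" for p
        proof
          assume p: "p \<in> P t \<and> cl p = i"
          then have "w ! p + d = k * t + i" "0 < i" by (auto simp: P_def grp_def cl_def alive_def)
          moreover have "i < k" using p k by (auto simp: cl_def)
          ultimately show False using False by linarith
        qed
        then show ?thesis by (intro sum.neutral) blast
      qed
      finally show "(\<Sum>p | p < card (P t) \<and> cl (e t p) = i. ?x t p) = 0" .
    next
      fix f assume f: "f \<in> F t"
      obtain i where "i < card (P t)" using nz by blast
      then have "e t i \<in> P t" by (rule e_mem)
      then have "t < T" using grp_less[of "e t i"] by (simp add: P_def)
      then have L\<Phi>: "L (ext t f) \<in> \<Phi>" using f by (auto simp: \<Phi>_def)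
      have "(\<Sum>a<?N. L (ext t f) a * v a) = 0" by (rule bspec[OF v\<Phi> L\<Phi>])
      then show "(\<Sum>p<card (P t). f p * ?x t p) = 0"
        unfolding L ext by (simp add: restrict_index_def e_def)
    qed
    have Q_nonneg: "Q t \<ge> 0" for t
    proof (cases "\<exists>i<card (P t). ?x t i \<noteq> 0")
      case True
      then show ?thesis using Q_pos[of t] by simp
    next
      case False
      then show ?thesis by (simp add: Q_def area_form_def)
    qed
    let ?G = "\<lambda>p q. col_gram c (w ! p) (w ! q)"
    have "area_form ?m s ?G (y v) = (\<Sum>t<T. Q t)"
    proof -
      have "area_form ?m s ?G (y v) =
          (\<Sum>t<T. area_form (card (P t)) s (\<lambda>i j. col_gram c (w ! (e t i)) (w ! (e t j))) (?x t))"
        unfolding P_def e_def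
        by (rule area_form_split) (use y_dead grp_less indep in auto)
      also have "\<dots> = (\<Sum>t<T. Q t)"
        unfolding Q_def area_form_def
      proof (intro sum.cong refl arg_cong2[of _ _ _ _ "(+)"] arg_cong2[of _ _ _ _ "(*)"] arg_cong[of _ _ Im] arg_cong[of _ _ of_real])
        fix t i j assume "i \<in> {..<card (P t)}" "j \<in> {..<i}"
        then have "e t i \<in> P t" "e t j \<in> P t" by (auto intro: e_mem)
        then show "col_gram c (w ! e t i) (w ! e t j) = col_gram c (cl (e t i)) (cl (e t j))"
          by (intro same_group) (simp add: P_def)
      qed
      finally show ?thesis .
    qed
    also have "\<dots> > 0"
    proof -
      obtain p where p: "p < ?m" "brick_chain w v p \<noteq> 0" using brick_chain_nonzero[OF v0] by blast
      then have yp: "y v p \<noteq> 0" using u0 by (simp add: y_def)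
      then have "alive p" using y_dead p by blast
      then have pP: "p \<in> P (grp p)" using p by (simp add: P_def)
      then have "p \<in> set (sorted_list_of_set (P (grp p)))" using fin by simp
      then obtain i where "i < card (P (grp p))" "sorted_list_of_set (P (grp p)) ! i = p"
        by (auto simp: in_set_conv_nth)
      then have "Q (grp p) > 0" using yp by (intro Q_pos) (auto simp: restrict_index_def)
      then show ?thesis using grp_less[OF p(1)] Q_nonneg by (intro sum_pos2[of _ "grp p"]) auto
    qed
    finally have pos: "area_form ?m s ?G (y v) > 0" .
    have "(\<Sum>i<?N. \<Sum>j<?N. cnj (v i) * ?M $$ (i, j) * v j) =
        (\<Sum>i<?N. \<Sum>j<?N. cnj (v i) * (a * of_int (seifert_matrix w $$ (i, j)) + cnj a * of_int (seifert_matrix w $$ (j, i))) * v j)"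
      by (intro sum.cong refl) (simp only: M_index lessThan_iff)
    also have "\<dots> = of_real (2 * s * area_form ?m s ?G (y v))"
      unfolding seifert_form_eq y_def u_def s_def c_def a_def
      by (rule letter_form_area) (rule brick_chain_column_sum)
    finally show "Re (\<Sum>i<?N. \<Sum>j<?N. cnj (v i) * ?M $$ (i, j) * v j) > 0"
      using pos s by (simp only: Re_complex_of_real) simp
  qed
  then show ?thesis using card\<Phi> by blast
qed

section \<open>Reduction to an angle below 1/2 and passage to the limit\<close>

lemma algebraic_root_of_unity:
  fixes \<omega> :: complex
  assumes "\<omega> ^ m = 1" "m > 0"
  shows "algebraic \<omega>"
proof (rule algebraicI)
  show "coeff (monom 1 m - 1 :: complex poly) i \<in> \<int>" for i by (simp add: coeff_monom)
  have "coeff (monom 1 m - 1 :: complex poly) m = 1" using assms by simp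
  then show "monom 1 m - 1 \<noteq> (0 :: complex poly)" by (metis coeff_0 zero_neq_one)
  show "poly (monom 1 m - 1) \<omega> = 0" using assms by (simp add: poly_monom)
qed

text \<open>Conjugating \<omega> transposes the matrix, which keeps the characteristic polynomial;
  this reduces everything to the upper half circle.\<close>

lemma matrix_signature_cnj:
  assumes "V \<in> carrier_mat n n"
  shows "matrix_signature (levine_tristram_matrix (cnj \<omega>) V) = matrix_signature (levine_tristram_matrix \<omega> V)"
proof -
  have "levine_tristram_matrix (cnj \<omega>) V = transpose_mat (levine_tristram_matrix \<omega> V)"
    using assms by (intro eq_matI) (auto simp: levine_tristram_matrix_def)
  moreover have "levine_tristram_matrix \<omega> V \<in> carrier_mat n n"
    using assms by (auto simp: levine_tristram_matrix_def)
  ultimately show ?thesis by (simp add: matrix_signature_def)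
qed

lemma word_b1_le: "word_b1 n w \<le> length w"
proof -
  have "surface_components n w = (\<lambda>x. (disc_adjacency w \<union> (disc_adjacency w)\<inverse>)\<^sup>* `` {x}) ` {1..n}"
    by (auto simp: surface_components_def quotient_def)
  then have "card (surface_components n w) \<le> card {1..n}" using card_image_le[of "{1..n}"] by simp
  then show ?thesis by (simp add: word_b1_def)
qed

text \<open>The slope is \<open>1 - 2 \<rho>\<close>, where \<rho> is the asymptotic bound on the
  proportion of nonpositive eigenvalues and depends on \<theta> alone, through the choice of
  \<open>k\<close> and \<eta>. What depends on \<open>n\<close>, namely the constants of the groups
  and the difference between letters and bricks, goes into \<open>K\<close>.\<close>

lemma signature_linear_bound:
  fixes \<omega> :: complex
  assumes "norm \<omega> = 1" and alg: "\<not> algebraic \<omega>"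
  shows "\<exists>c>0. \<forall>n. \<exists>K. \<forall>w\<in>positive_words n.
    real_of_int (matrix_signature (levine_tristram_matrix \<omega> (seifert_matrix w))) \<ge> c * real (word_b1 n w) - K"
proof -
  let ?\<sigma> = "\<lambda>w. real_of_int (matrix_signature (levine_tristram_matrix \<omega> (seifert_matrix w)))"
  obtain \<theta> where \<theta>: "0 < \<theta>" "\<theta> < 1 / 2" and \<omega>: "\<omega> = cis (2 * pi * \<theta>) \<or> \<omega> = cnj (cis (2 * pi * \<theta>))"
  proof -
    define t where "t = Arg \<omega>"
    have "\<omega> \<noteq> 0" using assms(1) by auto
    then have t: "\<omega> = cis t" "- pi < t" "t \<le> pi"
      using assms(1) cis_Arg[of \<omega>] Arg_bounded[of \<omega>] by (auto simp: t_def sgn_div_norm)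
    have "t \<noteq> 0" "t \<noteq> pi"
      using t(1) alg algebraic_root_of_unity[of \<omega> 2] by (auto simp: power2_eq_square cis_mult)
    then have "0 < \<bar>t\<bar> / (2 * pi)" "\<bar>t\<bar> / (2 * pi) < 1 / 2" using t by (auto simp: field_simps)
    moreover have "\<omega> = cis (2 * pi * (\<bar>t\<bar> / (2 * pi))) \<or> \<omega> = cnj (cis (2 * pi * (\<bar>t\<bar> / (2 * pi))))"
      using t(1) by (auto simp: cis_cnj abs_if)
    ultimately show ?thesis using that by blast
  qed
  have root: "\<theta> \<noteq> 1 / real j" if "j > 0" for j :: nat
  proof
    assume "\<theta> = 1 / real j"
    then have "cis (2 * pi * \<theta>) ^ j = 1" using that by (simp add: Complex.DeMoivre)
    then have "\<omega> ^ j = 1" using \<omega> by (auto simp flip: complex_cnj_power)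
    then show False using algebraic_root_of_unity[of \<omega> j] alg that by blast
  qed
  obtain k \<eta> C where k: "k \<ge> 2" "0 \<le> \<eta>" "1 / real k + \<eta> * (1 - 1 / real k) < 1 / 2"
    and ci: "column_index (sin (pi * \<theta>)) (cos (pi * \<theta>)) k \<eta> C"
    using column_index_exists[OF \<theta>] root[of 3] root[of 4] by auto
  have \<eta>1: "\<eta> \<le> 1"
  proof (rule ccontr)
    assume "\<not> \<eta> \<le> 1"
    then have "1 * (1 - 1 / real k) \<le> \<eta> * (1 - 1 / real k)" using k(1) by (intro mult_right_mono) auto
    then show False using k(3) by simp
  qed
  define \<rho> where "\<rho> = 1 / real k + \<eta> * (1 - 1 / real k)"
  have "\<rho> < 1 / 2" unfolding \<rho>_def by (rule k(3))
  then have \<rho>: "1 - 2 * \<rho> > 0" by simp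
  have "\<exists>K. \<forall>w\<in>positive_words n.
      ?\<sigma> w \<ge> (1 - 2 * \<rho>) * real (word_b1 n w) - K" for n
  proof (intro exI[of _ "2 * (real (n + k) * max C 0) + real n"] ballI)
    fix w assume w: "w \<in> positive_words n"
    have V: "seifert_matrix w \<in> carrier_mat (length (bricks w)) (length (bricks w))"
      by (simp add: seifert_matrix_def)
    obtain r where r: "real r \<le> \<rho> * real (length w) + real (n + k) * max C 0"
      "matrix_signature (levine_tristram_matrix (cis (2 * pi * \<theta>)) (seifert_matrix w)) \<ge> int (length (bricks w)) - 2 * int r"
      using levine_tristram_signature_ge[OF \<theta> k(1,2) \<eta>1 ci w] unfolding \<rho>_def by blast
    have "matrix_signature (levine_tristram_matrix \<omega> (seifert_matrix w)) =
        matrix_signature (levine_tristram_matrix (cis (2 * pi * \<theta>)) (seifert_matrix w))"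
      using \<omega> matrix_signature_cnj[OF V] by auto
    with r(2) have 1: "?\<sigma> w \<ge>
        real (length (bricks w)) - 2 * real r" by linarith
    have "card (set w) \<le> card {1..<n}" using w by (intro card_mono) (auto simp: positive_words_def)
    then have "card (set w) \<le> n" by simp
    then have 2: "real (length w) \<le> real (length (bricks w)) + real n" using length_le_bricks[of w] by linarith
    have "(1 - 2 * \<rho>) * real (word_b1 n w) \<le> (1 - 2 * \<rho>) * real (length w)"
      using \<rho> word_b1_le[of n w] by (intro mult_left_mono) auto
    also have "\<dots> = real (length w) - 2 * (\<rho> * real (length w))" by (simp add: algebra_simps)
    finally show "?\<sigma> w \<ge>
        (1 - 2 * \<rho>) * real (word_b1 n w) - (2 * (real (n + k) * max C 0) + real n)"
      using 1 2 r(1) by linarith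
  qed
  with \<rho> show ?thesis by blast
qed

theorem theorem1:
  fixes \<omega> :: complex
  assumes "norm \<omega> = 1" and "\<not> algebraic \<omega>"
  shows "\<exists>c::real. c > 0 \<and> (\<forall>n::nat.
    Liminf (b1_to_infinity n)
      (\<lambda>\<beta>. ereal (real_of_int (braid_signature n \<omega> \<beta>) / real (braid_b1 n \<beta>))) \<ge> ereal c)"
proof -
  let ?\<sigma> = "\<lambda>w. real_of_int (matrix_signature (levine_tristram_matrix \<omega> (seifert_matrix w)))"
  obtain c where c: "c > 0" "\<forall>n. \<exists>K. \<forall>w\<in>positive_words n.
    ?\<sigma> w \<ge> c * real (word_b1 n w) - K"
    using signature_linear_bound[OF assms] by blast
  have "Liminf (b1_to_infinity n)
      (\<lambda>\<beta>. ereal (real_of_int (braid_signature n \<omega> \<beta>) / real (braid_b1 n \<beta>))) \<ge> ereal (c / 2)" for n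
  proof (rule Liminf_bounded)
    obtain K where K: "\<And>w. w \<in> positive_words n \<Longrightarrow>
      ?\<sigma> w \<ge> c * real (word_b1 n w) - K"
      using c(2) by blast
    \<comment> \<open>Beyond \<open>2 K / c\<close> the error \<open>K\<close> costs at most half of
      the slope; \<open>Suc\<close> keeps the denominator positive.\<close>
    define B where "B = Suc (nat \<lceil>2 * K / c\<rceil>)"
    have "ereal (c / 2) \<le> ereal (real_of_int (braid_signature n \<omega> \<beta>) / real (braid_b1 n \<beta>))"
      if \<beta>: "\<beta> \<in> positive_braids n" and large: "B \<le> braid_b1 n \<beta>" for \<beta>
    proof -
      \<comment> \<open>Any representative will do, as the bound with \<open>K\<close> holds for all
        positive words.\<close>
      have "\<exists>w. w \<in> positive_words n \<and> braid_of_word n w = \<beta>" using \<beta> by (auto simp: positive_braids_def)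
      then have "word_of_braid n \<beta> \<in> positive_words n" unfolding word_of_braid_def by (rule someI2_ex) simp
      from K[OF this] have 1: "real_of_int (braid_signature n \<omega> \<beta>) \<ge> c * real (braid_b1 n \<beta>) - K"
        by (simp add: braid_signature_def braid_b1_def)
      have "real (braid_b1 n \<beta>) \<ge> 2 * K / c" "braid_b1 n \<beta> > 0" using large unfolding B_def by linarith+
      then have "K \<le> c / 2 * real (braid_b1 n \<beta>)" "real (braid_b1 n \<beta>) > 0" using c(1) by (simp_all add: field_simps)
      then show ?thesis using 1 by (simp add: field_simps)
    qed
    then show "\<forall>\<^sub>F \<beta> in b1_to_infinity n.
        ereal (c / 2) \<le> ereal (real_of_int (braid_signature n \<omega> \<beta>) / real (braid_b1 n \<beta>))"
      unfolding b1_to_infinity_def eventually_inf_principal eventually_filtercomap eventually_at_top_linorder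
      by (intro exI[of _ "\<lambda>b. B \<le> b"]) auto
  qed
  then show ?thesis using c(1) by (intro exI[of _ "c / 2"]) auto
qed

end
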